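(* Let $E$ be a graph, $K$ a field with involution and $R$ an involutive $K$-algebra. Restriction to $E^0$ gives a bijection between the set of positive, canonical, $K$-linear, $R$-valued traces on $L_K(E)$ and the set of positive $R$-valued graph traces on $E$ (the inverse sends $\delta$ to the unique canonical $K$-linear trace $t_\delta$ with $t_\delta(pq^* )=\delta_{p,q}\delta(\mathbf{r}(p))$). If, in addition, the involution of $R$ is positive definite, restriction to $E^0$ gives a bijection between the set of faithful, canonical, $K$-linear, $R$-valued traces on $L_K(E)$ and the set of faithful $R$-valued graph traces on $E$.
   Context: A (directed) graph $E=(E^0,E^1,\mathbf{s},\mathbf{r})$ has vertex set $E^0$, edge set $E^1$, source and range maps; no finiteness or countability is assumed. A path is a vertex $v$ (length $0$, $\mathbf{s}(v)=\mathbf{r}(v)=v$) or a sequence $p=e_1\cdots e_n$ of edges with $\mathbf{r}(e_i)=\mathbf{s}(e_{i+1})$, $\mathbf{s}(p)=\mathbf{s}(e_1)$, $\mathbf{r}(p)=\mathbf{r}(e_n)$. A vertex $v$ is regular if $\mathbf{s}^{-1}(v)$ is nonempty and finite. $K$ is a field with an arbitrary involution. $L_K(E)$ is the free $K$-algebra generated by $E^0\cup E^1\cup\{e^*:e\in E^1\}$ subject to (V) $vw=\delta_{v,w}v$; (E1) $\mathbf{s}(e)e=e\mathbf{r}(e)=e$; (E2) $\mathbf{r}(e)e^*=e^*\mathbf{s}(e)=e^*$; (CK1) $e^*f=\delta_{e,f}\mathbf{r}(e)$; (CK2) $v=\sum_{e\in\mathbf{s}^{-1}(v)}ee^*$ for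 regular $v$; with $p^*=e_n^*\cdots e_1^*$, $v^*=v$, it is involutive via $(\sum a_ip_iq_i^* )^*=\sum a_i^*q_ip_i^*$. An involutive $K$-algebra is a $K$-algebra with an involution satisfying $(ax)^*=a^*x^*$. $x\ge0$ means $x$ is a finite sum of elements $zz^*$; $x>0$ means $x\ge 0$, $x\ne0$; $x\ge y$ means $x-y\ge0$; the involution is positive definite if $\sum x_ix_i^*=0$ implies all $x_i=0$. A trace is an additive map with $t(xy)=t(yx)$; $K$-linear means $t(ax)=at(x)$; positive means $x\ge0\Rightarrow t(x)\ge0$; faithful means $x>0\Rightarrow t(x)>0$. A trace on $L_K(E)$ is canonical if $t(pq^* )=\delta_{p,q}t(\mathbf{r}(p))$ for all paths $p,q$ with $\mathbf{r}(p)=\mathbf{r}(q)$. An $R$-valued graph trace on $E$ is a map $\delta:E^0\to R$ with $\delta(v)=\sum_{e\in\mathbf{s}^{-1}(v)}\delta(\mathbf{r}(e))$ for every regular vertex $v$; it is positive if $\delta(v)\ge\sum_{e\in I}\delta(\mathbf{r}(e))$ for every vertex $v$ and every finite $I\subseteq\mathbf{s}^{-1}(v)$ (empty sum $=0$), and faithful if it is positive and $\delta(v)>0$ for every vertex $v$. *)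

theory Defs
  imports "HOL-Library.FuncSet"
begin

record ('v,'e) graph =
  verts :: "'v set"
  edges :: "'e set"
  src :: "'e \<Rightarrow> 'v"
  rng :: "'e \<Rightarrow> 'v"

definition wf_graph :: "('v,'e) graph \<Rightarrow> bool" where
  "wf_graph G \<longleftrightarrow> src G ` edges G \<subseteq> verts G \<and> rng G ` edges G \<subseteq> verts G"

definition out_edges :: "('v,'e) graph \<Rightarrow> 'v \<Rightarrow> 'e set" where
  "out_edges G v = {e \<in> edges G. src G e = v}"

definition regular :: "('v,'e) graph \<Rightarrow> 'v \<Rightarrow> bool" where
  "regular G v \<longleftrightarrow> v \<in> verts G \<and> out_edges G v \<noteq> {} \<and> finite (out_edges G v)"

text \<open>A path is a pair (v, es): (v, []) is the vertex v (length 0); (v, es) with es nonempty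
  is the edge path es, whose source is v.\<close>

definition is_path :: "('v,'e) graph \<Rightarrow> 'v \<times> 'e list \<Rightarrow> bool" where
  "is_path G p \<longleftrightarrow> (case p of (v, es) \<Rightarrow>
     v \<in> verts G \<and> set es \<subseteq> edges G \<and>
     (es \<noteq> [] \<longrightarrow> src G (hd es) = v \<and>
        (\<forall>i. Suc i < length es \<longrightarrow> rng G (es ! i) = src G (es ! Suc i))))"

definition path_rng :: "('v,'e) graph \<Rightarrow> 'v \<times> 'e list \<Rightarrow> 'v" where
  "path_rng G p = (case p of (v, es) \<Rightarrow> if es = [] then v else rng G (last es))"

definition field_involution :: "('k::field \<Rightarrow> 'k) \<Rightarrow> bool" where
  "field_involution invK \<longleftrightarrow>
     (\<forall>a b. invK (a + b) = invK a + invK b) \<and>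
     (\<forall>a b. invK (a * b) = invK a * invK b) \<and>
     (\<forall>a. invK (invK a) = a)"

definition involutive_algebra ::
  "('k::field \<Rightarrow> 'k) \<Rightarrow> ('k \<Rightarrow> 'r::ring \<Rightarrow> 'r) \<Rightarrow> ('r \<Rightarrow> 'r) \<Rightarrow> bool" where
  "involutive_algebra invK smul star \<longleftrightarrow>
     (\<forall>a x y. smul a (x + y) = smul a x + smul a y) \<and>
     (\<forall>a b x. smul (a + b) x = smul a x + smul b x) \<and>
     (\<forall>a b x. smul (a * b) x = smul a (smul b x)) \<and>
     (\<forall>x. smul 1 x = x) \<and>
     (\<forall>a x y. smul a (x * y) = smul a x * y) \<and>
     (\<forall>a x y. smul a (x * y) = x * smul a y) \<and>
     (\<forall>x y. star (x + y) = star x + star y) \<and>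
     (\<forall>x y. star (x * y) = star y * star x) \<and>
     (\<forall>x. star (star x) = x) \<and>
     (\<forall>a x. star (smul a x) = smul (invK a) (star x))"

definition nonnegR :: "('r::ring \<Rightarrow> 'r) \<Rightarrow> 'r \<Rightarrow> bool" where
  "nonnegR star x \<longleftrightarrow> (\<exists>zs. x = sum_list (map (\<lambda>z. z * star z) zs))"

definition posR :: "('r::ring \<Rightarrow> 'r) \<Rightarrow> 'r \<Rightarrow> bool" where
  "posR star x \<longleftrightarrow> nonnegR star x \<and> x \<noteq> 0"

definition geR :: "('r::ring \<Rightarrow> 'r) \<Rightarrow> 'r \<Rightarrow> 'r \<Rightarrow> bool" where
  "geR star x y \<longleftrightarrow> nonnegR star (x - y)"

definition positive_definite :: "('r::ring \<Rightarrow> 'r) \<Rightarrow> bool" where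
  "positive_definite star \<longleftrightarrow>
     (\<forall>zs. sum_list (map (\<lambda>z. z * star z) zs) = 0 \<longrightarrow> (\<forall>z\<in>set zs. z = 0))"

definition graph_trace :: "('v,'e) graph \<Rightarrow> ('v \<Rightarrow> 'r::ring) \<Rightarrow> bool" where
  "graph_trace G \<delta> \<longleftrightarrow>
     (\<forall>v. regular G v \<longrightarrow> \<delta> v = (\<Sum>e\<in>out_edges G v. \<delta> (rng G e)))"

definition positive_graph_trace :: "('v,'e) graph \<Rightarrow> ('r::ring \<Rightarrow> 'r) \<Rightarrow> ('v \<Rightarrow> 'r) \<Rightarrow> bool" where
  "positive_graph_trace G star \<delta> \<longleftrightarrow> graph_trace G \<delta> \<and>
     (\<forall>v\<in>verts G. \<forall>I. finite I \<and> I \<subseteq> out_edges G v \<longrightarrow>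
        geR star (\<delta> v) (\<Sum>e\<in>I. \<delta> (rng G e)))"

definition faithful_graph_trace :: "('v,'e) graph \<Rightarrow> ('r::ring \<Rightarrow> 'r) \<Rightarrow> ('v \<Rightarrow> 'r) \<Rightarrow> bool" where
  "faithful_graph_trace G star \<delta> \<longleftrightarrow> positive_graph_trace G star \<delta> \<and>
     (\<forall>v\<in>verts G. posR star (\<delta> v))"

datatype ('v,'e) gen = Vx 'v | Ex 'e | Gx 'e  \<comment> \<open>vertex, edge, ghost edge e^*\<close>

text \<open>Elements of the free algebra: finitely supported K-valued functions on nonempty words
  over the generators, multiplication = concatenation (convolution).\<close>

type_synonym ('v,'e,'k) fa = "('v,'e) gen list \<Rightarrow> 'k"

definition valid_gen :: "('v,'e) graph \<Rightarrow> ('v,'e) gen \<Rightarrow> bool" where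
  "valid_gen G g = (case g of Vx v \<Rightarrow> v \<in> verts G | Ex e \<Rightarrow> e \<in> edges G | Gx e \<Rightarrow> e \<in> edges G)"

definition free_alg :: "('v,'e) graph \<Rightarrow> ('v,'e,'k::field) fa set" where
  "free_alg G = {f. finite {w. f w \<noteq> 0} \<and>
      (\<forall>w. f w \<noteq> 0 \<longrightarrow> w \<noteq> [] \<and> (\<forall>g\<in>set w. valid_gen G g))}"

definition fzero :: "('v,'e,'k::field) fa" where "fzero = (\<lambda>w. 0)"
definition fadd :: "('v,'e,'k::field) fa \<Rightarrow> ('v,'e,'k) fa \<Rightarrow> ('v,'e,'k) fa" where
  "fadd f g = (\<lambda>w. f w + g w)"
definition fneg :: "('v,'e,'k::field) fa \<Rightarrow> ('v,'e,'k) fa" where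
  "fneg f = (\<lambda>w. - f w)"
definition fsmul :: "'k::field \<Rightarrow> ('v,'e,'k) fa \<Rightarrow> ('v,'e,'k) fa" where
  "fsmul a f = (\<lambda>w. a * f w)"
definition fmul :: "('v,'e,'k::field) fa \<Rightarrow> ('v,'e,'k) fa \<Rightarrow> ('v,'e,'k) fa" where
  "fmul f g = (\<lambda>w. \<Sum>i\<le>length w. f (take i w) * g (drop i w))"

fun gen_star :: "('v,'e) gen \<Rightarrow> ('v,'e) gen" where
  "gen_star (Vx v) = Vx v"
| "gen_star (Ex e) = Gx e"
| "gen_star (Gx e) = Ex e"

text \<open>The involution: (a w)^* = a^* w^*, with (g1...gn)^* = gn^*...g1^*.\<close>
definition fstar :: "('k::field \<Rightarrow> 'k) \<Rightarrow> ('v,'e,'k) fa \<Rightarrow> ('v,'e,'k) fa" where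
  "fstar invK f = (\<lambda>w. invK (f (rev (map gen_star w))))"

definition mono :: "('v,'e) gen list \<Rightarrow> ('v,'e,'k::field) fa" where
  "mono w = (\<lambda>u. if u = w then 1 else 0)"

definition lpa_rels :: "('v,'e) graph \<Rightarrow> ('v,'e,'k::field) fa set" where
  "lpa_rels G =
     {fadd (mono [Vx v, Vx w]) (fneg (if v = w then mono [Vx v] else fzero)) | v w.
        v \<in> verts G \<and> w \<in> verts G}
   \<union> {fadd (mono [Vx (src G e), Ex e]) (fneg (mono [Ex e])) | e. e \<in> edges G}
   \<union> {fadd (mono [Ex e, Vx (rng G e)]) (fneg (mono [Ex e])) | e. e \<in> edges G}
   \<union> {fadd (mono [Vx (rng G e), Gx e]) (fneg (mono [Gx e])) | e. e \<in> edges G}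
   \<union> {fadd (mono [Gx e, Vx (src G e)]) (fneg (mono [Gx e])) | e. e \<in> edges G}
   \<union> {fadd (mono [Gx e, Ex f]) (fneg (if e = f then mono [Vx (rng G e)] else fzero)) | e f.
        e \<in> edges G \<and> f \<in> edges G}
   \<union> {fadd (mono [Vx v]) (fneg (\<lambda>u. \<Sum>e\<in>out_edges G v. mono [Ex e, Gx e] u)) | v.
        regular G v}"

inductive_set lpa_ideal :: "('v,'e) graph \<Rightarrow> ('v,'e,'k::field) fa set"
  for G :: "('v,'e) graph" where
  rel: "x \<in> lpa_rels G \<Longrightarrow> x \<in> lpa_ideal G"
| zero: "fzero \<in> lpa_ideal G"
| add: "x \<in> lpa_ideal G \<Longrightarrow> y \<in> lpa_ideal G \<Longrightarrow> fadd x y \<in> lpa_ideal G"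
| smul: "x \<in> lpa_ideal G \<Longrightarrow> fsmul a x \<in> lpa_ideal G"
| lmul: "x \<in> lpa_ideal G \<Longrightarrow> f \<in> free_alg G \<Longrightarrow> fmul f x \<in> lpa_ideal G"
| rmul: "x \<in> lpa_ideal G \<Longrightarrow> f \<in> free_alg G \<Longrightarrow> fmul x f \<in> lpa_ideal G"

definition lpa_rel :: "('v,'e) graph \<Rightarrow> (('v,'e,'k::field) fa \<times> ('v,'e,'k) fa) set" where
  "lpa_rel G = {(x, y). x \<in> free_alg G \<and> y \<in> free_alg G \<and> fadd x (fneg y) \<in> lpa_ideal G}"

definition LPA :: "('v,'e) graph \<Rightarrow> ('v,'e,'k::field) fa set set" where
  "LPA G = free_alg G // lpa_rel G"

definition cls :: "('v,'e) graph \<Rightarrow> ('v,'e,'k::field) fa \<Rightarrow> ('v,'e,'k) fa set" where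
  "cls G x = lpa_rel G `` {x}"

definition rep :: "('v,'e,'k::field) fa set \<Rightarrow> ('v,'e,'k) fa" where
  "rep X = (SOME x. x \<in> X)"

definition zeroL :: "('v,'e) graph \<Rightarrow> ('v,'e,'k::field) fa set" where
  "zeroL G = cls G fzero"
definition addL :: "('v,'e) graph \<Rightarrow> ('v,'e,'k::field) fa set \<Rightarrow> ('v,'e,'k) fa set \<Rightarrow> ('v,'e,'k) fa set" where
  "addL G X Y = cls G (fadd (rep X) (rep Y))"
definition multL :: "('v,'e) graph \<Rightarrow> ('v,'e,'k::field) fa set \<Rightarrow> ('v,'e,'k) fa set \<Rightarrow> ('v,'e,'k) fa set" where
  "multL G X Y = cls G (fmul (rep X) (rep Y))"
definition smulL :: "('v,'e) graph \<Rightarrow> 'k::field \<Rightarrow> ('v,'e,'k) fa set \<Rightarrow> ('v,'e,'k) fa set" where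
  "smulL G a X = cls G (fsmul a (rep X))"
definition starL :: "('v,'e) graph \<Rightarrow> ('k::field \<Rightarrow> 'k) \<Rightarrow> ('v,'e,'k) fa set \<Rightarrow> ('v,'e,'k) fa set" where
  "starL G invK X = cls G (fstar invK (rep X))"

definition vertL :: "('v,'e) graph \<Rightarrow> 'v \<Rightarrow> ('v,'e,'k::field) fa set" where
  "vertL G v = cls G (mono [Vx v])"

definition pathL :: "('v,'e) graph \<Rightarrow> 'v \<times> 'e list \<Rightarrow> ('v,'e,'k::field) fa set" where
  "pathL G p = (case p of (v, es) \<Rightarrow>
      if es = [] then cls G (mono [Vx v]) else cls G (mono (map Ex es)))"

definition nonnegL :: "('v,'e) graph \<Rightarrow> ('k::field \<Rightarrow> 'k) \<Rightarrow> ('v,'e,'k) fa set \<Rightarrow> bool" where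
  "nonnegL G invK X \<longleftrightarrow> (\<exists>zs. set zs \<subseteq> LPA G \<and>
      X = foldr (\<lambda>z acc. addL G (multL G z (starL G invK z)) acc) zs (zeroL G))"

definition posL :: "('v,'e) graph \<Rightarrow> ('k::field \<Rightarrow> 'k) \<Rightarrow> ('v,'e,'k) fa set \<Rightarrow> bool" where
  "posL G invK X \<longleftrightarrow> nonnegL G invK X \<and> X \<noteq> zeroL G"

definition lpa_trace :: "('v,'e) graph \<Rightarrow> (('v,'e,'k::field) fa set \<Rightarrow> 'r::ring) \<Rightarrow> bool" where
  "lpa_trace G t \<longleftrightarrow>
     (\<forall>X\<in>LPA G. \<forall>Y\<in>LPA G. t (addL G X Y) = t X + t Y) \<and>
     (\<forall>X\<in>LPA G. \<forall>Y\<in>LPA G. t (multL G X Y) = t (multL G Y X))"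

definition lpa_Klinear :: "('v,'e) graph \<Rightarrow> ('k::field \<Rightarrow> 'r::ring \<Rightarrow> 'r) \<Rightarrow> (('v,'e,'k) fa set \<Rightarrow> 'r) \<Rightarrow> bool" where
  "lpa_Klinear G smul t \<longleftrightarrow> (\<forall>a. \<forall>X\<in>LPA G. t (smulL G a X) = smul a (t X))"

definition lpa_positive :: "('v,'e) graph \<Rightarrow> ('k::field \<Rightarrow> 'k) \<Rightarrow> ('r::ring \<Rightarrow> 'r) \<Rightarrow> (('v,'e,'k) fa set \<Rightarrow> 'r) \<Rightarrow> bool" where
  "lpa_positive G invK star t \<longleftrightarrow> (\<forall>X\<in>LPA G. nonnegL G invK X \<longrightarrow> nonnegR star (t X))"

definition lpa_faithful :: "('v,'e) graph \<Rightarrow> ('k::field \<Rightarrow> 'k) \<Rightarrow> ('r::ring \<Rightarrow> 'r) \<Rightarrow> (('v,'e,'k) fa set \<Rightarrow> 'r) \<Rightarrow> bool" where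
  "lpa_faithful G invK star t \<longleftrightarrow> (\<forall>X\<in>LPA G. posL G invK X \<longrightarrow> posR star (t X))"

definition lpa_canonical :: "('v,'e) graph \<Rightarrow> ('k::field \<Rightarrow> 'k) \<Rightarrow> (('v,'e,'k) fa set \<Rightarrow> 'r::ring) \<Rightarrow> bool" where
  "lpa_canonical G invK t \<longleftrightarrow>
     (\<forall>p q. is_path G p \<longrightarrow> is_path G q \<longrightarrow> path_rng G p = path_rng G q \<longrightarrow>
        t (multL G (pathL G p) (starL G invK (pathL G q))) =
        (if p = q then t (vertL G (path_rng G p)) else 0))"

definition restrict_E0 :: "('v,'e) graph \<Rightarrow> (('v,'e,'k::field) fa set \<Rightarrow> 'r) \<Rightarrow> 'v \<Rightarrow> 'r" where
  "restrict_E0 G t = restrict (\<lambda>v. t (vertL G v)) (verts G)"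

end

theory Submission
  imports Defs HOL.Modules "HOL-Library.Function_Algebras"
begin

text \<open>Words in the generators act on finite paths as partial injections; modulo the ideal every
  nonempty word is \<open>0\<close> or some \<open>p q*\<close>, which acts as \<open>q x \<mapsto> p x\<close>. The paths fixed by a word
  therefore form a cylinder \<open>q \<cdot> (paths)\<close> or the empty set, and for a graph trace \<open>\<delta>\<close> the assignment
  \<open>w \<mapsto> \<delta> (r q)\<close> is compatible with the relations and invariant under cyclic permutation: it is
  \<open>t\<^sub>\<delta>\<close>. For a finite prefix-closed set \<open>D\<close> of paths containing the cylinders of the words of \<open>f\<close>,
  \<open>t\<^sub>\<delta> (f f*)\<close> is the sum over \<open>u \<in> D\<close> of \<open>(\<Sum>x. F u x * (F u x)*) \<cdot> m u\<close>, where \<open>F u x\<close> collects the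
  coefficients of the words that map \<open>u\<close> to \<open>x\<close> and \<open>m u = \<delta> (r u) - (\<Sum>u e \<in> D. \<delta> (r e))\<close>; this is
  nonnegative when \<open>\<delta>\<close> is. If \<open>\<delta>\<close> is faithful, then \<open>m u = 0\<close> only where (CK2) applies, so that
  \<open>t\<^sub>\<delta> (f f*) = 0\<close> forces \<open>f = 0\<close> in the Leavitt path algebra.\<close>

section \<open>The free algebra\<close>

text \<open>The elements \<open>p q*\<close> span the Leavitt path algebra but (CK2) makes them
  dependent, so a functional cannot simply be prescribed on them. The set of paths fixed by a word,
  however, depends on the word alone, and a functional on words descends once it kills every
  relation placed between two words. The action on finite paths respects all relations except (CK2):
  the path of length 0 at a regular \<open>v\<close> is fixed by \<open>v\<close> and by no
  \<open>e e*\<close>. The graph trace equation matches exactly this defect.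

  The domains of the words of \<open>f\<close> may be nested, so they do not diagonalise
  \<open>f f*\<close>. The remedy is to cut cylinders into disjoint parts: \<open>m u\<close> is the
  value of the cylinder of \<open>u\<close> minus its children in \<open>D\<close>. As for
  faithfulness: if \<open>m u = 0\<close> and some edge \<open>e\<close> at the end of
  \<open>u\<close> did not continue \<open>u\<close> inside \<open>D\<close>, positivity of
  \<open>\<delta>\<close> with \<open>e\<close> added would give
  \<open>- \<delta> (r e) \<ge> 0\<close>, which positive definiteness excludes because
  \<open>\<delta> (r e) > 0\<close>. So all edges continue \<open>u\<close>, and (CK2) removes the
  term at \<open>u\<close>.\<close>

lemmas pointwise = zero_fun_apply plus_fun_apply minus_apply uminus_apply

text \<open>As simp rules these would turn equations and memberships between functions into \<open>\<lambda>\<close>-terms.\<close>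

declare pointwise [simp del]

lemma fzero_eq: "fzero = 0"
  by (simp add: fzero_def zero_fun_def)

lemma fadd_eq: "fadd f g = f + g"
  by (simp add: fadd_def plus_fun_def)

lemma fneg_eq: "fneg f = - f"
  by (simp add: fneg_def fun_Compl_def)

lemma sum_fun_apply: "(\<Sum>i\<in>A. F i) x = (\<Sum>i\<in>A. F i x)"
  for F :: "'i \<Rightarrow> 'a \<Rightarrow> 'b::comm_monoid_add"
  by (induction A rule: infinite_finite_induct) (auto simp: pointwise)

lemma fsmul_diff: "fsmul a (f - g) = fsmul a f - fsmul a g"
  by (rule ext) (simp add: pointwise fsmul_def algebra_simps)

lemma fsmul_0_left: "fsmul 0 f = 0"
  by (rule ext) (simp add: pointwise fsmul_def)

lemma fsmul_minus_1: "fsmul (- 1) f = - f"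
  by (rule ext) (simp add: pointwise fsmul_def)

lemma fmul_add_left: "fmul (f + g) h = fmul f h + fmul g h"
  by (rule ext) (simp add: pointwise fmul_def algebra_simps sum.distrib)

lemma fmul_add_right: "fmul h (f + g) = fmul h f + fmul h g"
  by (rule ext) (simp add: pointwise fmul_def algebra_simps sum.distrib)

lemma fmul_diff_left: "fmul (f - g) h = fmul f h - fmul g h"
  by (rule ext) (simp add: pointwise fmul_def algebra_simps sum_subtractf)

lemma fmul_diff_right: "fmul h (f - g) = fmul h f - fmul h g"
  by (rule ext) (simp add: pointwise fmul_def algebra_simps sum_subtractf)

lemma fmul_0_left: "fmul 0 h = 0"
  by (rule ext) (simp add: pointwise fmul_def)

lemma fmul_0_right: "fmul h 0 = 0"
  by (rule ext) (simp add: pointwise fmul_def)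

lemma fmul_sum_left: "fmul (\<Sum>i\<in>A. F i) h = (\<Sum>i\<in>A. fmul (F i) h)"
  by (induction A rule: infinite_finite_induct) (simp_all add: fmul_add_left fmul_0_left)

lemma fmul_sum_right: "fmul h (\<Sum>i\<in>A. F i) = (\<Sum>i\<in>A. fmul h (F i))"
  by (induction A rule: infinite_finite_induct) (simp_all add: fmul_add_right fmul_0_right)

lemma take_drop_eq_iff: "i \<le> length w \<Longrightarrow> take i w = u \<and> drop i w = v \<longleftrightarrow> w = u @ v \<and> i = length u"
  by (metis append_eq_conv_conj append_take_drop_id length_take min.absorb2)

lemma fmul_mono_mono: "fmul (mono u) (mono v) = (mono (u @ v) :: ('v,'e,'k::field) fa)"
proof
  fix w :: "('v,'e) gen list"
  have "fmul (mono u) (mono v) w =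
      (\<Sum>i\<le>length w. if i = length u then (if w = u @ v then 1 else 0) else (0::'k))"
    unfolding fmul_def
  proof (rule sum.cong)
    fix i assume "i \<in> {..length w}"
    then have "take i w = u \<and> drop i w = v \<longleftrightarrow> w = u @ v \<and> i = length u"
      by (intro take_drop_eq_iff) simp
    moreover have "mono u (take i w) * mono v (drop i w) =
        (if take i w = u \<and> drop i w = v then 1 else (0::'k))"
      by (simp add: mono_def)
    ultimately show "mono u (take i w) * mono v (drop i w) =
        (if i = length u then (if w = u @ v then 1 else 0) else (0::'k))"
      by presburger
  qed simp
  also have "\<dots> = mono (u @ v) w"
    by (auto simp: mono_def)
  finally show "fmul (mono u) (mono v) w = (mono (u @ v) w :: 'k)" .
qed

text \<open>The empty word lies outside \<open>free_alg\<close>, yet convolution with it is the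
  identity. Together with \<open>valid_word\<close>, which admits \<open>[]\<close>, this allows
  contexts around a word to be empty.\<close>

lemma fmul_mono_Nil_left: "fmul (mono []) f = (f :: ('v,'e,'k::field) fa)"
proof
  fix w :: "('v,'e) gen list"
  have "fmul (mono []) f w = (\<Sum>i\<le>length w. if i = 0 then f w else 0)"
    unfolding fmul_def by (rule sum.cong) (auto simp: mono_def)
  then show "fmul (mono []) f w = f w" by simp
qed

lemma fmul_mono_Nil_right: "fmul f (mono []) = (f :: ('v,'e,'k::field) fa)"
proof
  fix w :: "('v,'e) gen list"
  have "fmul f (mono []) w = (\<Sum>i\<le>length w. if i = length w then f w else 0)"
    unfolding fmul_def by (rule sum.cong) (auto simp: mono_def)
  then show "fmul f (mono []) w = f w" by simp
qed

definition valid_word :: "('v,'e) graph \<Rightarrow> ('v,'e) gen list \<Rightarrow> bool" where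
  "valid_word G w \<longleftrightarrow> (\<forall>g\<in>set w. valid_gen G g)"

lemma valid_word_simps [simp]:
  "valid_word G []"
  "valid_word G (g # w) \<longleftrightarrow> valid_gen G g \<and> valid_word G w"
  "valid_word G (u @ w) \<longleftrightarrow> valid_word G u \<and> valid_word G w"
  "valid_word G (rev w) \<longleftrightarrow> valid_word G w"
  by (auto simp: valid_word_def)

lemma valid_gen_simps [simp]:
  "valid_gen G (Vx v) \<longleftrightarrow> v \<in> verts G"
  "valid_gen G (Ex e) \<longleftrightarrow> e \<in> edges G"
  "valid_gen G (Gx e) \<longleftrightarrow> e \<in> edges G"
  by (auto simp: valid_gen_def)

lemma free_algI:
  assumes "finite {w. f w \<noteq> 0}" "\<And>w. f w \<noteq> 0 \<Longrightarrow> w \<noteq> [] \<and> valid_word G w"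
  shows "f \<in> free_alg G"
  using assms by (auto simp: free_alg_def valid_word_def)

lemma free_alg_finite: "f \<in> free_alg G \<Longrightarrow> finite {w. f w \<noteq> 0}"
  by (simp add: free_alg_def)

lemma free_alg_word: "f \<in> free_alg G \<Longrightarrow> f w \<noteq> 0 \<Longrightarrow> w \<noteq> [] \<and> valid_word G w"
  by (simp add: free_alg_def valid_word_def)

lemma free_alg_zero: "0 \<in> free_alg G"
  by (simp add: free_alg_def pointwise)

lemma free_alg_mono: "w \<noteq> [] \<Longrightarrow> valid_word G w \<Longrightarrow> mono w \<in> free_alg G"
  by (simp add: free_alg_def mono_def valid_word_def)

lemma free_alg_add:
  assumes f: "f \<in> free_alg G" and g: "g \<in> free_alg G"
  shows "f + g \<in> free_alg G"
proof (rule free_algI)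
  have "{w. (f + g) w \<noteq> 0} \<subseteq> {w. f w \<noteq> 0} \<union> {w. g w \<noteq> 0}" by (auto simp: pointwise)
  then show "finite {w. (f + g) w \<noteq> 0}"
    using free_alg_finite[OF f] free_alg_finite[OF g] by (meson finite_UnI finite_subset)
next
  fix w assume "(f + g) w \<noteq> 0"
  then have "f w \<noteq> 0 \<or> g w \<noteq> 0" by (auto simp: pointwise)
  then show "w \<noteq> [] \<and> valid_word G w"
    using free_alg_word[OF f] free_alg_word[OF g] by blast
qed

lemma free_alg_smul:
  assumes f: "f \<in> free_alg G"
  shows "fsmul a f \<in> free_alg G"
proof (rule free_algI)
  have "{w. fsmul a f w \<noteq> 0} \<subseteq> {w. f w \<noteq> 0}" by (auto simp: fsmul_def)
  then show "finite {w. fsmul a f w \<noteq> 0}"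
    using free_alg_finite[OF f] finite_subset by blast
next
  fix w assume "fsmul a f w \<noteq> 0"
  then show "w \<noteq> [] \<and> valid_word G w"
    using free_alg_word[OF f] by (auto simp: fsmul_def)
qed

lemma free_alg_uminus: "f \<in> free_alg G \<Longrightarrow> - f \<in> free_alg G"
  using free_alg_smul[of f G "-1"] by (simp add: fsmul_minus_1)

lemma free_alg_diff: "f \<in> free_alg G \<Longrightarrow> g \<in> free_alg G \<Longrightarrow> f - g \<in> free_alg G"
  using free_alg_add[of f G "- g"] free_alg_uminus[of g G] by simp

lemma free_alg_sum: "(\<And>i. i \<in> A \<Longrightarrow> F i \<in> free_alg G) \<Longrightarrow> (\<Sum>i\<in>A. F i) \<in> free_alg G"
  by (induction A rule: infinite_finite_induct) (auto simp: free_alg_zero free_alg_add)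

lemma fmul_nonzeroE:
  assumes "fmul f g w \<noteq> 0"
  obtains u v where "w = u @ v" "f u \<noteq> 0" "g v \<noteq> 0"
proof -
  obtain i where "f (take i w) * g (drop i w) \<noteq> 0"
    using assms unfolding fmul_def by (meson sum.not_neutral_contains_not_neutral)
  then show thesis
    using that[of "take i w" "drop i w"] by auto
qed

lemma free_alg_mul:
  assumes f: "f \<in> free_alg G" and g: "g \<in> free_alg G"
  shows "fmul f g \<in> free_alg G"
proof (rule free_algI)
  have "{w. fmul f g w \<noteq> 0} \<subseteq> (\<lambda>(u, v). u @ v) ` ({w. f w \<noteq> 0} \<times> {w. g w \<noteq> 0})"
    by (force elim: fmul_nonzeroE)
  then show "finite {w. fmul f g w \<noteq> 0}"
    using free_alg_finite[OF f] free_alg_finite[OF g]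
    by (meson finite_SigmaI finite_imageI finite_subset)
next
  fix w assume "fmul f g w \<noteq> 0"
  then obtain u v where "w = u @ v" "f u \<noteq> 0" "g v \<noteq> 0" by (rule fmul_nonzeroE)
  then show "w \<noteq> [] \<and> valid_word G w"
    using free_alg_word[OF f] free_alg_word[OF g] by auto
qed

lemma free_alg_expand:
  assumes "finite A" "{w. f w \<noteq> 0} \<subseteq> A"
  shows "f = (\<Sum>w\<in>A. fsmul (f w) (mono w))"
proof
  fix w
  have "(\<Sum>u\<in>A. fsmul (f u) (mono u)) w = (\<Sum>u\<in>A. if u = w then f w else 0)"
    unfolding sum_fun_apply by (rule sum.cong) (auto simp: fsmul_def mono_def)
  then show "f w = (\<Sum>w\<in>A. fsmul (f w) (mono w)) w"
    using assms by auto
qed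

definition word_star :: "('v,'e) gen list \<Rightarrow> ('v,'e) gen list" where
  "word_star w = rev (map gen_star w)"

lemma gen_star_gen_star [simp]: "gen_star (gen_star g) = g"
  by (cases g) auto

lemma word_star_word_star [simp]: "word_star (word_star w) = w"
  by (simp add: word_star_def rev_map o_def)

lemma word_star_append: "word_star (u @ w) = word_star w @ word_star u"
  by (simp add: word_star_def)

lemma word_star_Nil_iff [simp]: "word_star w = [] \<longleftrightarrow> w = []"
  by (simp add: word_star_def)

lemma valid_word_star [simp]: "valid_word G (word_star w) \<longleftrightarrow> valid_word G w"
proof -
  have "valid_gen G (gen_star g) \<longleftrightarrow> valid_gen G g" for g :: "('a,'b) gen"
    by (cases g) auto
  then show ?thesis by (auto simp: valid_word_def word_star_def)
qed

lemma fstar_apply: "fstar invK f w = invK (f (word_star w))"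
  by (simp add: fstar_def word_star_def)

text \<open>The K-linear extension of a function on words. A sum over an infinite support is 0 by
  default, so additivity is claimed for finite supports.\<close>

definition lin :: "('k::field \<Rightarrow> 'r::ring \<Rightarrow> 'r) \<Rightarrow> (('v,'e) gen list \<Rightarrow> 'r) \<Rightarrow> ('v,'e,'k) fa \<Rightarrow> 'r" where
  "lin smul \<phi> f = (\<Sum>w | f w \<noteq> 0. smul (f w) (\<phi> w))"

context
  fixes smul :: "'k::field \<Rightarrow> 'r::ring \<Rightarrow> 'r"
  assumes mod: "module smul"
begin

interpretation module smul by (rule mod)

lemma lin_superset:
  assumes "finite A" "{w. f w \<noteq> 0} \<subseteq> A"
  shows "lin smul \<phi> f = (\<Sum>w\<in>A. smul (f w) (\<phi> w))"
  unfolding lin_def using assms by (intro sum.mono_neutral_left) auto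

lemma lin_mono: "lin smul \<phi> (mono w) = \<phi> w"
  by (subst lin_superset[of "{w}"]) (auto simp: mono_def split: if_splits)

lemma lin_zero: "lin smul \<phi> 0 = 0"
  by (simp add: lin_def pointwise)

lemma lin_add:
  assumes "finite {w. f w \<noteq> 0}" "finite {w. g w \<noteq> 0}"
  shows "lin smul \<phi> (f + g) = lin smul \<phi> f + lin smul \<phi> g"
proof -
  let ?A = "{w. f w \<noteq> 0} \<union> {w. g w \<noteq> 0}"
  have A: "finite ?A" using assms by simp
  have "lin smul \<phi> (f + g) = (\<Sum>w\<in>?A. smul ((f + g) w) (\<phi> w))"
    by (rule lin_superset[OF A]) (auto simp: pointwise)
  also have "\<dots> = (\<Sum>w\<in>?A. smul (f w) (\<phi> w)) + (\<Sum>w\<in>?A. smul (g w) (\<phi> w))"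
    by (simp add: pointwise scale_left_distrib sum.distrib)
  also have "\<dots> = lin smul \<phi> f + lin smul \<phi> g"
    using lin_superset[OF A, of f] lin_superset[OF A, of g] by simp
  finally show ?thesis .
qed

lemma lin_smul:
  assumes "finite {w. f w \<noteq> 0}"
  shows "lin smul \<phi> (fsmul a f) = smul a (lin smul \<phi> f)"
proof -
  have "lin smul \<phi> (fsmul a f) = (\<Sum>w | f w \<noteq> 0. smul (fsmul a f w) (\<phi> w))"
    by (rule lin_superset[OF assms]) (auto simp: fsmul_def)
  also have "\<dots> = smul a (lin smul \<phi> f)"
    by (simp add: lin_def fsmul_def scale_sum_right)
  finally show ?thesis .
qed

text \<open>Convolution sums over words \<open>w\<close> with a cut \<open>i\<close>. The pair
  \<open>(u, v)\<close> becomes the word \<open>u @ v\<close> cut at \<open>length u\<close>;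
  recording the cut makes this injective, which concatenation alone is not. Cuts with a half outside
  \<open>A\<close> or \<open>B\<close> carry coefficient 0.\<close>

lemma lin_fmul:
  assumes A: "finite A" "{w. f w \<noteq> 0} \<subseteq> A" and B: "finite B" "{w. g w \<noteq> 0} \<subseteq> B"
  shows "lin smul \<phi> (fmul f g) = (\<Sum>u\<in>A. \<Sum>v\<in>B. smul (f u * g v) (\<phi> (u @ v)))"
proof -
  let ?W = "(\<lambda>(u, v). u @ v) ` (A \<times> B)"
  let ?S = "Sigma ?W (\<lambda>w. {..length w})"
  let ?h = "\<lambda>(w, i). smul (f (take i w) * g (drop i w)) (\<phi> w)"
  let ?T = "(\<lambda>(u, v). (u @ v, length u)) ` (A \<times> B)"
  have W: "finite ?W" using A B by blast
  have inj: "inj_on (\<lambda>(u, v). (u @ v, length u)) (A \<times> B)"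
    by (auto simp: inj_on_def)
  have "lin smul \<phi> (fmul f g) = (\<Sum>w\<in>?W. smul (fmul f g w) (\<phi> w))"
    using A B by (intro lin_superset[OF W]) (force elim: fmul_nonzeroE)
  also have "\<dots> = (\<Sum>w\<in>?W. \<Sum>i\<le>length w. ?h (w, i))"
    by (simp add: fmul_def scale_sum_left)
  also have "\<dots> = sum ?h ?S"
    using W by (simp add: sum.Sigma)
  also have "\<dots> = sum ?h ?T"
  proof (rule sum.mono_neutral_right)
    show "finite ?S" using W by blast
    show "?T \<subseteq> ?S" by auto
    show "\<forall>x\<in>?S - ?T. ?h x = 0"
    proof
      fix x assume x: "x \<in> ?S - ?T"
      obtain w i where [simp]: "x = (w, i)" by (cases x)
      have i: "i \<le> length w" using x by auto
      have "\<not> (take i w \<in> A \<and> drop i w \<in> B)"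
      proof
        assume "take i w \<in> A \<and> drop i w \<in> B"
        then have "(\<lambda>(u, v). (u @ v, length u)) (take i w, drop i w) \<in> ?T" by blast
        then show False using x i by auto
      qed
      then have "f (take i w) = 0 \<or> g (drop i w) = 0" using A B by blast
      then show "?h x = 0" by auto
    qed
  qed
  also have "\<dots> = (\<Sum>(u, v)\<in>A \<times> B. smul (f u * g v) (\<phi> (u @ v)))"
    by (subst sum.reindex[OF inj]) (auto simp: o_def intro!: sum.cong)
  also have "\<dots> = (\<Sum>u\<in>A. \<Sum>v\<in>B. smul (f u * g v) (\<phi> (u @ v)))"
    using A B by (simp add: sum.cartesian_product)
  finally show ?thesis .
qed

end

section \<open>The involution of the free algebra\<close>

context
  fixes invK :: "'k::field \<Rightarrow> 'k"
  assumes invol: "field_involution invK"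
begin

lemma invK_add: "invK (a + b) = invK a + invK b"
  and invK_mult: "invK (a * b) = invK a * invK b"
  and invK_invK: "invK (invK a) = a"
  using invol by (auto simp: field_involution_def)

lemma invK_0: "invK 0 = 0"
  using invK_add[of 0 0] by (metis add.right_neutral add_cancel_right_right)

lemma invK_eq_0_iff: "invK a = 0 \<longleftrightarrow> a = 0"
  by (metis invK_0 invK_invK)

text \<open>Unitality is no clause of \<open>field_involution\<close>; \<open>invK 1\<close> is
  idempotent in a field, and nonzero because only 0 is sent to 0.\<close>

lemma invK_1: "invK 1 = 1"
  using invK_mult[of 1 1] invK_eq_0_iff[of 1] by simp

lemma invK_minus: "invK (- a) = - invK a"
  using invK_add[of a "- a"] invK_0 by (simp add: eq_neg_iff_add_eq_0 add.commute)

lemma invK_sum: "invK (\<Sum>i\<in>A. F i) = (\<Sum>i\<in>A. invK (F i))"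
  by (induction A rule: infinite_finite_induct) (simp_all add: invK_0 invK_add)

lemma fstar_add: "fstar invK (f + g) = fstar invK f + fstar invK g"
  by (rule ext) (simp add: pointwise fstar_apply invK_add)

lemma fstar_minus: "fstar invK (- f) = - fstar invK f"
  by (rule ext) (simp add: pointwise fstar_apply invK_minus)

lemma fstar_diff: "fstar invK (f - g) = fstar invK f - fstar invK g"
  using fstar_add[of f "- g"] by (simp add: fstar_minus)

lemma fstar_zero: "fstar invK 0 = 0"
  by (rule ext) (simp add: pointwise fstar_apply invK_0)

lemma fstar_smul: "fstar invK (fsmul a f) = fsmul (invK a) (fstar invK f)"
  by (rule ext) (simp add: pointwise fstar_apply fsmul_def invK_mult)

lemma fstar_sum: "fstar invK (\<Sum>i\<in>A. F i) = (\<Sum>i\<in>A. fstar invK (F i))"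
  by (induction A rule: infinite_finite_induct) (simp_all add: fstar_zero fstar_add)

lemma fstar_mono: "fstar invK (mono w) = mono (word_star w)"
proof
  fix u
  have "word_star u = w \<longleftrightarrow> u = word_star w" by auto
  then show "fstar invK (mono w) u = mono (word_star w) u"
    by (auto simp: fstar_apply mono_def invK_0 invK_1)
qed

lemma word_star_take: "i \<le> length w \<Longrightarrow> take i (word_star w) = word_star (drop (length w - i) w)"
  and word_star_drop: "i \<le> length w \<Longrightarrow> drop i (word_star w) = word_star (take (length w - i) w)"
  by (simp_all add: word_star_def take_rev drop_rev take_map drop_map)

text \<open>Reversal carries the cut at \<open>i\<close> to the cut at \<open>length w - i\<close>,
  so the same sum is run through backwards with the two factors exchanged.\<close>

lemma fstar_fmul: "fstar invK (fmul f g) = fmul (fstar invK g) (fstar invK f)"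
proof
  fix w :: "('a,'b) gen list"
  have len: "length (word_star w) = length w" by (simp add: word_star_def)
  have "fstar invK (fmul f g) w =
      (\<Sum>i\<le>length w. invK (f (take i (word_star w))) * invK (g (drop i (word_star w))))"
    by (simp add: fstar_apply fmul_def len invK_sum invK_mult)
  also have "\<dots> = (\<Sum>i\<le>length w. fstar invK g (take (length w - i) w) * fstar invK f (drop (length w - i) w))"
    by (rule sum.cong) (simp_all add: fstar_apply word_star_take word_star_drop mult.commute)
  also have "\<dots> = (\<Sum>i\<le>length w. fstar invK g (take i w) * fstar invK f (drop i w))"
    by (rule sum.reindex_bij_witness[of _ "\<lambda>i. length w - i" "\<lambda>i. length w - i"]) auto
  finally show "fstar invK (fmul f g) w = fmul (fstar invK g) (fstar invK f) w"
    by (simp add: fmul_def)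
qed

lemma fstar_support: "{w. fstar invK f w \<noteq> 0} = word_star ` {w. f w \<noteq> 0}"
proof -
  have "{w. fstar invK f w \<noteq> 0} = {w. f (word_star w) \<noteq> 0}"
    by (simp add: fstar_apply invK_eq_0_iff)
  also have "\<dots> = word_star ` {w. f w \<noteq> 0}"
  proof (intro set_eqI iffI)
    fix w assume "w \<in> {w. f (word_star w) \<noteq> 0}"
    then show "w \<in> word_star ` {w. f w \<noteq> 0}"
      by (intro image_eqI[of _ _ "word_star w"]) auto
  qed auto
  finally show ?thesis .
qed

lemma free_alg_star:
  assumes f: "f \<in> free_alg G"
  shows "fstar invK f \<in> free_alg G"
proof (rule free_algI)
  show "finite {w. fstar invK f w \<noteq> 0}"
    using free_alg_finite[OF f] by (simp add: fstar_support)
next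
  fix w assume "fstar invK f w \<noteq> 0"
  then have "f (word_star w) \<noteq> 0" by (simp add: fstar_apply invK_eq_0_iff)
  then show "w \<noteq> [] \<and> valid_word G w" using free_alg_word[OF f] by force
qed

end

section \<open>The ideal and the quotient\<close>

lemma ideal_zero: "0 \<in> lpa_ideal G"
  using lpa_ideal.zero[of G] by (simp add: fzero_eq)

lemma ideal_add: "x \<in> lpa_ideal G \<Longrightarrow> y \<in> lpa_ideal G \<Longrightarrow> x + y \<in> lpa_ideal G"
  using lpa_ideal.add[of x G y] by (simp add: fadd_eq)

lemma ideal_uminus: "x \<in> lpa_ideal G \<Longrightarrow> - x \<in> lpa_ideal G"
  using lpa_ideal.smul[of x G "-1"] by (simp add: fsmul_minus_1)

lemma ideal_sum: "(\<And>i. i \<in> A \<Longrightarrow> F i \<in> lpa_ideal G) \<Longrightarrow> (\<Sum>i\<in>A. F i) \<in> lpa_ideal G"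
  by (induction A rule: infinite_finite_induct) (simp_all add: ideal_zero ideal_add)

lemma ideal_mono_left: "x \<in> lpa_ideal G \<Longrightarrow> valid_word G u \<Longrightarrow> fmul (mono u) x \<in> lpa_ideal G"
  by (cases "u = []") (simp_all add: fmul_mono_Nil_left lpa_ideal.lmul free_alg_mono)

lemma ideal_mono_right: "x \<in> lpa_ideal G \<Longrightarrow> valid_word G u \<Longrightarrow> fmul x (mono u) \<in> lpa_ideal G"
  by (cases "u = []") (simp_all add: fmul_mono_Nil_right lpa_ideal.rmul free_alg_mono)

text \<open>The branches \<open>v = w\<close> of (V) and \<open>e = f\<close> of (CK1) are separated
  from the others: they serve as rewriting steps, their complements as reasons for a word to
  vanish.\<close>

lemma ideal_rel:
  shows ideal_V: "v \<in> verts G \<Longrightarrow> mono [Vx v, Vx v] - mono [Vx v] \<in> lpa_ideal G"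
    and ideal_V': "v \<in> verts G \<Longrightarrow> w \<in> verts G \<Longrightarrow> v \<noteq> w \<Longrightarrow> mono [Vx v, Vx w] \<in> lpa_ideal G"
    and ideal_E1s: "e \<in> edges G \<Longrightarrow> mono [Vx (src G e), Ex e] - mono [Ex e] \<in> lpa_ideal G"
    and ideal_E1r: "e \<in> edges G \<Longrightarrow> mono [Ex e, Vx (rng G e)] - mono [Ex e] \<in> lpa_ideal G"
    and ideal_E2r: "e \<in> edges G \<Longrightarrow> mono [Vx (rng G e), Gx e] - mono [Gx e] \<in> lpa_ideal G"
    and ideal_E2s: "e \<in> edges G \<Longrightarrow> mono [Gx e, Vx (src G e)] - mono [Gx e] \<in> lpa_ideal G"
    and ideal_CK1: "e \<in> edges G \<Longrightarrow> mono [Gx e, Ex e] - mono [Vx (rng G e)] \<in> lpa_ideal G"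
    and ideal_CK1': "e \<in> edges G \<Longrightarrow> f \<in> edges G \<Longrightarrow> e \<noteq> f \<Longrightarrow> mono [Gx e, Ex f] \<in> lpa_ideal G"
    and ideal_CK2: "regular G v \<Longrightarrow>
      mono [Vx v] - (\<Sum>e\<in>out_edges G v. mono [Ex e, Gx e]) \<in> lpa_ideal G"
proof -
  have V: "fadd (mono [Vx v, Vx w]) (fneg (if v = w then mono [Vx v] else fzero)) \<in> lpa_ideal G"
    if "v \<in> verts G" "w \<in> verts G" for v w
    using that by (intro lpa_ideal.rel) (unfold lpa_rels_def, blast)
  have CK1: "fadd (mono [Gx e, Ex f]) (fneg (if e = f then mono [Vx (rng G e)] else fzero)) \<in> lpa_ideal G"
    if "e \<in> edges G" "f \<in> edges G" for e f
    using that by (intro lpa_ideal.rel) (unfold lpa_rels_def, blast)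
  show "v \<in> verts G \<Longrightarrow> mono [Vx v, Vx v] - mono [Vx v] \<in> lpa_ideal G"
    using V[of v v] by (simp add: fadd_eq fneg_eq)
  show "v \<in> verts G \<Longrightarrow> w \<in> verts G \<Longrightarrow> v \<noteq> w \<Longrightarrow> mono [Vx v, Vx w] \<in> lpa_ideal G"
    using V[of v w] by (simp add: fadd_eq fneg_eq fzero_eq)
  show "e \<in> edges G \<Longrightarrow> mono [Gx e, Ex e] - mono [Vx (rng G e)] \<in> lpa_ideal G"
    using CK1[of e e] by (simp add: fadd_eq fneg_eq)
  show "e \<in> edges G \<Longrightarrow> f \<in> edges G \<Longrightarrow> e \<noteq> f \<Longrightarrow> mono [Gx e, Ex f] \<in> lpa_ideal G"
    using CK1[of e f] by (simp add: fadd_eq fneg_eq fzero_eq)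
  show "mono [Vx (src G e), Ex e] - mono [Ex e] \<in> lpa_ideal G"
    "mono [Ex e, Vx (rng G e)] - mono [Ex e] \<in> lpa_ideal G"
    "mono [Vx (rng G e), Gx e] - mono [Gx e] \<in> lpa_ideal G"
    "mono [Gx e, Vx (src G e)] - mono [Gx e] \<in> lpa_ideal G" if "e \<in> edges G"
  proof -
    have "fadd (mono [Vx (src G e), Ex e]) (fneg (mono [Ex e])) \<in> lpa_ideal G"
      "fadd (mono [Ex e, Vx (rng G e)]) (fneg (mono [Ex e])) \<in> lpa_ideal G"
      "fadd (mono [Vx (rng G e), Gx e]) (fneg (mono [Gx e])) \<in> lpa_ideal G"
      "fadd (mono [Gx e, Vx (src G e)]) (fneg (mono [Gx e])) \<in> lpa_ideal G"
      using that by (intro lpa_ideal.rel; unfold lpa_rels_def, blast)+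
    then show "mono [Vx (src G e), Ex e] - mono [Ex e] \<in> lpa_ideal G"
      "mono [Ex e, Vx (rng G e)] - mono [Ex e] \<in> lpa_ideal G"
      "mono [Vx (rng G e), Gx e] - mono [Gx e] \<in> lpa_ideal G"
      "mono [Gx e, Vx (src G e)] - mono [Gx e] \<in> lpa_ideal G"
      by (simp_all add: fadd_eq fneg_eq)
  qed
  show "mono [Vx v] - (\<Sum>e\<in>out_edges G v. mono [Ex e, Gx e]) \<in> lpa_ideal G" if "regular G v"
  proof -
    have "fadd (mono [Vx v]) (fneg (\<lambda>u. \<Sum>e\<in>out_edges G v. mono [Ex e, Gx e] u)) \<in> lpa_ideal G"
      using that by (intro lpa_ideal.rel) (unfold lpa_rels_def, blast)
    also have "(\<lambda>u. \<Sum>e\<in>out_edges G v. mono [Ex e, Gx e] u) = (\<Sum>e\<in>out_edges G v. mono [Ex e, Gx e])"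
      by (simp add: fun_eq_iff sum_fun_apply)
    finally show ?thesis by (simp add: fadd_eq fneg_eq)
  qed
qed

lemma lpa_rels_cases:
  assumes "x \<in> lpa_rels G"
  obtains (V) v where "v \<in> verts G" "x = mono [Vx v, Vx v] - mono [Vx v]"
    | (V') v w where "v \<in> verts G" "w \<in> verts G" "v \<noteq> w" "x = mono [Vx v, Vx w]"
    | (E1s) e where "e \<in> edges G" "x = mono [Vx (src G e), Ex e] - mono [Ex e]"
    | (E1r) e where "e \<in> edges G" "x = mono [Ex e, Vx (rng G e)] - mono [Ex e]"
    | (E2r) e where "e \<in> edges G" "x = mono [Vx (rng G e), Gx e] - mono [Gx e]"
    | (E2s) e where "e \<in> edges G" "x = mono [Gx e, Vx (src G e)] - mono [Gx e]"
    | (CK1) e where "e \<in> edges G" "x = mono [Gx e, Ex e] - mono [Vx (rng G e)]"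
    | (CK1') e f where "e \<in> edges G" "f \<in> edges G" "e \<noteq> f" "x = mono [Gx e, Ex f]"
    | (CK2) v where "regular G v" "x = mono [Vx v] - (\<Sum>e\<in>out_edges G v. mono [Ex e, Gx e])"
proof -
  have CK2': "(\<lambda>u. \<Sum>e\<in>A. mono [Ex e, Gx e] u) = (\<Sum>e\<in>A. mono [Ex e, Gx e])" for A :: "'b set"
    by (simp add: fun_eq_iff sum_fun_apply)
  show thesis
    using assms unfolding lpa_rels_def
  proof (elim UnE CollectE exE conjE)
    fix v w assume "x = fadd (mono [Vx v, Vx w]) (fneg (if v = w then mono [Vx v] else fzero))"
      "v \<in> verts G" "w \<in> verts G"
    then show thesis
      by (cases "v = w") (simp_all add: fadd_eq fneg_eq fzero_eq V V')
  next
    fix e f assume "x = fadd (mono [Gx e, Ex f]) (fneg (if e = f then mono [Vx (rng G e)] else fzero))"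
      "e \<in> edges G" "f \<in> edges G"
    then show thesis
      by (cases "e = f") (simp_all add: fadd_eq fneg_eq fzero_eq CK1 CK1')
  next
    fix v assume "x = fadd (mono [Vx v]) (fneg (\<lambda>u. \<Sum>e\<in>out_edges G v. mono [Ex e, Gx e] u))"
      "regular G v"
    then show thesis
      using CK2 unfolding CK2' by (simp add: fadd_eq fneg_eq)
  qed (simp_all add: fadd_eq fneg_eq E1s E1r E2r E2s)
qed

lemma lpa_rels_subset_free_alg:
  assumes "wf_graph G"
  shows "lpa_rels G \<subseteq> free_alg G"
proof
  have wf: "src G e \<in> verts G" "rng G e \<in> verts G" if "e \<in> edges G" for e
    using assms that by (auto simp: wf_graph_def)
  fix x assume "x \<in> lpa_rels G"
  then show "x \<in> free_alg G"
    by (cases rule: lpa_rels_cases)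
      (auto simp: regular_def out_edges_def wf intro!: free_alg_diff free_alg_mono free_alg_sum)
qed

lemma lpa_ideal_subset_free_alg:
  assumes "wf_graph G"
  shows "lpa_ideal G \<subseteq> free_alg G"
proof
  fix x assume "x \<in> lpa_ideal G"
  then show "x \<in> free_alg G"
  proof induction
    case (rel x)
    then show ?case using lpa_rels_subset_free_alg[OF assms] by blast
  qed (simp_all add: fzero_eq fadd_eq free_alg_zero free_alg_add free_alg_smul free_alg_mul)
qed

text \<open>The relations are stable under the star: (E1) and (E2) change places, the vanishing
  products in (V) and (CK1) are permuted, and the remaining relations are self-adjoint. In the
  ideal, left and right multiplication change places.\<close>

lemma ideal_star:
  assumes invol: "field_involution invK" and "x \<in> lpa_ideal G"
  shows "fstar invK x \<in> lpa_ideal G"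
  using assms(2)
proof induction
  case (rel x)
  note star_simps = fstar_diff[OF invol] fstar_mono[OF invol]
    fstar_sum[OF invol] word_star_def
  from rel show ?case
    by (cases rule: lpa_rels_cases) (auto simp: star_simps intro: ideal_rel)
next
  case (add x y)
  then show ?case by (simp add: fadd_eq fstar_add[OF invol] ideal_add)
next
  case (smul x a)
  then show ?case by (simp add: fstar_smul[OF invol] lpa_ideal.smul)
qed (simp_all add: fzero_eq fstar_zero[OF invol] ideal_zero fstar_fmul[OF invol]
    lpa_ideal.lmul lpa_ideal.rmul free_alg_star[OF invol])

section \<open>The quotient algebra and its operations\<close>

lemma equiv_lpa_rel: "equiv (free_alg G) (lpa_rel G)"
proof (intro equivI)
  show "lpa_rel G \<subseteq> free_alg G \<times> free_alg G"
    by (auto simp: lpa_rel_def)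
  show "refl_on (free_alg G) (lpa_rel G)"
    by (auto simp: refl_on_def lpa_rel_def fadd_eq fneg_eq ideal_zero)
  show "sym (lpa_rel G)"
  proof (rule symI)
    fix x y assume "(x, y) \<in> lpa_rel G"
    then show "(y, x) \<in> lpa_rel G"
      using ideal_uminus[of "x - y" G] by (auto simp: lpa_rel_def fadd_eq fneg_eq)
  qed
  show "trans (lpa_rel G)"
  proof (rule transI)
    fix x y z assume "(x, y) \<in> lpa_rel G" "(y, z) \<in> lpa_rel G"
    then show "(x, z) \<in> lpa_rel G"
      using ideal_add[of "x - y" G "y - z"] by (auto simp: lpa_rel_def fadd_eq fneg_eq)
  qed
qed

lemma cls_in_LPA: "x \<in> free_alg G \<Longrightarrow> cls G x \<in> LPA G"
  by (simp add: cls_def LPA_def quotientI)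

lemma cls_eq_iff:
  assumes "x \<in> free_alg G" "y \<in> free_alg G"
  shows "cls G x = cls G y \<longleftrightarrow> x - y \<in> lpa_ideal G"
  unfolding cls_def using eq_equiv_class_iff[OF equiv_lpa_rel assms] assms
  by (simp add: lpa_rel_def fadd_eq fneg_eq)

lemma rep_LPA:
  assumes "X \<in> LPA G"
  shows "rep X \<in> free_alg G" "cls G (rep X) = X"
proof -
  have "X \<in> free_alg G // lpa_rel G" using assms by (simp add: LPA_def)
  then obtain x where x: "x \<in> free_alg G" "X = lpa_rel G `` {x}" by (rule quotientE)
  then have "x \<in> X" using equiv_class_self[OF equiv_lpa_rel] by blast
  then have "rep X \<in> X" unfolding rep_def by (rule someI[of "\<lambda>x. x \<in> X"])
  then have "(x, rep X) \<in> lpa_rel G" using x by simp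
  then show "rep X \<in> free_alg G" "cls G (rep X) = X"
    using x equiv_class_eq[OF equiv_lpa_rel] by (auto simp: lpa_rel_def cls_def)
qed

lemma LPA_cases:
  assumes "X \<in> LPA G"
  obtains x where "x \<in> free_alg G" "X = cls G x"
  using rep_LPA[OF assms] by metis

text \<open>Operations on classes are computed at the choice \<open>rep\<close>. That it differs
  from \<open>x\<close> by an element of the ideal is what makes \<open>addL_cls\<close> to
  \<open>starL_cls\<close> independent of the choice.\<close>

lemma rep_cls:
  assumes "x \<in> free_alg G"
  shows "rep (cls G x) \<in> free_alg G" "rep (cls G x) - x \<in> lpa_ideal G"
  using rep_LPA[OF cls_in_LPA[OF assms]] cls_eq_iff assms by blast+

lemma addL_cls:
  assumes x: "x \<in> free_alg G" and y: "y \<in> free_alg G"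
  shows "addL G (cls G x) (cls G y) = cls G (x + y)"
proof -
  have "rep (cls G x) - x + (rep (cls G y) - y) \<in> lpa_ideal G"
    by (rule ideal_add[OF rep_cls(2)[OF x] rep_cls(2)[OF y]])
  then show ?thesis
    unfolding addL_def fadd_eq
    by (subst cls_eq_iff) (simp_all add: free_alg_add x y rep_cls algebra_simps)
qed

lemma smulL_cls:
  assumes x: "x \<in> free_alg G"
  shows "smulL G a (cls G x) = cls G (fsmul a x)"
proof -
  have "fsmul a (rep (cls G x) - x) \<in> lpa_ideal G"
    by (rule lpa_ideal.smul[OF rep_cls(2)[OF x]])
  then show ?thesis
    unfolding smulL_def by (subst cls_eq_iff) (simp_all add: free_alg_smul x rep_cls fsmul_diff)
qed

lemma multL_cls:
  assumes x: "x \<in> free_alg G" and y: "y \<in> free_alg G"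
  shows "multL G (cls G x) (cls G y) = cls G (fmul x y)"
proof -
  let ?x = "rep (cls G x)" and ?y = "rep (cls G y)"
  \<comment> \<open>Telescoping: \<open>x' y' - x y = (x' - x) y' + x (y' - y)\<close>, with both
    differences in the ideal.\<close>
  have "fmul (?x - x) ?y + fmul x (?y - y) \<in> lpa_ideal G"
    by (intro ideal_add lpa_ideal.rmul lpa_ideal.lmul rep_cls x y)
  then show ?thesis
    unfolding multL_def
    by (subst cls_eq_iff)
      (simp_all add: free_alg_mul x y rep_cls fmul_diff_left fmul_diff_right algebra_simps)
qed

lemma starL_cls:
  assumes invol: "field_involution invK" and x: "x \<in> free_alg G"
  shows "starL G invK (cls G x) = cls G (fstar invK x)"
proof -
  have "fstar invK (rep (cls G x) - x) \<in> lpa_ideal G"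
    by (rule ideal_star[OF invol rep_cls(2)[OF x]])
  then show ?thesis
    unfolding starL_def by (subst cls_eq_iff) (simp_all add: free_alg_star[OF invol] x rep_cls fstar_diff[OF invol])
qed

text \<open>The contexts \<open>u\<close>, \<open>v\<close> make the hypothesis stable under multiplication from both sides.\<close>

lemma lin_ideal:
  fixes smul :: "'k::field \<Rightarrow> 'r::ring \<Rightarrow> 'r" and x :: "('v,'e,'k) fa"
  assumes mod: "module smul" and wf: "wf_graph G"
    and rels: "\<And>u v x. valid_word G u \<Longrightarrow> valid_word G v \<Longrightarrow> x \<in> lpa_rels G \<Longrightarrow>
      lin smul (\<lambda>w. \<phi> (u @ w @ v)) x = 0"
    and x: "x \<in> lpa_ideal G" and "valid_word G u" "valid_word G v"
  shows "lin smul (\<lambda>w. \<phi> (u @ w @ v)) x = 0"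
  using x assms(5,6)
proof (induction arbitrary: u v)
  case (rel x)
  then show ?case by (intro rels)
next
  case zero
  show ?case by (simp add: fzero_eq lin_zero[OF mod])
next
  case (add x y)
  have "x \<in> free_alg G" "y \<in> free_alg G"
    using add.hyps lpa_ideal_subset_free_alg[OF wf] by blast+
  then show ?case
    by (simp add: add fadd_eq lin_add[OF mod] free_alg_finite)
next
  case (smul x a)
  interpret module smul by (rule mod)
  have "x \<in> free_alg G" using smul.hyps lpa_ideal_subset_free_alg[OF wf] by blast
  then show ?case by (simp add: smul lin_smul[OF mod] free_alg_finite)
next
  case (lmul x f)
  interpret module smul by (rule mod)
  have x: "x \<in> free_alg G" using lmul.hyps lpa_ideal_subset_free_alg[OF wf] by blast
  have "lin smul (\<lambda>w. \<phi> (u @ w @ v)) (fmul f x) =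
      (\<Sum>a | f a \<noteq> 0. smul (f a) (lin smul (\<lambda>w. \<phi> ((u @ a) @ w @ v)) x))"
    by (subst lin_fmul[OF mod free_alg_finite[OF lmul.hyps(2)] order_refl free_alg_finite[OF x] order_refl])
      (simp add: lin_def scale_sum_right)
  also have "\<dots> = 0"
  proof (intro sum.neutral ballI)
    fix a assume "a \<in> {a. f a \<noteq> 0}"
    then have "valid_word G (u @ a)"
      using lmul.prems free_alg_word[OF lmul.hyps(2)] by simp
    then show "smul (f a) (lin smul (\<lambda>w. \<phi> ((u @ a) @ w @ v)) x) = 0"
      using lmul.IH lmul.prems by (simp only: scale_zero_right)
  qed
  finally show ?case .
next
  case (rmul x f)
  interpret module smul by (rule mod)
  have x: "x \<in> free_alg G" using rmul.hyps lpa_ideal_subset_free_alg[OF wf] by blast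
  have "lin smul (\<lambda>w. \<phi> (u @ w @ v)) (fmul x f) =
      (\<Sum>b | x b \<noteq> 0. \<Sum>a | f a \<noteq> 0. smul (x b * f a) (\<phi> (u @ (b @ a) @ v)))"
    by (rule lin_fmul[OF mod free_alg_finite[OF x] order_refl free_alg_finite[OF rmul.hyps(2)] order_refl])
  also have "\<dots> = (\<Sum>a | f a \<noteq> 0. smul (f a) (lin smul (\<lambda>w. \<phi> (u @ w @ (a @ v))) x))"
    by (subst sum.swap) (simp add: lin_def scale_sum_right mult.commute)
  also have "\<dots> = 0"
  proof (intro sum.neutral ballI)
    fix a assume "a \<in> {a. f a \<noteq> 0}"
    then have "valid_word G (a @ v)"
      using rmul.prems free_alg_word[OF rmul.hyps(2)] by simp
    then show "smul (f a) (lin smul (\<lambda>w. \<phi> (u @ w @ (a @ v))) x) = 0"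
      using rmul.IH rmul.prems by (simp only: scale_zero_right)
  qed
  finally show ?case .
qed

section \<open>Words as partial maps on paths\<close>

type_synonym ('v,'e) path = "'v \<times> 'e list"

text \<open>\<open>x\<close> need not start at the range of \<open>p\<close>; whether the result is
  a path is a separate condition, split up by \<open>is_path_pext\<close>.\<close>

definition pext :: "('v,'e) path \<Rightarrow> 'e list \<Rightarrow> ('v,'e) path" where
  "pext p x = (fst p, snd p @ x)"

lemma pext_simps [simp]:
  "fst (pext p x) = fst p" "snd (pext p x) = snd p @ x" "pext p [] = p"
  "pext (pext p x) y = pext p (x @ y)" "pext p x = pext p y \<longleftrightarrow> x = y"
  "pext p x = p \<longleftrightarrow> x = []" "p = pext p x \<longleftrightarrow> x = []"
  by (auto simp: pext_def prod_eq_iff)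

lemma pext_Pair: "pext (v, es) x = (v, es @ x)"
  by (simp add: pext_def)

lemma path_rng_Nil [simp]: "path_rng G (v, []) = v"
  by (simp add: path_rng_def)

lemma path_rng_Cons [simp]: "path_rng G (v, e # es) = path_rng G (rng G e, es)"
  by (simp add: path_rng_def)

lemma path_rng_append: "path_rng G (v, es @ x) = path_rng G (path_rng G (v, es), x)"
  by (simp add: path_rng_def)

lemma path_rng_pext: "path_rng G (pext p x) = path_rng G (path_rng G p, x)"
  by (cases p) (simp add: pext_Pair path_rng_append)

lemma is_path_Nil [simp]: "is_path G (v, []) \<longleftrightarrow> v \<in> verts G"
  by (simp add: is_path_def)

text \<open>The path-space representation of the Cohn path algebra by partial maps, with
  \<open>None\<close> for 0. The maps are defined on all pairs, so statements about inverses are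
  restricted to pairs that satisfy \<open>is_path\<close>.\<close>

fun gen_act :: "('v,'e) graph \<Rightarrow> ('v,'e) gen \<Rightarrow> ('v,'e) path \<Rightarrow> ('v,'e) path option" where
  "gen_act G (Vx v) p = (if fst p = v then Some p else None)"
| "gen_act G (Ex e) p = (if e \<in> edges G \<and> fst p = rng G e then Some (src G e, e # snd p) else None)"
| "gen_act G (Gx e) p =
    (case snd p of [] \<Rightarrow> None | f # fs \<Rightarrow> if f = e then Some (rng G e, fs) else None)"

fun act :: "('v,'e) graph \<Rightarrow> ('v,'e) gen list \<Rightarrow> ('v,'e) path \<Rightarrow> ('v,'e) path option" where
  "act G [] p = Some p"
| "act G (g # w) p = Option.bind (act G w p) (gen_act G g)"

lemma act_append: "act G (u @ w) p = Option.bind (act G w p) (act G u)"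
  by (induction u) auto

lemma gen_act_pext: "gen_act G g p = Some p' \<Longrightarrow> gen_act G g (pext p x) = Some (pext p' x)"
  by (cases g) (auto simp: pext_def split: if_splits list.splits)

text \<open>Generators only touch the beginning of a path and hence commute with extension at the
  end. Domains and fixed sets are therefore closed under passing to longer paths.\<close>

lemma act_pext: "act G w p = Some p' \<Longrightarrow> act G w (pext p x) = Some (pext p' x)"
proof (induction w arbitrary: p')
  case (Cons g w)
  then obtain a where "act G w p = Some a" "gen_act G g a = Some p'"
    by (auto simp: bind_eq_Some_conv)
  then show ?case using Cons.IH[of a] gen_act_pext[of G g a p' x] by simp
qed simp

text \<open>The source vertex stays in front even for positive length, so that paths of length 0
  need no separate treatment; \<open>pathL_eq\<close> compares this with \<open>pathL\<close>, which
  drops the vertex there.\<close>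

definition path_word :: "('v,'e) path \<Rightarrow> ('v,'e) gen list" where
  "path_word p = Vx (fst p) # map Ex (snd p)"

definition pq_word :: "('v,'e) path \<Rightarrow> ('v,'e) path \<Rightarrow> ('v,'e) gen list" where
  "pq_word p q = path_word p @ word_star (path_word q)"

definition cyl :: "('v,'e) graph \<Rightarrow> ('v,'e) path \<Rightarrow> ('v,'e) path set" where
  "cyl G q = {y. is_path G y \<and> (\<exists>x. y = pext q x)}"

definition dom_act :: "('v,'e) graph \<Rightarrow> ('v,'e) gen list \<Rightarrow> ('v,'e) path set" where
  "dom_act G w = {y. is_path G y \<and> act G w y \<noteq> None}"

lemma cyl_self: "is_path G q \<Longrightarrow> q \<in> cyl G q"
  unfolding cyl_def by (auto intro: exI[of _ "[]"])

text \<open>A generator is the shortest member of its cylinder. Finiteness of paths matters here: on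
  infinite paths, a vertex emitting a single edge would have the same cylinder as that edge.\<close>

lemma cyl_inj: "is_path G p \<Longrightarrow> is_path G q \<Longrightarrow> cyl G p = cyl G q \<Longrightarrow> p = q"
proof -
  assume *: "is_path G p" "is_path G q" "cyl G p = cyl G q"
  then have "p \<in> cyl G q" "q \<in> cyl G p" using cyl_self by blast+
  then show "p = q" by (auto simp: cyl_def)
qed

section \<open>Congruence of words modulo the ideal\<close>

context
  fixes G :: "('v,'e) graph" and I :: "('v,'e,'k::field) fa set"
  defines "I \<equiv> lpa_ideal G"
begin

lemma mono_cong_sym: "mono u - mono w \<in> I \<Longrightarrow> mono w - mono u \<in> I"
  using ideal_uminus[of "mono u - mono w" G] by (simp add: I_def)

lemma mono_cong_trans [trans]:
  "mono u - mono v \<in> I \<Longrightarrow> mono v - mono w \<in> I \<Longrightarrow> mono u - mono w \<in> I"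
  using ideal_add[of "mono u - mono v" G "mono v - mono w"] by (simp add: I_def)

lemma mono_cong_zero [trans]: "mono u - mono v \<in> I \<Longrightarrow> mono v \<in> I \<Longrightarrow> mono u \<in> I"
  using ideal_add[of "mono u - mono v" G "mono v"] by (simp add: I_def)

lemma mono_cong_ctx:
  "mono u - mono w \<in> I \<Longrightarrow> valid_word G a \<Longrightarrow> valid_word G b \<Longrightarrow>
    mono (a @ u @ b) - mono (a @ w @ b) \<in> I"
  using ideal_mono_right[OF ideal_mono_left[of "mono u - mono w" G a], of b]
  by (simp add: I_def fmul_diff_left fmul_diff_right fmul_mono_mono)

lemma mono_zero_ctx:
  "mono u \<in> I \<Longrightarrow> valid_word G a \<Longrightarrow> valid_word G b \<Longrightarrow> mono (a @ u @ b) \<in> I"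
  using ideal_mono_right[OF ideal_mono_left[of "mono u" G a], of b]
  by (simp add: I_def fmul_mono_mono)

end

section \<open>The action on the paths of a well-formed graph\<close>

locale leavitt =
  fixes G :: "('v,'e) graph" and invK :: "'k::field \<Rightarrow> 'k"
  assumes wf: "wf_graph G" and invol: "field_involution invK"
begin

lemma edge_verts [simp]: "e \<in> edges G \<Longrightarrow> src G e \<in> verts G" "e \<in> edges G \<Longrightarrow> rng G e \<in> verts G"
  using wf by (auto simp: wf_graph_def)

lemma is_path_Cons [simp]:
  "is_path G (v, e # es) \<longleftrightarrow> e \<in> edges G \<and> src G e = v \<and> is_path G (rng G e, es)"
proof -
  have "(\<forall>i. Suc i < length (e # es) \<longrightarrow> rng G ((e # es) ! i) = src G ((e # es) ! Suc i)) \<longleftrightarrow>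
     (es \<noteq> [] \<longrightarrow> src G (hd es) = rng G e \<and>
       (\<forall>i. Suc i < length es \<longrightarrow> rng G (es ! i) = src G (es ! Suc i)))"
    (is "?L \<longleftrightarrow> ?R")
  proof (cases es)
    case (Cons f fs)
    have split: "(\<forall>i. P i) \<longleftrightarrow> P 0 \<and> (\<forall>i. P (Suc i))" for P :: "nat \<Rightarrow> bool"
      by (metis not0_implies_Suc)
    show ?thesis
      by (subst split) (auto simp: Cons)
  qed simp
  then show ?thesis
    by (auto simp: is_path_def)
qed

lemma is_path_append:
  "is_path G (v, es @ x) \<longleftrightarrow> is_path G (v, es) \<and> is_path G (path_rng G (v, es), x)"
proof (induction es arbitrary: v)
  case Nil
  show ?case by (auto simp: is_path_def)
qed auto

lemma is_path_pext: "is_path G (pext p x) \<longleftrightarrow> is_path G p \<and> is_path G (path_rng G p, x)"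
  by (cases p) (simp add: pext_Pair is_path_append)

lemma path_rng_in_verts: "is_path G p \<Longrightarrow> path_rng G p \<in> verts G"
  using is_path_pext[of p "[]"] by simp

lemma gen_act_path:
  assumes "gen_act G g p = Some p'" "is_path G p"
  shows "is_path G p' \<and> path_rng G p' = path_rng G p"
  using assms by (cases g; cases p) (auto split: if_splits list.splits)

lemma act_path:
  assumes "act G w p = Some p'" "is_path G p"
  shows "is_path G p'" "path_rng G p' = path_rng G p"
  using assms
  by (induction w arbitrary: p') (auto simp: bind_eq_Some_conv dest: gen_act_path)

lemma gen_act_star:
  assumes "is_path G y" "is_path G z"
  shows "gen_act G (gen_star g) z = Some y \<longleftrightarrow> gen_act G g y = Some z"
  using assms by (cases g; cases y; cases z) (auto split: if_splits list.splits)

text \<open>Each generator is a partial injection inverted by its star, and reversing the word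
  composes the inverses in the right order. Both ends must be paths: on an arbitrary pair, stripping
  an edge forgets the first component.\<close>

lemma act_word_star:
  assumes "is_path G y" "is_path G z"
  shows "act G (word_star w) z = Some y \<longleftrightarrow> act G w y = Some z"
  using assms
proof (induction w arbitrary: z)
  case Nil
  then show ?case by (auto simp: word_star_def)
next
  case (Cons g w)
  have ws: "word_star (g # w) = word_star w @ [gen_star g]"
    by (simp add: word_star_def)
  have "act G (word_star (g # w)) z = Some y \<longleftrightarrow>
      (\<exists>a. gen_act G (gen_star g) z = Some a \<and> act G (word_star w) a = Some y)"
    unfolding ws act_append by (auto simp: bind_eq_Some_conv)
  also have "\<dots> \<longleftrightarrow> (\<exists>a. is_path G a \<and> gen_act G (gen_star g) z = Some a \<and> act G (word_star w) a = Some y)"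
    using gen_act_path Cons.prems by blast
  also have "\<dots> \<longleftrightarrow> (\<exists>a. is_path G a \<and> gen_act G g a = Some z \<and> act G w y = Some a)"
    using gen_act_star Cons by blast
  also have "\<dots> \<longleftrightarrow> act G (g # w) y = Some z"
    unfolding act.simps bind_eq_Some_conv using act_path(1) Cons.prems(1) by blast
  finally show ?case .
qed

lemma act_path_word:
  assumes "is_path G p"
  shows "act G (path_word p) z = (if fst z = path_rng G p then Some (fst p, snd p @ snd z) else None)"
proof -
  have "is_path G (v, es) \<Longrightarrow> act G (Vx v # map Ex es) z =
      (if fst z = path_rng G (v, es) then Some (v, es @ snd z) else None)" for v es
  proof (induction es arbitrary: v)
    case Nil
    then show ?case by auto
  next
    case (Cons e es)
    \<comment> \<open>An edge already demands that the path start at its range, so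
      \<open>Vx (rng G e)\<close> can be put in front of the remaining word to match the induction
      hypothesis.\<close>
    have "gen_act G (Ex e) p = Option.bind (gen_act G (Vx (rng G e)) p) (gen_act G (Ex e))" for p
      by simp
    then have "act G (map Ex (e # es)) z =
        Option.bind (act G (Vx (rng G e) # map Ex es) z) (gen_act G (Ex e))"
      by (cases "act G (map Ex es) z") simp_all
    moreover have "act G (Vx (rng G e) # map Ex es) z =
      (if fst z = path_rng G (rng G e, es) then Some (rng G e, es @ snd z) else None)"
      using Cons.prems by (intro Cons.IH) simp
    ultimately have "act G (map Ex (e # es)) z =
        (if fst z = path_rng G (v, e # es) then Some (v, e # es @ snd z) else None)"
      using Cons.prems by (simp only: path_rng_Cons is_path_Cons) simp
    then show ?case by (simp only: act.simps(2)) simp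
  qed
  from this[of "fst p" "snd p"] assms show ?thesis
    by (simp add: path_word_def)
qed

text \<open>\<open>path_word q\<close> prepends \<open>q\<close>, so by \<open>act_word_star\<close>
  its star strips \<open>q\<close>; then \<open>p\<close> can be prepended because the ranges
  agree.\<close>

lemma act_pq_word:
  assumes "is_path G p" "is_path G q" "path_rng G p = path_rng G q"
  shows "dom_act G (pq_word p q) = cyl G q" "act G (pq_word p q) q = Some p"
proof -
  have *: "act G (word_star (path_word q)) y = Some z \<longleftrightarrow> y = pext q (snd z) \<and> fst z = path_rng G q"
    if y: "is_path G y" for y z
  proof (cases "is_path G z")
    case True
    then show ?thesis
      using y by (auto simp: act_word_star act_path_word assms pext_def split: if_splits)
  next
    case False
    then have "act G (word_star (path_word q)) y \<noteq> Some z" using act_path y by blast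
    moreover have "\<not> (y = pext q (snd z) \<and> fst z = path_rng G q)"
      using False y is_path_pext[of q "snd z"] by (metis prod.collapse)
    ultimately show ?thesis by blast
  qed
  have q: "act G (word_star (path_word q)) q = Some (path_rng G q, [])"
    using * assms by simp
  then show act_q: "act G (pq_word p q) q = Some p"
    by (simp add: pq_word_def act_append act_path_word assms)
  show "dom_act G (pq_word p q) = cyl G q"
  proof
    show "dom_act G (pq_word p q) \<subseteq> cyl G q"
      using * by (auto simp: dom_act_def cyl_def pq_word_def act_append bind_eq_Some_conv)
    show "cyl G q \<subseteq> dom_act G (pq_word p q)"
      using act_pext[OF act_q] by (auto simp: dom_act_def cyl_def)
  qed
qed

lemma valid_path_word: "is_path G p \<Longrightarrow> valid_word G (path_word p)"
  by (auto simp: path_word_def valid_word_def is_path_def split: prod.splits)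

lemma valid_pq_word: "is_path G p \<Longrightarrow> is_path G q \<Longrightarrow> valid_word G (pq_word p q)"
  by (simp add: pq_word_def valid_path_word)


lemma path_word_pext_single: "path_word (pext q [e]) = path_word q @ [Ex e]"
  by (simp add: path_word_def)

text \<open>Once \<open>w\<close> is known to carry \<open>q x\<close> to \<open>p x\<close>, only
  the effect of \<open>g\<close> on the paths \<open>p x\<close> remains to be examined; the live
  cases of \<open>normal_form\<close> read off their domains from this set.\<close>

lemma dom_act_Cons:
  assumes "is_path G q" "dom_act G w = cyl G q" "act G w q = Some p"
  shows "dom_act G (g # w) = {pext q x | x. is_path G (pext q x) \<and> gen_act G g (pext p x) \<noteq> None}"
proof -
  have "dom_act G (g # w) = {y \<in> dom_act G w. gen_act G g (the (act G w y)) \<noteq> None}"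
    unfolding dom_act_def by (auto simp: bind_eq_None_conv simp del: not_None_eq)
  also have "\<dots> = {pext q x | x. is_path G (pext q x) \<and> gen_act G g (pext p x) \<noteq> None}"
    using act_pext[OF assms(3)] unfolding assms(2) cyl_def by (auto simp del: not_None_eq)
  finally show ?thesis .
qed

text \<open>Induction that adds a generator on the left of \<open>p q*\<close>. The result vanishes,
  or \<open>p\<close> is lengthened, shortened or kept; only a ghost edge that meets
  \<open>p\<close> of length 0 lengthens \<open>q\<close> instead. The rewriting uses (V), (E1),
  (E2) and (CK1), which the action respects exactly, so domain and congruence are carried along
  together.\<close>

lemma normal_form:
  assumes "w \<noteq> []" "valid_word G w"
  shows "(dom_act G w = {} \<and> mono w \<in> (lpa_ideal G :: ('v,'e,'k) fa set)) \<or>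
    (\<exists>p q. is_path G p \<and> is_path G q \<and> path_rng G p = path_rng G q \<and>
      dom_act G w = cyl G q \<and> act G w q = Some p \<and>
      mono w - mono (pq_word p q) \<in> (lpa_ideal G :: ('v,'e,'k) fa set))"
  using assms
proof (induction w rule: list_nonempty_induct)
  case (single g)
  let ?I = "lpa_ideal G :: ('v,'e,'k) fa set"
  show ?case
  proof (rule disjI2, cases g)
    case (Vx v)
    have "mono [Vx v] - mono [Vx v, Vx v] \<in> ?I"
      using single Vx by (intro mono_cong_sym[OF ideal_V]) simp
    then show "\<exists>p q. is_path G p \<and> is_path G q \<and> path_rng G p = path_rng G q \<and>
      dom_act G [g] = cyl G q \<and> act G [g] q = Some p \<and> mono [g] - mono (pq_word p q) \<in> ?I"
      using single Vx by (intro exI[of _ "(v, [])"])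
        (auto simp: dom_act_def cyl_def pext_def pq_word_def path_word_def word_star_def)
  next
    case (Ex e)
    then have e: "e \<in> edges G" using single by simp
    have "mono [Ex e] - mono [Vx (src G e), Ex e] \<in> ?I"
      using e by (intro mono_cong_sym[OF ideal_E1s])
    also have "mono ([Vx (src G e)] @ [Ex e] @ []) - mono ([Vx (src G e)] @ [Ex e, Vx (rng G e)] @ []) \<in> ?I"
      using e by (intro mono_cong_ctx mono_cong_sym[OF ideal_E1r]) simp_all
    then have "mono [Vx (src G e), Ex e] - mono [Vx (src G e), Ex e, Vx (rng G e)] \<in> ?I" by simp
    finally show "\<exists>p q. is_path G p \<and> is_path G q \<and> path_rng G p = path_rng G q \<and>
      dom_act G [g] = cyl G q \<and> act G [g] q = Some p \<and> mono [g] - mono (pq_word p q) \<in> ?I"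
      using e Ex by - (rule exI[of _ "(src G e, [e])"], rule exI[of _ "(rng G e, [])"],
         auto simp: dom_act_def cyl_def pext_def pq_word_def path_word_def word_star_def)
  next
    case (Gx e)
    then have e: "e \<in> edges G" using single by simp
    have "mono [Gx e] - mono [Vx (rng G e), Gx e] \<in> ?I"
      using e by (intro mono_cong_sym[OF ideal_E2r])
    also have "mono ([Vx (rng G e)] @ [Gx e] @ []) - mono ([Vx (rng G e)] @ [Gx e, Vx (src G e)] @ []) \<in> ?I"
      using e by (intro mono_cong_ctx mono_cong_sym[OF ideal_E2s]) simp_all
    then have "mono [Vx (rng G e), Gx e] - mono [Vx (rng G e), Gx e, Vx (src G e)] \<in> ?I" by simp
    finally have cong: "mono [Gx e] - mono [Vx (rng G e), Gx e, Vx (src G e)] \<in> ?I" .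
    have "y \<in> dom_act G [Gx e] \<longleftrightarrow> y \<in> cyl G (src G e, [e])" for y
      by (cases y; cases "snd y") (auto simp: dom_act_def cyl_def pext_Pair)
    then have "dom_act G [g] = cyl G (src G e, [e])" using Gx by blast
    with cong show "\<exists>p q. is_path G p \<and> is_path G q \<and> path_rng G p = path_rng G q \<and>
      dom_act G [g] = cyl G q \<and> act G [g] q = Some p \<and> mono [g] - mono (pq_word p q) \<in> ?I"
      using e Gx by - (rule exI[of _ "(rng G e, [])"], rule exI[of _ "(src G e, [e])"],
         auto simp: pq_word_def path_word_def word_star_def)
  qed
next
  case (cons g w)
  let ?I = "lpa_ideal G :: ('v,'e,'k) fa set"
  let ?thesis' = "\<exists>p q. is_path G p \<and> is_path G q \<and> path_rng G p = path_rng G q \<and>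
      dom_act G (g # w) = cyl G q \<and> act G (g # w) q = Some p \<and> mono (g # w) - mono (pq_word p q) \<in> ?I"
  have g: "valid_gen G g" and w: "valid_word G w" using cons.prems by simp_all
  from cons.IH[OF w] show ?case
  proof (elim disjE exE conjE)
    assume "dom_act G w = {}" "mono w \<in> ?I"
    then have "dom_act G (g # w) = {} \<and> mono (g # w) \<in> ?I"
      using mono_zero_ctx[of w G "[g]" "[]"] g by (auto simp: dom_act_def bind_eq_Some_conv)
    then show ?thesis by (rule disjI1)
  next
    fix p q assume p: "is_path G p" and q: "is_path G q" and pq: "path_rng G p = path_rng G q"
      and dom: "dom_act G w = cyl G q" and actq: "act G w q = Some p"
      and "mono w - mono (pq_word p q) \<in> ?I"
    then have cong: "mono (g # w) - mono (g # pq_word p q) \<in> ?I"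
      using mono_cong_ctx[of w "pq_word p q" G "[g]" "[]"] g by simp
    note domg = dom_act_Cons[OF q dom actq, of g]
    have pext_path: "is_path G (pext p x) \<longleftrightarrow> is_path G (pext q x)" for x
      using p q pq by (simp add: is_path_pext)
    obtain v es where p_eq: "p = (v, es)" by (cases p)
    define r where "r = word_star (path_word q)"
    have r: "valid_word G r" and es: "valid_word G (map Ex es)" and v: "v \<in> verts G"
      using valid_path_word[OF q] valid_path_word[OF p] by (auto simp: r_def p_eq path_word_def)
    have pq_word: "pq_word p q = Vx v # map Ex es @ r"
      by (simp add: pq_word_def r_def p_eq path_word_def)
    show ?thesis
    proof (cases g)
      case (Vx u)
      show ?thesis
      proof (cases "u = v")
        case True
        have "mono ([] @ [Vx v, Vx v] @ map Ex es @ r) - mono ([] @ [Vx v] @ map Ex es @ r) \<in> ?I"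
          using v es r by (intro mono_cong_ctx ideal_V) auto
        then have "mono (g # pq_word p q) - mono (pq_word p q) \<in> ?I"
          by (simp add: pq_word Vx True)
        from mono_cong_trans[OF cong this] have ?thesis'
          using p q pq True Vx actq domg
          by - (rule exI[of _ p], rule exI[of _ q],  auto simp: p_eq cyl_def)
        then show ?thesis ..
      next
        case False
        have "mono ([] @ [Vx u, Vx v] @ map Ex es @ r) \<in> ?I"
          using v es r g Vx False by (intro mono_zero_ctx ideal_V') auto
        then have "mono (g # pq_word p q) \<in> ?I" by (simp add: pq_word Vx)
        from mono_cong_zero[OF cong this] show ?thesis
          using domg False by (auto simp: Vx p_eq)
      qed
    next
      case (Ex e)
      have e: "e \<in> edges G" using g Ex by simp
      show ?thesis
      proof (cases "rng G e = v")
        case True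
        have "mono ([] @ [Ex e, Vx (rng G e)] @ map Ex es @ r) - mono ([] @ [Ex e] @ map Ex es @ r) \<in> ?I"
          using v es r e by (intro mono_cong_ctx ideal_E1r) auto
        also have "mono ([] @ [Ex e] @ map Ex es @ r) - mono ([] @ [Vx (src G e), Ex e] @ map Ex es @ r) \<in> ?I"
          using v es r e by (intro mono_cong_ctx mono_cong_sym[OF ideal_E1s]) auto
        finally have "mono (g # pq_word p q) - mono (pq_word (src G e, e # es) q) \<in> ?I"
          by (simp add: pq_word Ex True) (simp add: pq_word_def path_word_def r_def)
        from mono_cong_trans[OF cong this] have ?thesis'
          using p q pq True Ex e actq domg
          by - (rule exI[of _ "(src G e, e # es)"], rule exI[of _ q],  auto simp: p_eq cyl_def)
        then show ?thesis ..
      next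
        case False
        \<comment> \<open>(E1) inserts \<open>rng G e\<close> behind \<open>e\<close>, so that it
          meets the different vertex \<open>v\<close>.\<close>
        have "mono ([] @ [Ex e] @ Vx v # map Ex es @ r) - mono ([] @ [Ex e, Vx (rng G e)] @ Vx v # map Ex es @ r) \<in> ?I"
          using v es r e by (intro mono_cong_ctx mono_cong_sym[OF ideal_E1r]) auto
        moreover have "mono ([Ex e] @ [Vx (rng G e), Vx v] @ map Ex es @ r) \<in> ?I"
          using v es r e False by (intro mono_zero_ctx ideal_V') auto
        ultimately have "mono (g # pq_word p q) \<in> ?I"
          using mono_cong_zero by (simp add: pq_word Ex) blast
        from mono_cong_zero[OF cong this] show ?thesis
          using domg False by (auto simp: Ex p_eq)
      qed
    next
      case (Gx e)
      have e: "e \<in> edges G" using g Gx by simp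
      show ?thesis
      proof (cases "src G e = v")
        case False
        have "mono ([] @ [Gx e] @ Vx v # map Ex es @ r) - mono ([] @ [Gx e, Vx (src G e)] @ Vx v # map Ex es @ r) \<in> ?I"
          using v es r e by (intro mono_cong_ctx mono_cong_sym[OF ideal_E2s]) auto
        moreover have "mono ([Gx e] @ [Vx (src G e), Vx v] @ map Ex es @ r) \<in> ?I"
          using v es r e False by (intro mono_zero_ctx ideal_V') auto
        ultimately have "mono (g # pq_word p q) \<in> ?I"
          using mono_cong_zero by (simp add: pq_word Gx) blast
        moreover have "gen_act G g (pext p x) = None" if "is_path G (pext q x)" for x
          using that False unfolding pext_path[symmetric]
          by (auto simp: Gx p_eq pext_def split: list.splits)
        ultimately show ?thesis
          using domg mono_cong_zero[OF cong] by auto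
      next
        case src: True
        have c1: "mono ([] @ [Gx e, Vx (src G e)] @ map Ex es @ r) - mono ([] @ [Gx e] @ map Ex es @ r) \<in> ?I"
          using v es r e by (intro mono_cong_ctx ideal_E2s) auto
        show ?thesis
        proof (cases es)
          case (Cons f fs)
          have f: "f \<in> edges G" "valid_word G (map Ex fs)" using es Cons by auto
          show ?thesis
          proof (cases "f = e")
            case True
            have "mono ([] @ [Gx e, Ex e] @ map Ex fs @ r) - mono ([] @ [Vx (rng G e)] @ map Ex fs @ r) \<in> ?I"
              using f r e by (intro mono_cong_ctx ideal_CK1) auto
            then have "mono (g # pq_word p q) - mono (pq_word (rng G e, fs) q) \<in> ?I"
              using mono_cong_trans c1
              by (simp add: pq_word Gx src Cons True) (simp add: pq_word_def path_word_def r_def, blast)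
            from mono_cong_trans[OF cong this] have ?thesis'
              using p q pq True Gx e actq domg src Cons
              by - (rule exI[of _ "(rng G e, fs)"], rule exI[of _ q],  auto simp: p_eq cyl_def)
            then show ?thesis ..
          next
            case False
            have "mono ([] @ [Gx e, Ex f] @ map Ex fs @ r) \<in> ?I"
              using f r e False by (intro mono_zero_ctx ideal_CK1') auto
            then have "mono (g # pq_word p q) \<in> ?I"
              using mono_cong_zero c1 by (simp add: pq_word Gx src Cons) blast
            from mono_cong_zero[OF cong this] show ?thesis
              using domg False Cons by (auto simp: Gx p_eq)
          qed
        next
          \<comment> \<open>Here \<open>p\<close> is a vertex and offers no edge to cancel against;
            since \<open>e* q* = (q e)*\<close>, the ghost edge is absorbed into
            \<open>q\<close>.\<close>
          case Nil
          have "mono ([] @ [Gx e] @ r) - mono ([] @ [Vx (rng G e), Gx e] @ r) \<in> ?I"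
            using r e by (intro mono_cong_ctx mono_cong_sym[OF ideal_E2r]) auto
          moreover have "pq_word (rng G e, []) (pext q [e]) = Vx (rng G e) # Gx e # r"
            by (simp add: pq_word_def path_word_pext_single word_star_append r_def)
              (simp add: path_word_def word_star_def)
          ultimately have "mono (g # pq_word p q) - mono (pq_word (rng G e, []) (pext q [e])) \<in> ?I"
            using mono_cong_trans c1 by (simp add: pq_word Gx src Nil) blast
          note cong' = mono_cong_trans[OF cong this]
          have rq: "path_rng G q = v" using pq by (simp add: p_eq Nil)
          have q': "is_path G (pext q [e])" using q e rq src by (simp add: is_path_pext)
          have "gen_act G g (pext p x) \<noteq> None \<longleftrightarrow> (\<exists>x'. x = e # x')" for x
            by (cases x) (simp_all add: Gx p_eq Nil)
          then have "dom_act G (g # w) = {pext q x | x. is_path G (pext q x) \<and> (\<exists>x'. x = e # x')}"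
            unfolding domg by blast
          also have "\<dots> = cyl G (pext q [e])"
            by (auto simp: cyl_def)
          finally have dom': "dom_act G (g # w) = cyl G (pext q [e])" .
          have "act G (g # w) (pext q [e]) = Some (rng G e, [])"
            using act_pext[OF actq, of "[e]"] by (simp add: Gx p_eq Nil)
          then have ?thesis'
            using cong' dom' q' e
            by - (rule exI[of _ "(rng G e, [])"], rule exI[of _ "pext q [e]"],  auto simp: path_rng_pext)
          then show ?thesis ..
        qed
      qed
    qed
  qed
qed

end

section \<open>Functionals from values on cylinders\<close>

context leavitt
begin

definition fixset :: "('v,'e) gen list \<Rightarrow> ('v,'e) path set" where
  "fixset w = {y. is_path G y \<and> act G w y = Some y}"

text \<open>\<open>w\<close> carries \<open>q x\<close> to \<open>p x\<close>, and
  \<open>p x = q x\<close> forces \<open>p = q\<close> by cancelling \<open>x\<close>.\<close>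

lemma fixset_live:
  assumes "dom_act G w = cyl G q" "act G w q = Some p" "is_path G q"
  shows "fixset w = (if p = q then cyl G q else {})"
proof -
  have "fixset w = {y \<in> dom_act G w. act G w y = Some y}"
    by (auto simp: fixset_def dom_act_def)
  also have "\<dots> = {y \<in> cyl G q. \<exists>x. y = pext q x \<and> pext p x = pext q x}"
    unfolding assms(1) using act_pext[OF assms(2)] by (auto simp: cyl_def)
  also have "\<dots> = (if p = q then cyl G q else {})"
    by (auto simp: cyl_def pext_def prod_eq_iff)
  finally show ?thesis .
qed

lemma fixset_cases:
  assumes "w \<noteq> []" "valid_word G w"
  obtains "fixset w = {}" | q where "is_path G q" "fixset w = cyl G q"
  using normal_form[OF assms]
proof (elim disjE exE conjE)
  assume "dom_act G w = {}"
  then have "fixset w = {}" by (auto simp: fixset_def dom_act_def)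
  then show thesis by (rule that)
next
  fix p q assume "is_path G q" "dom_act G w = cyl G q" "act G w q = Some p"
  then show thesis using that fixset_live by (cases "p = q") auto
qed

lemma fixset_pq_word:
  assumes "is_path G p" "is_path G q" "path_rng G p = path_rng G q"
  shows "fixset (pq_word p q) = (if p = q then cyl G q else {})"
  using fixset_live act_pq_word[OF assms] assms by blast

lemma fixset_vertex: "fixset [Vx v] = cyl G (v, [])"
  by (auto simp: fixset_def cyl_def pext_def)

text \<open>Values are attached to sets of paths and not to words, so words with equal fixed sets
  agree by definition. \<open>cyl_inj\<close> makes the generator unique; the default 0 serves the
  empty set, which is no cylinder because a cylinder contains its generator.\<close>

definition cylval :: "(('v,'e) path \<Rightarrow> 'r::zero) \<Rightarrow> ('v,'e) path set \<Rightarrow> 'r" where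
  "cylval \<nu> S = (if \<exists>q. is_path G q \<and> S = cyl G q
     then \<nu> (THE q. is_path G q \<and> S = cyl G q) else 0)"

lemma cylval_cyl: "is_path G q \<Longrightarrow> cylval \<nu> (cyl G q) = \<nu> q"
proof -
  assume q: "is_path G q"
  have "(THE q'. is_path G q' \<and> cyl G q = cyl G q') = q"
  proof (rule the_equality)
    fix r assume "is_path G r \<and> cyl G q = cyl G r"
    then show "r = q" using cyl_inj[OF q, of r] by simp
  qed (simp add: q)
  then show ?thesis using q unfolding cylval_def by metis
qed

lemma cylval_empty: "cylval \<nu> {} = 0"
  using cyl_self unfolding cylval_def by (metis empty_iff)

text \<open>\<open>\<nu>\<close> may depend on the whole path: \<open>vertex_nonzero\<close> needs
  this, while traces take \<open>\<delta> (path_rng G q)\<close> for \<open>\<nu> q\<close>.\<close>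

definition wval :: "(('v,'e) path \<Rightarrow> 'r::zero) \<Rightarrow> ('v,'e) gen list \<Rightarrow> 'r" where
  "wval \<nu> w = cylval \<nu> (fixset w)"

lemma wval_pq_word:
  assumes "is_path G p" "is_path G q" "path_rng G p = path_rng G q"
  shows "wval \<nu> (pq_word p q) = (if p = q then \<nu> q else 0)"
  by (simp add: wval_def fixset_pq_word[OF assms] cylval_cyl assms cylval_empty)

lemma wval_vertex: "v \<in> verts G \<Longrightarrow> wval \<nu> [Vx v] = \<nu> (v, [])"
  by (simp add: wval_def fixset_vertex cylval_cyl)

text \<open>An equality of partial maps on paths survives composition with \<open>u\<close> and
  \<open>v\<close>, since \<open>act\<close> sends paths to paths.\<close>

lemma fixset_ctx_cong:
  assumes "\<And>y. is_path G y \<Longrightarrow> act G a y = act G b y"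
  shows "fixset (u @ a @ v) = fixset (u @ b @ v)"
proof -
  have "act G (u @ a @ v) y = act G (u @ b @ v) y" if "is_path G y" for y
    using act_path(1)[of v y] that assms by (cases "act G v y") (auto simp: act_append)
  then show ?thesis by (auto simp: fixset_def)
qed

lemma fixset_ctx_empty:
  assumes "\<And>y. is_path G y \<Longrightarrow> act G a y = None"
  shows "fixset (u @ a @ v) = {}"
proof -
  have "act G (u @ a @ v) y = None" if "is_path G y" for y
    using act_path(1)[of v y] that assms by (cases "act G v y") (auto simp: act_append)
  then show ?thesis by (auto simp: fixset_def)
qed

lemma act_edge_ghost:
  assumes "is_path G y"
  shows "act G [Ex e, Gx e] y = (if \<exists>es. snd y = e # es then Some y else None)"
  using assms by (cases y; cases "snd y") auto

text \<open>Let the fixed paths of \<open>u @ Vx v # w\<close> form the cylinder of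
  \<open>q\<close>, and let \<open>w\<close> carry \<open>q\<close> to \<open>z\<close>, a path
  starting at \<open>v\<close>. If \<open>z\<close> begins with an edge \<open>f\<close>, then
  \<open>f\<close> alone inherits the whole cylinder and the other edges get nothing. If
  \<open>z\<close> has length 0, the edge \<open>e\<close> gets the cylinder of \<open>q e\<close>,
  and the hypothesis on \<open>\<nu>\<close> adds these values up to \<open>\<nu> q\<close>.\<close>

lemma wval_CK2:
  assumes \<nu>: "\<And>q. is_path G q \<Longrightarrow> regular G (path_rng G q) \<Longrightarrow>
      \<nu> q = (\<Sum>e\<in>out_edges G (path_rng G q). \<nu> (pext q [e]))"
    and u: "valid_word G u" and w: "valid_word G w" and v: "regular G v"
  shows "wval \<nu> (u @ Vx v # w) = (\<Sum>e\<in>out_edges G v. wval \<nu> (u @ Ex e # Gx e # w) :: 'r::ring)"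
proof -
  let ?S = "fixset (u @ Vx v # w)" and ?Se = "\<lambda>e. fixset (u @ Ex e # Gx e # w)"
  have fin: "finite (out_edges G v)" and vv: "v \<in> verts G" using v by (auto simp: regular_def)
  have S: "y \<in> ?S \<longleftrightarrow> is_path G y \<and> (\<exists>z. act G w y = Some z \<and> fst z = v \<and> act G u z = Some y)" for y
    by (auto simp: fixset_def act_append bind_eq_Some_conv split: if_splits)
  have Se: "y \<in> ?Se e \<longleftrightarrow>
      is_path G y \<and> (\<exists>z. act G w y = Some z \<and> (\<exists>es. snd z = e # es) \<and> act G u z = Some y)" for y e
  proof -
    have "act G (u @ Ex e # Gx e # w) y = Some y \<longleftrightarrow>
        (\<exists>z. act G w y = Some z \<and> (\<exists>es. snd z = e # es) \<and> act G u z = Some y)"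
      if y: "is_path G y"
    proof (cases "act G w y")
      case (Some z)
      then have "is_path G z" using act_path y by blast
      moreover have "act G (Ex e # Gx e # w) y = act G [Ex e, Gx e] z" by (simp add: Some)
      ultimately have "act G (u @ Ex e # Gx e # w) y =
          Option.bind (if \<exists>es. snd z = e # es then Some z else None) (act G u)"
        by (simp only: act_append act_edge_ghost)
      then show ?thesis using Some by simp
    qed (simp add: act_append)
    then show ?thesis by (auto simp: fixset_def)
  qed
  have Se_sub: "?Se e \<subseteq> ?S" if "e \<in> out_edges G v" for e
  proof
    fix y assume y: "y \<in> ?Se e"
    then obtain z es where z: "is_path G y" "act G w y = Some z" "snd z = e # es" "act G u z = Some y"
      by (auto simp: Se)
    then have "is_path G z" using act_path by blast
    then have "fst z = v" using z that by (cases z) (auto simp: out_edges_def)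
    then show "y \<in> ?S" using z by (auto simp: S)
  qed
  have "u @ Vx v # w \<noteq> []" "valid_word G (u @ Vx v # w)" using u w vv by auto
  then show ?thesis
  proof (cases rule: fixset_cases)
    case 1
    then have "wval \<nu> (u @ Ex e # Gx e # w) = 0" if "e \<in> out_edges G v" for e
      using Se_sub[OF that] unfolding wval_def by (simp only: subset_empty cylval_empty)
    then show ?thesis using 1 by (simp add: wval_def cylval_empty)
  next
    case (2 q)
    have "q \<in> ?S" using 2 cyl_self by blast
    then obtain z where z: "act G w q = Some z" "fst z = v" "act G u z = Some q" by (auto simp: S)
    have z_path: "is_path G z" "path_rng G z = path_rng G q" using act_path[OF z(1) 2(1)] by auto
    have Se': "?Se e = {pext q x | x. is_path G (pext q x) \<and> (\<exists>es. snd z @ x = e # es)}"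
      if "e \<in> out_edges G v" for e
    proof -
      have *: "pext q x \<in> ?Se e \<longleftrightarrow> is_path G (pext q x) \<and> (\<exists>es. snd z @ x = e # es)" for x
        unfolding Se using act_pext[OF z(1)] act_pext[OF z(3)] by simp
      have "?Se e = {y \<in> cyl G q. y \<in> ?Se e}" using Se_sub[OF that] 2 by blast
      also have "\<dots> = {pext q x | x. is_path G (pext q x) \<and> (\<exists>es. snd z @ x = e # es)}"
        unfolding cyl_def using * by blast
      finally show ?thesis .
    qed
    show ?thesis
    proof (cases "snd z")
      case (Cons f fs)
      have f: "f \<in> out_edges G v"
        using z_path z(2) Cons by (cases z) (auto simp: out_edges_def)
      have "wval \<nu> (u @ Ex e # Gx e # w) = (if e = f then \<nu> q else 0)" if "e \<in> out_edges G v" for e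
      proof (cases "e = f")
        case True
        then have "?Se e = cyl G q" using Se'[OF that] Cons by (auto simp: cyl_def)
        then show ?thesis using True 2 unfolding wval_def by (simp only: cylval_cyl simp_thms if_True)
      next
        case False
        then have "?Se e = {}" using Se'[OF that] Cons by auto
        then show ?thesis using False unfolding wval_def by (simp only: cylval_empty if_False)
      qed
      then have "(\<Sum>e\<in>out_edges G v. wval \<nu> (u @ Ex e # Gx e # w)) = \<nu> q"
        using f fin by simp
      then show ?thesis using 2 by (simp add: wval_def cylval_cyl)
    next
      case Nil
      \<comment> \<open>\<open>act\<close> preserves ranges, so \<open>q\<close> ends where the
        trivial path \<open>z\<close> does.\<close>
      have rq: "path_rng G q = v" using z_path(2) z(2) Nil by (cases z) auto
      have "wval \<nu> (u @ Ex e # Gx e # w) = \<nu> (pext q [e])" if "e \<in> out_edges G v" for e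
      proof -
        have "?Se e = cyl G (pext q [e])" using Se'[OF that] Nil by (auto simp: cyl_def)
        moreover have "is_path G (pext q [e])"
          using that 2 rq by (auto simp: is_path_pext out_edges_def)
        ultimately show ?thesis unfolding wval_def by (simp only: cylval_cyl)
      qed
      then have "(\<Sum>e\<in>out_edges G v. wval \<nu> (u @ Ex e # Gx e # w)) = \<nu> q"
        using \<nu>[OF 2(1)] v rq by simp
      then show ?thesis using 2 by (simp add: wval_def cylval_cyl)
    qed
  qed
qed

text \<open>All relations except (CK2) are equalities between partial maps or assert that one is
  nowhere defined; they fall to \<open>cong\<close> and \<open>zero\<close>. For (CK2) the sum of
  words is evaluated first, and \<open>wval_CK2\<close> applies.\<close>

lemma lin_wval_ideal:
  fixes smul :: "'k \<Rightarrow> 'r::ring \<Rightarrow> 'r"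
  assumes mod: "module smul"
    and \<nu>: "\<And>q. is_path G q \<Longrightarrow> regular G (path_rng G q) \<Longrightarrow>
      \<nu> q = (\<Sum>e\<in>out_edges G (path_rng G q). \<nu> (pext q [e]))"
    and x: "x \<in> lpa_ideal G"
  shows "lin smul (wval \<nu>) x = 0"
proof -
  have "lin smul (\<lambda>w. wval \<nu> (u @ w @ v)) x = 0"
    if u: "valid_word G u" and v: "valid_word G v" and x: "x \<in> lpa_rels G" for u v x
  proof -
    let ?\<phi> = "\<lambda>w. wval \<nu> (u @ w @ v)"
    have diff: "lin smul ?\<phi> (mono a - y) = 0"
      if "?\<phi> a = lin smul ?\<phi> y" "finite {w. y w \<noteq> 0}" for a y
    proof -
      have fin: "finite {w. (mono a - y) w \<noteq> 0}"
        by (rule finite_subset[of _ "insert a {w. y w \<noteq> 0}"])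
          (auto simp: pointwise mono_def that split: if_splits)
      have "lin smul ?\<phi> (mono a - y) + lin smul ?\<phi> y = lin smul ?\<phi> (mono a - y + y)"
        using fin that(2) by (rule lin_add[OF mod, symmetric])
      then show ?thesis using that(1) by (simp add: lin_mono[OF mod])
    qed
    have fin_mono: "finite {w. mono a w \<noteq> (0::'k)}" for a :: "('v,'e) gen list"
      by (simp add: mono_def)
    have cong: "lin smul ?\<phi> (mono a - mono b) = 0"
      if "\<And>y. is_path G y \<Longrightarrow> act G a y = act G b y" for a b
      using fixset_ctx_cong[OF that, of u v] fin_mono
      by (intro diff) (simp_all add: lin_mono[OF mod] wval_def)
    have zero: "lin smul ?\<phi> (mono a) = 0" if "\<And>y. is_path G y \<Longrightarrow> act G a y = None" for a
      using fixset_ctx_empty[OF that, of u v] by (simp add: lin_mono[OF mod] wval_def cylval_empty)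
    from x show ?thesis
    proof (cases rule: lpa_rels_cases)
      case (V a)
      show ?thesis unfolding V(2) by (rule cong) simp
    next
      case (V' a b)
      show ?thesis unfolding V'(4) by (rule zero) (use V' in auto)
    next
      case (E1s e)
      show ?thesis unfolding E1s(2) by (rule cong) simp
    next
      case (E1r e)
      show ?thesis unfolding E1r(2) by (rule cong) simp
    next
      case (E2r e)
      show ?thesis unfolding E2r(2) by (rule cong) (simp split: list.splits)
    next
      case (E2s e)
      \<comment> \<open>Stripping \<open>e\<close> does not look at the source, but a path whose
        first edge is \<open>e\<close> starts at \<open>src G e\<close>.\<close>
      have "act G [Gx e, Vx (src G e)] y = act G [Gx e] y" if "is_path G y" for y
        using that by (cases y; cases "snd y") auto
      then show ?thesis unfolding E2s(2) by (rule cong)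
    next
      case (CK1 e)
      have "act G [Gx e, Ex e] y = act G [Vx (rng G e)] y" if "is_path G y" for y
        using CK1(1) by (cases y) auto
      then show ?thesis unfolding CK1(2) by (rule cong)
    next
      case (CK1' e f)
      show ?thesis unfolding CK1'(4) by (rule zero) (use CK1' in auto)
    next
      case (CK2 a)
      have "lin smul ?\<phi> (\<Sum>e\<in>A. mono [Ex e, Gx e]) = (\<Sum>e\<in>A. ?\<phi> [Ex e, Gx e])"
        if "finite A" "A \<subseteq> edges G" for A
        using that
      proof (induction A)
        case empty
        show ?case by (simp add: lin_zero[OF mod])
      next
        case (insert e A)
        have "(\<Sum>e\<in>A. mono [Ex e, Gx e] :: ('v,'e,'k) fa) \<in> free_alg G"
          using insert by (intro free_alg_sum free_alg_mono) auto
        then show ?case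
          using insert by (simp add: lin_add[OF mod] free_alg_finite fin_mono lin_mono[OF mod])
      qed
      moreover have "finite (out_edges G a)" "out_edges G a \<subseteq> edges G"
        using CK2 by (auto simp: regular_def out_edges_def)
      moreover have "(\<Sum>e\<in>out_edges G a. mono [Ex e, Gx e] :: ('v,'e,'k) fa) \<in> free_alg G"
        by (intro free_alg_sum free_alg_mono) (auto simp: out_edges_def)
      ultimately show ?thesis
        unfolding CK2(2) using wval_CK2[where \<nu> = \<nu>, OF \<nu> u v CK2(1)]
        by (intro diff) (auto simp: free_alg_finite)
    qed
  qed
  then have "lin smul (\<lambda>w. wval \<nu> ([] @ w @ [])) x = 0"
    by (intro lin_ideal[OF mod wf _ x]) auto
  then show ?thesis by simp
qed

text \<open>A nonzero graph trace need not exist, so vertices are separated from \<open>0\<close> by the functional that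
  follows one chosen edge out of every regular vertex.\<close>

lemma vertex_nonzero:
  assumes v: "v \<in> verts G"
  shows "mono [Vx v] \<notin> (lpa_ideal G :: ('v,'e,'k) fa set)"
proof
  assume *: "mono [Vx v] \<in> (lpa_ideal G :: ('v,'e,'k) fa set)"
  define ch where "ch u = (SOME e. e \<in> out_edges G u)" for u
  define \<nu> :: "('v,'e) path \<Rightarrow> 'k" where
    "\<nu> q = (if \<forall>e\<in>set (snd q). e = ch (src G e) then 1 else 0)" for q
  have mod: "module ((*) :: 'k \<Rightarrow> 'k \<Rightarrow> 'k)"
    by unfold_locales (auto simp: algebra_simps)
  have "\<nu> q = (\<Sum>e\<in>out_edges G (path_rng G q). \<nu> (pext q [e]))"
    if q: "is_path G q" and reg: "regular G (path_rng G q)" for q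
  proof -
    have ch: "ch (path_rng G q) \<in> out_edges G (path_rng G q)"
      using reg some_in_eq unfolding ch_def regular_def by blast
    have "\<nu> (pext q [e]) = (if e = ch (path_rng G q) then \<nu> q else 0)"
      if "e \<in> out_edges G (path_rng G q)" for e
      using that by (auto simp: \<nu>_def out_edges_def)
    then show ?thesis using ch reg by (simp add: regular_def)
  qed
  from lin_wval_ideal[OF mod this *] show False
    using v by (simp add: lin_mono[OF mod] wval_vertex \<nu>_def)
qed

text \<open>\<open>b\<close> carries the generator \<open>q\<close> of the fixed set of
  \<open>a b\<close> to a path \<open>q'\<close> fixed by \<open>b a\<close>. It is again the
  generator: if \<open>q' = r x\<close> with \<open>r\<close> generating, then \<open>a\<close>
  carries \<open>r\<close> to some \<open>q y\<close>, hence \<open>q'\<close> to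
  \<open>q y x\<close>; but \<open>a\<close> carries \<open>q'\<close> to \<open>q\<close>, so
  \<open>x\<close> is empty.\<close>

lemma fixset_append_commute:
  assumes "fixset (a @ b) = cyl G q" "is_path G q"
    and ab: "valid_word G a" "valid_word G b" "a \<noteq> []"
  obtains q' where "is_path G q'" "fixset (b @ a) = cyl G q'" "path_rng G q' = path_rng G q"
proof -
  have "q \<in> fixset (a @ b)" using assms cyl_self by blast
  then obtain q' where q': "act G b q = Some q'" "act G a q' = Some q"
    by (auto simp: fixset_def act_append bind_eq_Some_conv)
  have q'_path: "is_path G q'" "path_rng G q' = path_rng G q"
    using act_path[OF q'(1) assms(2)] by auto
  then have q'_fix: "q' \<in> fixset (b @ a)"
    using q' by (simp add: fixset_def act_append)
  have "b @ a \<noteq> []" "valid_word G (b @ a)" using ab by auto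
  then show thesis
  proof (cases rule: fixset_cases)
    case 1
    then show ?thesis using q'_fix by simp
  next
    case (2 r)
    then obtain x where x: "q' = pext r x" using q'_fix by (auto simp: cyl_def)
    have "r \<in> fixset (b @ a)" using 2 cyl_self by blast
    then obtain z where z: "act G a r = Some z" "act G b z = Some r"
      by (auto simp: fixset_def act_append bind_eq_Some_conv)
    then have "z \<in> fixset (a @ b)"
      using act_path(1)[OF z(1) 2(1)] by (simp add: fixset_def act_append)
    then obtain y where y: "z = pext q y" using assms by (auto simp: cyl_def)
    have "pext z x = q" using act_pext[OF z(1), of x] q'(2) x by simp
    then have "x = []" using y by simp
    then show ?thesis using that[of q'] q'_path 2 x by simp
  qed
qed

text \<open>The generators of the two fixed sets are related by the action of \<open>b\<close>,
  which preserves the range but not the path; hence values of the form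
  \<open>\<delta> (path_rng G q)\<close>.\<close>

lemma wval_commute:
  assumes ab: "valid_word G a" "valid_word G b" "a \<noteq> []" "b \<noteq> []"
  shows "wval (\<lambda>q. \<delta> (path_rng G q)) (a @ b) = wval (\<lambda>q. \<delta> (path_rng G q)) (b @ a)"
proof -
  have ne: "a @ b \<noteq> []" "valid_word G (a @ b)" "b @ a \<noteq> []" "valid_word G (b @ a)"
    using ab by auto
  from ne(1,2) show ?thesis
  proof (cases rule: fixset_cases)
    case 1
    from ne(3,4) have "fixset (b @ a) = {}"
    proof (cases rule: fixset_cases)
      case (2 q)
      then obtain q' where "is_path G q'" "fixset (a @ b) = cyl G q'"
        using fixset_append_commute[of b a q] ab by metis
      then show ?thesis using 1 cyl_self by blast
    qed
    then show ?thesis using 1 by (simp add: wval_def)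
  next
    case (2 q)
    then obtain q' where "is_path G q'" "fixset (b @ a) = cyl G q'" "path_rng G q' = path_rng G q"
      using fixset_append_commute[of a b q] ab by metis
    then show ?thesis using 2 by (simp add: wval_def cylval_cyl)
  qed
qed

text \<open>Rotated to \<open>b* a\<close>, the word fixes \<open>y\<close> precisely if
  \<open>a\<close> and \<open>b\<close> send \<open>y\<close> to the same path. The value becomes
  that of a coincidence set, a description symmetric in \<open>a\<close> and
  \<open>b\<close>.\<close>

lemma wval_star:
  assumes ab: "valid_word G a" "valid_word G b" "a \<noteq> []" "b \<noteq> []"
  shows "wval (\<lambda>q. \<delta> (path_rng G q)) (a @ word_star b) =
    cylval (\<lambda>q. \<delta> (path_rng G q)) {y. is_path G y \<and> act G a y \<noteq> None \<and> act G a y = act G b y}"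
proof -
  have "act G (word_star b @ a) y = Some y \<longleftrightarrow> act G a y \<noteq> None \<and> act G a y = act G b y"
    if y: "is_path G y" for y
  proof (cases "act G a y")
    case (Some z)
    then have "is_path G z" using act_path y by blast
    then show ?thesis using act_word_star[OF y, of z b] Some by (auto simp: act_append)
  qed (simp add: act_append)
  then have "fixset (word_star b @ a) =
      {y. is_path G y \<and> act G a y \<noteq> None \<and> act G a y = act G b y}"
    unfolding fixset_def by blast
  then show ?thesis
    using wval_commute[of a "word_star b" \<delta>] ab by (simp add: wval_def)
qed

end

section \<open>The quadratic form of a graph trace\<close>

definition prefix_closed :: "('v,'e) path set \<Rightarrow> bool" where
  "prefix_closed D \<longleftrightarrow> (\<forall>u x. pext u x \<in> D \<longrightarrow> u \<in> D)"

text \<open>Moebius inversion on the tree \<open>D\<close>. The group is left general because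
  \<open>g\<close> takes values in \<open>R\<close> for the trace and in the free algebra in
  \<open>in_ideal_if_fibres_vanish\<close>.\<close>

definition weight :: "('v,'e) path set \<Rightarrow> (('v,'e) path \<Rightarrow> 'a::ab_group_add) \<Rightarrow> ('v,'e) path \<Rightarrow> 'a" where
  "weight D g u = g u - (\<Sum>e | pext u [e] \<in> D. g (pext u [e]))"

lemma finite_children:
  assumes "finite D"
  shows "finite {e. pext u [e] \<in> D}"
proof -
  have "inj (\<lambda>e. pext u [e])" by (auto simp: inj_on_def)
  then show ?thesis using finite_vimageI[OF assms] by (simp add: vimage_def)
qed

text \<open>The sum telescopes: every member of \<open>D\<close> that properly extends
  \<open>q\<close> is the child of exactly one member extending \<open>q\<close>, namely its own
  truncation by the last edge, which prefix closure puts into \<open>D\<close>.\<close>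

lemma sum_weight:
  fixes g :: "('v,'e) path \<Rightarrow> 'a::ab_group_add"
  assumes D: "finite D" "prefix_closed D" and q: "q \<in> D"
  shows "(\<Sum>u | u \<in> D \<and> (\<exists>x. u = pext q x). weight D g u) = g q"
proof -
  let ?C = "{u. u \<in> D \<and> (\<exists>x. u = pext q x)}" and ?E = "\<lambda>u. {e. pext u [e] \<in> D}"
  let ?h = "\<lambda>(u, e). pext u [e]"
  have fin: "finite ?C" using D by simp
  have inj: "inj_on ?h (Sigma ?C ?E)"
    by (auto simp: inj_on_def pext_def prod_eq_iff)
  have img: "?h ` Sigma ?C ?E = ?C - {q}"
  proof
    show "?h ` Sigma ?C ?E \<subseteq> ?C - {q}" by auto
    show "?C - {q} \<subseteq> ?h ` Sigma ?C ?E"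
    proof
      fix u assume "u \<in> ?C - {q}"
      then obtain x where x: "u \<in> D" "u = pext q x" "x \<noteq> []" by auto
      then have u: "u = pext (pext q (butlast x)) [last x]" by simp
      then have "pext q (butlast x) \<in> D" using D x unfolding prefix_closed_def by metis
      then have "(pext q (butlast x), last x) \<in> Sigma ?C ?E" using u x by auto
      then show "u \<in> ?h ` Sigma ?C ?E" using u by (intro image_eqI) auto
    qed
  qed
  have "(\<Sum>u\<in>?C. \<Sum>e\<in>?E u. g (pext u [e])) = (\<Sum>(u, e)\<in>Sigma ?C ?E. g (pext u [e]))"
    using fin finite_children[OF D(1)] by (intro sum.Sigma) auto
  also have "\<dots> = sum g (?h ` Sigma ?C ?E)"
    by (subst sum.reindex[OF inj]) (simp add: o_def case_prod_unfold)
  finally have "(\<Sum>u\<in>?C. weight D g u) = sum g ?C - sum g (?C - {q})"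
    by (simp add: weight_def sum_subtractf img)
  also have "\<dots> = g q"
  proof -
    have "q \<in> ?C" using q by (auto intro: exI[of _ "[]"])
    then show ?thesis using sum.remove[OF fin, of q g] by simp
  qed
  finally show ?thesis .
qed

section \<open>Coincidence sets over a finite tree, and the diagonal form\<close>

context leavitt
begin

definition adapted :: "('v,'e) path set \<Rightarrow> ('v,'e) gen list set \<Rightarrow> bool" where
  "adapted D A \<longleftrightarrow> finite D \<and> (\<forall>u\<in>D. is_path G u) \<and> prefix_closed D \<and>
     (\<forall>w\<in>A. dom_act G w = {} \<or> (\<exists>q\<in>D. dom_act G w = cyl G q))"

text \<open>\<open>D\<close> consists of all prefixes of the generators \<open>Q\<close>. These are
  finitely many, because \<open>cyl\<close> is injective on them with values among the domains of
  finitely many words.\<close>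

lemma adapted_exists:
  assumes A: "finite A" "\<And>w. w \<in> A \<Longrightarrow> w \<noteq> [] \<and> valid_word G w"
  shows "\<exists>D. adapted D A"
proof -
  define Q where "Q = {q. is_path G q \<and> (\<exists>w\<in>A. dom_act G w = cyl G q)}"
  define D where "D = {u. \<exists>x. pext u x \<in> Q}"
  have "inj_on (cyl G) Q" unfolding Q_def by (rule inj_onI) (blast intro: cyl_inj)
  moreover have "finite (cyl G ` Q)"
    by (rule finite_subset[of _ "dom_act G ` A"]) (use A in \<open>auto simp: Q_def\<close>)
  ultimately have Q: "finite Q" using finite_imageD by blast
  have "D \<subseteq> (\<Union>q\<in>Q. (\<lambda>n. (fst q, take n (snd q))) ` {..length (snd q)})"
  proof
    fix u assume "u \<in> D"
    then obtain x where x: "pext u x \<in> Q" by (auto simp: D_def)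
    have "u = (fst (pext u x), take (length (snd u)) (snd (pext u x)))"
      "length (snd u) \<le> length (snd (pext u x))" by simp_all
    then show "u \<in> (\<Union>q\<in>Q. (\<lambda>n. (fst q, take n (snd q))) ` {..length (snd q)})"
      using x by blast
  qed
  then have "finite D" using Q finite_subset by (metis (no_types, lifting) finite_UN finite_atMost finite_imageI)
  moreover have "\<forall>u\<in>D. is_path G u" by (auto simp: D_def Q_def is_path_pext)
  moreover have "prefix_closed D" by (auto simp: prefix_closed_def D_def)
  moreover have "dom_act G w = {} \<or> (\<exists>q\<in>D. dom_act G w = cyl G q)" if "w \<in> A" for w
  proof -
    have "q \<in> D" if "is_path G q" "dom_act G w = cyl G q" for q
    proof -
      have "pext q [] \<in> Q" using that \<open>w \<in> A\<close> unfolding Q_def by (simp, blast)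
      then show ?thesis unfolding D_def by blast
    qed
    then show ?thesis using normal_form[of w] A(2)[OF that] by blast
  qed
  ultimately show ?thesis unfolding adapted_def by blast
qed

text \<open>One coincidence suffices. At \<open>y = q x z\<close> the two words give
  \<open>p z\<close> and \<open>p' x z\<close>; cancelling \<open>z\<close> yields
  \<open>p = p' x\<close>, so they already agree on the generator \<open>q x\<close>, hence on its
  whole cylinder.\<close>

lemma coincidence_cyl:
  assumes a: "dom_act G a = cyl G (pext q x)" "is_path G (pext q x)"
    and b: "dom_act G b = cyl G q"
    and y: "is_path G y" "act G a y \<noteq> None" "act G a y = act G b y"
  shows "{y. is_path G y \<and> act G a y \<noteq> None \<and> act G a y = act G b y} = cyl G (pext q x)"
proof
  show "{y. is_path G y \<and> act G a y \<noteq> None \<and> act G a y = act G b y} \<subseteq> cyl G (pext q x)"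
    using a(1) by (auto simp: dom_act_def)
  have q: "is_path G q" using a(2) by (simp add: is_path_pext)
  have "pext q x \<in> dom_act G a" "q \<in> dom_act G b" using a b q cyl_self by simp_all
  then obtain p p' where p: "act G a (pext q x) = Some p" and p': "act G b q = Some p'"
    unfolding dom_act_def by blast
  have "y \<in> cyl G (pext q x)" using y a(1) by (auto simp: dom_act_def)
  then obtain z where z: "y = pext q (x @ z)" by (auto simp: cyl_def)
  then have "pext p z = pext p' (x @ z)"
    using y act_pext[OF p, of z] act_pext[OF p', of "x @ z"] by simp
  then have "p = pext p' x" by (auto simp: pext_def prod_eq_iff)
  then have "act G a (pext q (x @ z)) = Some (pext p' (x @ z))"
    "act G b (pext q (x @ z)) = Some (pext p' (x @ z))" for z
    using act_pext[OF p, of z] act_pext[OF p', of "x @ z"] by simp_all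
  then show "cyl G (pext q x) \<subseteq> {y. is_path G y \<and> act G a y \<noteq> None \<and> act G a y = act G b y}"
    by (auto simp: cyl_def)
qed

text \<open>If the words agree somewhere, the generators of both domains are prefixes of a common
  path, so one extends the other and the coincidence set is the smaller of the two cylinders. Its
  generator lies in \<open>D\<close>, and \<open>sum_weight\<close> spreads its value over the
  members of \<open>D\<close> extending it.\<close>

lemma cylval_coincidence:
  fixes \<nu> :: "('v,'e) path \<Rightarrow> 'r::ring"
  assumes D: "adapted D A" and ab: "a \<in> A" "b \<in> A"
  shows "cylval \<nu> {y. is_path G y \<and> act G a y \<noteq> None \<and> act G a y = act G b y} =
    (\<Sum>u\<in>D. if act G a u \<noteq> None \<and> act G a u = act G b u then weight D \<nu> u else 0)"
    (is "cylval \<nu> ?S = _")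
proof -
  have fin: "finite D" and paths: "\<And>u. u \<in> D \<Longrightarrow> is_path G u" and closed: "prefix_closed D"
    and cover: "\<And>w. w \<in> A \<Longrightarrow> dom_act G w = {} \<or> (\<exists>q\<in>D. dom_act G w = cyl G q)"
    using D unfolding adapted_def by blast+
  have rhs: "(\<Sum>u\<in>D. if act G a u \<noteq> None \<and> act G a u = act G b u then weight D \<nu> u else 0) =
      (\<Sum>u | u \<in> D \<and> u \<in> ?S. weight D \<nu> u)"
    using fin paths by (subst sum.inter_filter[symmetric]) (auto intro!: sum.cong)
  have "?S = {} \<or> (\<exists>q\<in>D. ?S = cyl G q)"
  proof (cases "?S = {}")
    case False
    then obtain y where y: "is_path G y" "act G a y \<noteq> None" "act G a y = act G b y" by blast
    then have "y \<in> dom_act G a" "y \<in> dom_act G b" by (auto simp: dom_act_def)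
    then obtain q q' where q: "q \<in> D" "dom_act G a = cyl G q" and q': "q' \<in> D" "dom_act G b = cyl G q'"
      using cover[OF ab(1)] cover[OF ab(2)] by (metis empty_iff)
    obtain x x' where x: "y = pext q x" "y = pext q' x'"
      using \<open>y \<in> dom_act G a\<close> \<open>y \<in> dom_act G b\<close> q q' by (auto simp: cyl_def)
    then have "fst q = fst q'" "snd q @ x = snd q' @ x'" by (auto simp: pext_def)
    then have "(\<exists>c. q = pext q' c) \<or> (\<exists>c. q' = pext q c)"
      by (simp add: append_eq_append_conv2 pext_def prod_eq_iff) metis
    then show ?thesis
    proof (elim disjE exE)
      fix c assume c: "q = pext q' c"
      have "?S = cyl G q"
        unfolding c by (rule coincidence_cyl[OF _ _ q'(2) y])
          (use q paths in \<open>simp_all only: c\<close>)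
      then show ?thesis using q(1) by (intro disjI2 bexI)
    next
      fix c assume c: "q' = pext q c"
      \<comment> \<open>\<open>coincidence_cyl\<close> expects the smaller domain first, so
        \<open>a\<close> and \<open>b\<close> change places.\<close>
      have y': "act G b y \<noteq> None" "act G b y = act G a y" using y by metis+
      have "?S = {y. is_path G y \<and> act G b y \<noteq> None \<and> act G b y = act G a y}" by metis
      also have "\<dots> = cyl G q'"
        unfolding c by (rule coincidence_cyl[OF _ _ q(2) y(1) y'])
          (use q' paths in \<open>simp_all only: c\<close>)
      finally show ?thesis using q'(1) by (intro disjI2 bexI)
    qed
  qed simp
  then show ?thesis
  proof
    assume "?S = {}"
    then show ?thesis unfolding rhs by (simp only: cylval_empty empty_iff simp_thms) simp
  next
    assume "\<exists>q\<in>D. ?S = cyl G q"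
    then obtain q where q: "q \<in> D" "?S = cyl G q" by blast
    have set: "{u. u \<in> D \<and> u \<in> cyl G q} = {u. u \<in> D \<and> (\<exists>x. u = pext q x)}"
      using paths by (auto simp: cyl_def)
    show ?thesis
      unfolding rhs q(2) set sum_weight[OF fin closed q(1)] cylval_cyl[OF paths[OF q(1)]] ..
  qed
qed

text \<open>The entry in column \<open>u\<close> and row \<open>x\<close> of the matrix by which
  \<open>f\<close> acts on the vector space with the paths as basis.\<close>

definition fibre_sum :: "('v,'e,'k) fa \<Rightarrow> ('v,'e) path \<Rightarrow> ('v,'e) path \<Rightarrow> 'k" where
  "fibre_sum f u x = (\<Sum>w | f w \<noteq> 0. if act G w u = Some x then f w else 0)"

definition images :: "('v,'e,'k) fa \<Rightarrow> ('v,'e) path \<Rightarrow> ('v,'e) path set" where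
  "images f u = {x. \<exists>w. f w \<noteq> 0 \<and> act G w u = Some x}"

lemma finite_images: "f \<in> free_alg G \<Longrightarrow> finite (images f u)"
proof -
  assume "f \<in> free_alg G"
  then have "finite ((\<lambda>w. the (act G w u)) ` {w. f w \<noteq> 0})" using free_alg_finite by blast
  moreover have "images f u \<subseteq> (\<lambda>w. the (act G w u)) ` {w. f w \<noteq> 0}"
    unfolding images_def by force
  ultimately show ?thesis using finite_subset by blast
qed

text \<open>Pairs of words that agree at \<open>u\<close> are sorted by their common value
  \<open>x\<close>; for fixed \<open>x\<close> the double sum is a product of two single
  sums.\<close>

lemma sum_fibres:
  assumes f: "f \<in> free_alg G"
  shows "(\<Sum>a | f a \<noteq> 0. \<Sum>b | f b \<noteq> 0.
      if act G a u \<noteq> None \<and> act G a u = act G b u then f a * invK (f b) else 0) =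
    (\<Sum>x\<in>images f u. fibre_sum f u x * invK (fibre_sum f u x))"
proof -
  let ?A = "{w. f w \<noteq> 0}"
  have "(\<Sum>x\<in>images f u. fibre_sum f u x * invK (fibre_sum f u x)) =
      (\<Sum>x\<in>images f u. \<Sum>a\<in>?A. \<Sum>b\<in>?A.
        if act G a u = Some x \<and> act G b u = Some x then f a * invK (f b) else 0)"
    unfolding fibre_sum_def invK_sum[OF invol] sum_product
    by (intro sum.cong refl) (auto simp: invK_0[OF invol])
  also have "\<dots> = (\<Sum>a\<in>?A. \<Sum>b\<in>?A. \<Sum>x\<in>images f u.
        if act G a u = Some x \<and> act G b u = Some x then f a * invK (f b) else 0)"
    by (subst sum.swap, intro sum.cong refl, subst sum.swap) simp
  also have "\<dots> = (\<Sum>a\<in>?A. \<Sum>b\<in>?A.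
      if act G a u \<noteq> None \<and> act G a u = act G b u then f a * invK (f b) else 0)"
  proof (intro sum.cong refl)
    fix a b assume a: "a \<in> ?A"
    show "(\<Sum>x\<in>images f u. if act G a u = Some x \<and> act G b u = Some x then f a * invK (f b) else 0) =
      (if act G a u \<noteq> None \<and> act G a u = act G b u then f a * invK (f b) else 0)"
    proof (cases "act G a u")
      case (Some z)
      have "z \<in> images f u" using a Some by (auto simp: images_def)
      have "(\<Sum>x\<in>images f u. if act G a u = Some x \<and> act G b u = Some x then f a * invK (f b) else 0) =
          (\<Sum>x\<in>images f u. if x = z then (if act G b u = Some z then f a * invK (f b) else 0) else 0)"
        using Some by (intro sum.cong) auto
      also have "\<dots> = (if act G b u = Some z then f a * invK (f b) else 0)"
        using \<open>z \<in> images f u\<close> finite_images[OF f] by simp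
      finally show ?thesis using Some by auto
    qed simp
  qed
  finally show ?thesis by simp
qed

lemma lin_wval_square:
  fixes smul :: "'k \<Rightarrow> 'r::ring \<Rightarrow> 'r"
  assumes mod: "module smul" and f: "f \<in> free_alg G" and D: "adapted D {w. f w \<noteq> 0}"
  shows "lin smul (wval (\<lambda>q. \<delta> (path_rng G q))) (fmul f (fstar invK f)) =
    (\<Sum>u\<in>D. smul (\<Sum>x\<in>images f u. fibre_sum f u x * invK (fibre_sum f u x))
      (weight D (\<lambda>q. \<delta> (path_rng G q)) u))"
proof -
  interpret module smul by (rule mod)
  let ?A = "{w. f w \<noteq> 0}" and ?\<nu> = "\<lambda>q. \<delta> (path_rng G q)"
  let ?P = "\<lambda>a b u. act G a u \<noteq> None \<and> act G a u = act G b u"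
  have A: "finite ?A" and valid: "\<And>w. w \<in> ?A \<Longrightarrow> w \<noteq> [] \<and> valid_word G w"
    using f free_alg_finite free_alg_word by blast+
  \<comment> \<open>The indicator moves from the weight to the coefficient, so that the weight can
    be factored out for fixed \<open>u\<close>.\<close>
  have smul_if: "smul c (if P then m else 0) = smul (if P then c else 0) m" for c P m
    by simp
  have inj: "inj_on word_star ?A" by (metis inj_onI word_star_word_star)
  have "lin smul (wval ?\<nu>) (fmul f (fstar invK f)) =
      (\<Sum>a\<in>?A. \<Sum>b\<in>word_star ` ?A. smul (f a * fstar invK f b) (wval ?\<nu> (a @ b)))"
    using A by (intro lin_fmul[OF mod]) (simp_all add: fstar_support[OF invol])
  also have "\<dots> = (\<Sum>a\<in>?A. \<Sum>b\<in>?A. smul (f a * invK (f b)) (wval ?\<nu> (a @ word_star b)))"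
    by (simp add: sum.reindex[OF inj] fstar_apply)
  also have "\<dots> = (\<Sum>a\<in>?A. \<Sum>b\<in>?A. smul (f a * invK (f b))
      (\<Sum>u\<in>D. if ?P a b u then weight D ?\<nu> u else 0))"
  proof (intro sum.cong refl)
    fix a b assume ab: "a \<in> ?A" "b \<in> ?A"
    have "wval ?\<nu> (a @ word_star b) = (\<Sum>u\<in>D. if ?P a b u then weight D ?\<nu> u else 0)"
      using wval_star[of a b \<delta>] valid[OF ab(1)] valid[OF ab(2)] cylval_coincidence[OF D ab, of ?\<nu>]
      by (elim conjE) (simp only: simp_thms)
    then show "smul (f a * invK (f b)) (wval ?\<nu> (a @ word_star b)) =
        smul (f a * invK (f b)) (\<Sum>u\<in>D. if ?P a b u then weight D ?\<nu> u else 0)"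
      by (rule arg_cong)
  qed
  also have "\<dots> = (\<Sum>a\<in>?A. \<Sum>b\<in>?A. \<Sum>u\<in>D.
      smul (if ?P a b u then f a * invK (f b) else 0) (weight D ?\<nu> u))"
    unfolding scale_sum_right smul_if ..
  also have "\<dots> = (\<Sum>u\<in>D. \<Sum>a\<in>?A. \<Sum>b\<in>?A.
      smul (if ?P a b u then f a * invK (f b) else 0) (weight D ?\<nu> u))"
    by (subst (2) sum.swap, subst sum.swap) simp
  also have "\<dots> = (\<Sum>u\<in>D. smul (\<Sum>a\<in>?A. \<Sum>b\<in>?A. if ?P a b u then f a * invK (f b) else 0)
      (weight D ?\<nu> u))"
    by (simp add: scale_sum_left)
  finally show ?thesis by (simp only: sum_fibres[OF f])
qed

text \<open>Supplies the vertex between \<open>x\<close> and \<open>u*\<close> that (CK2) is to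
  replace; it comes from (V) for length 0 and from (E1) at the last edge otherwise.\<close>

lemma path_word_vertex:
  assumes "is_path G p"
  shows "mono (path_word p @ [Vx (path_rng G p)]) - mono (path_word p) \<in> (lpa_ideal G :: ('v,'e,'k) fa set)"
proof (cases "snd p" rule: rev_cases)
  case Nil
  then have "path_word p = [Vx (fst p)]" "path_rng G p = fst p"
    by (cases p; simp add: path_word_def path_rng_def)+
  then show ?thesis using path_rng_in_verts[OF assms] ideal_V[of "fst p" G] by simp
next
  case (snoc es e)
  then have p: "path_word p = path_word (fst p, es) @ [Ex e]" "path_rng G p = rng G e"
    by (cases p; simp add: path_word_def path_rng_def)+
  have e: "e \<in> edges G" "valid_word G (path_word (fst p, es))"
    using valid_path_word[OF assms] unfolding p by simp_all
  have "mono (path_word (fst p, es) @ [Ex e, Vx (rng G e)] @ []) -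
      mono (path_word (fst p, es) @ [Ex e] @ []) \<in> (lpa_ideal G :: ('v,'e,'k) fa set)"
    by (intro mono_cong_ctx ideal_E1r e) simp
  then show ?thesis by (simp add: p)
qed

text \<open>Write \<open>x u*\<close> as \<open>x v u*\<close> and apply (CK2) to \<open>v\<close>;
  then \<open>x e e* u*\<close> is \<open>(x e) (u e)*\<close>.\<close>

lemma CK2_pq_word:
  assumes x: "is_path G x" and u: "is_path G u" and v: "path_rng G x = v" "path_rng G u = v"
    and reg: "regular G v"
  shows "mono (pq_word x u) - (\<Sum>e\<in>out_edges G v. mono (pq_word (pext x [e]) (pext u [e])))
    \<in> (lpa_ideal G :: ('v,'e,'k) fa set)"
proof -
  let ?I = "lpa_ideal G :: ('v,'e,'k) fa set"
  let ?x = "path_word x" and ?u = "word_star (path_word u)"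
  have vx: "valid_word G ?x" and vu: "valid_word G ?u"
    using valid_path_word x u by simp_all
  have word: "pq_word (pext x [e]) (pext u [e]) = ?x @ [Ex e, Gx e] @ ?u" for e
    by (simp add: pq_word_def path_word_def word_star_def)
  have "mono ([] @ (?x @ [Vx v]) @ ?u) - mono ([] @ ?x @ ?u) \<in> ?I"
    using path_word_vertex[OF x] v vu by (intro mono_cong_ctx) simp_all
  then have "mono ([] @ ?x @ ?u) - mono ([] @ (?x @ [Vx v]) @ ?u) \<in> ?I"
    by (rule mono_cong_sym)
  then have absorb: "mono (?x @ ?u) - mono (?x @ [Vx v] @ ?u) \<in> ?I" by simp
  have "fmul (fmul (mono ?x) (mono [Vx v] - (\<Sum>e\<in>out_edges G v. mono [Ex e, Gx e]))) (mono ?u) \<in> ?I"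
    using ideal_CK2[OF reg] vx vu by (intro ideal_mono_left ideal_mono_right)
  also have "fmul (fmul (mono ?x) (mono [Vx v] - (\<Sum>e\<in>out_edges G v. mono [Ex e, Gx e]))) (mono ?u) =
      mono (?x @ [Vx v] @ ?u) - (\<Sum>e\<in>out_edges G v. mono (?x @ [Ex e, Gx e] @ ?u))"
    by (simp add: fmul_diff_left fmul_diff_right fmul_sum_left fmul_sum_right fmul_mono_mono)
  finally have "(mono (?x @ ?u) - mono (?x @ [Vx v] @ ?u)) +
      (mono (?x @ [Vx v] @ ?u) - (\<Sum>e\<in>out_edges G v. mono (?x @ [Ex e, Gx e] @ ?u))) \<in> ?I"
    by (rule ideal_add[OF absorb])
  then show ?thesis unfolding word by (simp add: pq_word_def)
qed

text \<open>The trace computation is repeated inside the algebra. Let \<open>N u x\<close> be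
  \<open>x u*\<close> minus the sum of \<open>(x e) (u e)*\<close> over the children
  \<open>u e\<close> of \<open>u\<close> in \<open>D\<close>. Each word is congruent to the sum of
  \<open>N u x\<close> over the \<open>u\<close> in \<open>D\<close> on which it is defined,
  \<open>x\<close> being the image. Collecting coefficients, \<open>f\<close> is congruent to the
  sum of \<open>F u x\<close> times \<open>N u x\<close>; at each \<open>u\<close> either the
  coefficients vanish or (CK2) puts \<open>N u x\<close> into the ideal.\<close>

lemma in_ideal_if_fibres_vanish:
  assumes f: "f \<in> free_alg G" and D: "adapted D {w. f w \<noteq> 0}"
    and van: "\<And>u. u \<in> D \<Longrightarrow> (\<forall>x. fibre_sum f u x = 0) \<or>
      (regular G (path_rng G u) \<and> {e. pext u [e] \<in> D} = out_edges G (path_rng G u))"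
  shows "f \<in> (lpa_ideal G :: ('v,'e,'k) fa set)"
proof -
  let ?I = "lpa_ideal G :: ('v,'e,'k) fa set" and ?A = "{w. f w \<noteq> 0}"
  have fin: "finite D" and paths: "\<And>u. u \<in> D \<Longrightarrow> is_path G u" and closed: "prefix_closed D"
    using D by (auto simp: adapted_def)
  have A: "finite ?A" and valid: "\<And>w. w \<in> ?A \<Longrightarrow> w \<noteq> [] \<and> valid_word G w"
    using f free_alg_finite free_alg_word by blast+
  define N :: "('v,'e) path \<Rightarrow> ('v,'e) path \<Rightarrow> ('v,'e,'k) fa" where
    "N u x = mono (pq_word x u) - (\<Sum>e | pext u [e] \<in> D. mono (pq_word (pext x [e]) (pext u [e])))" for u x
  define B where "B u = {w. f w \<noteq> 0 \<and> act G w u \<noteq> None}" for u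
  have word: "mono w - (\<Sum>u | u \<in> D \<and> act G w u \<noteq> None. N u (the (act G w u))) \<in> ?I" if w: "w \<in> ?A" for w
    using normal_form[OF conjunct1[OF valid[OF w]] conjunct2[OF valid[OF w]]]
  proof (elim disjE exE conjE)
    assume dead: "dom_act G w = {}" "mono w \<in> ?I"
    then have "{u. u \<in> D \<and> act G w u \<noteq> None} = {}" using paths by (auto simp: dom_act_def)
    then show ?thesis using dead by (simp only: sum.empty diff_zero)
  next
    fix p q assume pq: "is_path G p" "is_path G q" "path_rng G p = path_rng G q"
      "dom_act G w = cyl G q" "act G w q = Some p" "mono w - mono (pq_word p q) \<in> ?I"
    \<comment> \<open>For this function the weight at \<open>u\<close> is \<open>N u x\<close>,
      since the word carries \<open>u e\<close> to \<open>x e\<close>; \<open>sum_weight\<close>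
      then telescopes to \<open>p q*\<close>.\<close>
    define h :: "('v,'e) path \<Rightarrow> ('v,'e,'k) fa" where "h u = mono (pq_word (the (act G w u)) u)" for u
    have "dom_act G w \<noteq> {}" using pq(2,4) cyl_self by blast
    then obtain q' where "q' \<in> D" "dom_act G w = cyl G q'"
      using D w unfolding adapted_def by blast
    then have qD: "q \<in> D" using cyl_inj[OF pq(2), of q'] pq(4) paths by simp
    have set: "{u. u \<in> D \<and> act G w u \<noteq> None} = {u. u \<in> D \<and> (\<exists>x. u = pext q x)}"
      using pq(4) paths unfolding dom_act_def cyl_def by blast
    have "weight D h u = N u (the (act G w u))" if ex: "\<exists>x. u = pext q x" for u
    proof -
      obtain x where x: "u = pext q x" using ex by blast
      then have "act G w u = Some (pext p x)" using act_pext[OF pq(5)] by simp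
      then have "act G w (pext u [e]) = Some (pext (pext p x) [e])" for e by (rule act_pext)
      then show ?thesis
        using \<open>act G w u = Some (pext p x)\<close> by (simp add: weight_def N_def h_def)
    qed
    then have "(\<Sum>u | u \<in> D \<and> act G w u \<noteq> None. N u (the (act G w u))) =
        (\<Sum>u | u \<in> D \<and> (\<exists>x. u = pext q x). weight D h u)"
      unfolding set by (intro sum.cong) auto
    also have "\<dots> = mono (pq_word p q)"
      using sum_weight[OF fin closed qD, of h] pq(5) by (simp add: h_def)
    finally show ?thesis using pq(6) by simp
  qed
  have vertex: "(\<Sum>w\<in>B u. fsmul (f w) (N u (the (act G w u)))) \<in> ?I" if u: "u \<in> D" for u
    using van[OF u]
  proof
    assume zero: "\<forall>x. fibre_sum f u x = 0"
    have B: "finite (B u)" using A by (auto simp: B_def)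
    \<comment> \<open>The words are grouped by their value \<open>x\<close> at \<open>u\<close>,
      because all words of one group share \<open>N u x\<close>.\<close>
    have "(\<Sum>w\<in>B u. fsmul (f w) (N u (the (act G w u)))) =
        (\<Sum>x\<in>images f u. \<Sum>w | w \<in> B u \<and> the (act G w u) = x. fsmul (f w) (N u (the (act G w u))))"
      using B finite_images[OF f] by (intro sum.group[symmetric]) (auto simp: B_def images_def)
    also have "\<dots> = (\<Sum>x\<in>images f u. fsmul (fibre_sum f u x) (N u x))"
    proof (intro sum.cong refl)
      fix x
      have "{w. w \<in> B u \<and> the (act G w u) = x} = {w \<in> ?A. act G w u = Some x}"
        by (auto simp: B_def)
      then have "(\<Sum>w | w \<in> B u \<and> the (act G w u) = x. f w) = fibre_sum f u x"
        using sum.inter_filter[OF A, of f "\<lambda>w. act G w u = Some x"] by (simp add: fibre_sum_def)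
      then show "(\<Sum>w | w \<in> B u \<and> the (act G w u) = x. fsmul (f w) (N u (the (act G w u)))) =
          fsmul (fibre_sum f u x) (N u x)"
        by (simp add: fun_eq_iff sum_fun_apply fsmul_def flip: sum_distrib_right)
    qed
    also have "\<dots> = 0" using zero by (simp only: fsmul_0_left sum.neutral_const)
    finally show ?thesis by (simp add: ideal_zero)
  next
    assume reg: "regular G (path_rng G u) \<and> {e. pext u [e] \<in> D} = out_edges G (path_rng G u)"
    show ?thesis
    proof (intro ideal_sum lpa_ideal.smul)
      fix w assume "w \<in> B u"
      then obtain x where "act G w u = Some x" by (auto simp: B_def)
      then have "N u x \<in> ?I"
        using act_path[of w u x] paths[OF u] reg CK2_pq_word[of x u] by (simp add: N_def)
      then show "N u (the (act G w u)) \<in> ?I" using \<open>act G w u = Some x\<close> by simp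
    qed
  qed
  have "(\<Sum>w\<in>?A. fsmul (f w) (\<Sum>u | u \<in> D \<and> act G w u \<noteq> None. N u (the (act G w u)))) =
      (\<Sum>w\<in>?A. \<Sum>u | u \<in> D \<and> act G w u \<noteq> None. fsmul (f w) (N u (the (act G w u))))"
    by (simp add: fun_eq_iff sum_fun_apply fsmul_def sum_distrib_left)
  also have "\<dots> = (\<Sum>u\<in>D. \<Sum>w | w \<in> ?A \<and> act G w u \<noteq> None. fsmul (f w) (N u (the (act G w u))))"
    by (rule sum.swap_restrict[OF A fin])
  also have "\<dots> = (\<Sum>u\<in>D. \<Sum>w\<in>B u. fsmul (f w) (N u (the (act G w u))))"
    by (simp add: B_def)
  also have "\<dots> \<in> ?I" by (intro ideal_sum vertex)
  finally have "(\<Sum>w\<in>?A. fsmul (f w) (\<Sum>u | u \<in> D \<and> act G w u \<noteq> None. N u (the (act G w u)))) \<in> ?I" .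
  moreover have "(\<Sum>w\<in>?A. fsmul (f w) (mono w - (\<Sum>u | u \<in> D \<and> act G w u \<noteq> None. N u (the (act G w u))))) \<in> ?I"
    by (intro ideal_sum lpa_ideal.smul word)
  ultimately have "(\<Sum>w\<in>?A. fsmul (f w) (mono w)) \<in> ?I"
    using ideal_add by (fastforce simp: fsmul_diff sum_subtractf)
  then show ?thesis by (simp only: free_alg_expand[OF A order_refl, symmetric])
qed

end

section \<open>Traces on the Leavitt path algebra\<close>

locale leavitt_target = leavitt G invK for G :: "('v,'e) graph" and invK :: "'k::field \<Rightarrow> 'k" +
  fixes smul :: "'k \<Rightarrow> 'r::ring \<Rightarrow> 'r" and star :: "'r \<Rightarrow> 'r"
  assumes alg: "involutive_algebra invK smul star"
begin

lemma mod: "module smul"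
  using alg by unfold_locales (auto simp: involutive_algebra_def)

sublocale module smul by (rule mod)

lemma smul_eq_0_iff: "smul a x = 0 \<longleftrightarrow> a = 0 \<or> x = 0"
proof -
  have "x = smul (inverse a * a) x" if "a \<noteq> 0" using that alg by (simp add: involutive_algebra_def)
  then show ?thesis by (metis scale_scale scale_zero_left scale_zero_right)
qed

section \<open>The order on R\<close>

lemma nonneg_0: "nonnegR star 0"
  unfolding nonnegR_def by (rule exI[of _ "[]"]) simp

lemma nonneg_square: "nonnegR star (z * star z)"
  unfolding nonnegR_def by (rule exI[of _ "[z]"]) simp

lemma nonneg_add: "nonnegR star x \<Longrightarrow> nonnegR star y \<Longrightarrow> nonnegR star (x + y)"
  unfolding nonnegR_def by (metis map_append sum_list_append)

lemma nonneg_sum: "(\<And>i. i \<in> A \<Longrightarrow> nonnegR star (F i)) \<Longrightarrow> nonnegR star (\<Sum>i\<in>A. F i)"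
  by (induction A rule: infinite_finite_induct) (simp_all add: nonneg_0 nonneg_add)

lemma nonneg_sum_list: "(\<And>x. x \<in> set xs \<Longrightarrow> nonnegR star x) \<Longrightarrow> nonnegR star (sum_list xs)"
  by (induction xs) (simp_all add: nonneg_0 nonneg_add)

text \<open>The scalar is absorbed into each square, \<open>c c* z z* = (c z) (c z)*\<close>. This
  is why the coefficients of the quadratic form are brought into the shape
  \<open>F * invK F\<close>.\<close>

lemma nonneg_smul:
  assumes "nonnegR star x"
  shows "nonnegR star (smul (c * invK c) x)"
proof -
  have square: "smul c z * star (smul c z) = smul (c * invK c) (z * star z)" for z
    using alg unfolding involutive_algebra_def by metis
  have "nonnegR star (smul (c * invK c) (sum_list (map (\<lambda>z. z * star z) zs)))" for zs
    by (induction zs) (simp_all add: nonneg_0 scale_right_distrib square[symmetric] nonneg_add nonneg_square)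
  then show ?thesis using assms unfolding nonnegR_def[of star x] by blast
qed

text \<open>The lists of squares for \<open>x\<close> and \<open>y\<close> concatenate to one with
  sum 0, so positive definiteness makes every entry 0.\<close>

lemma nonneg_add_eq_0:
  assumes pd: "positive_definite star" and "nonnegR star x" "nonnegR star y" "x + y = 0"
  shows "x = 0"
proof -
  obtain xs ys where xs: "x = sum_list (map (\<lambda>z. z * star z) xs)" and ys: "y = sum_list (map (\<lambda>z. z * star z) ys)"
    using assms unfolding nonnegR_def by blast
  then have "sum_list (map (\<lambda>z. z * star z) (xs @ ys)) = 0" using assms by simp
  then have "\<forall>z\<in>set xs. z = 0" using pd unfolding positive_definite_def by (metis Un_iff set_append)
  then have "x = sum_list (map (\<lambda>z. 0) xs)" unfolding xs by (intro arg_cong[of _ _ sum_list] map_cong) auto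
  then show ?thesis by simp
qed

lemma nonneg_sum_eq_0:
  assumes pd: "positive_definite star" and "finite A" "\<And>i. i \<in> A \<Longrightarrow> nonnegR star (F i)"
    and "(\<Sum>i\<in>A. F i) = 0" "i \<in> A"
  shows "F i = 0"
proof (rule nonneg_add_eq_0[OF pd])
  show "nonnegR star (\<Sum>i\<in>A - {i}. F i)" using assms(3) by (intro nonneg_sum) simp
  show "F i + (\<Sum>i\<in>A - {i}. F i) = 0" using assms by (simp add: sum.remove)
qed (use assms in simp)

text \<open>This is \<open>t\<^sub>\<delta>\<close> before passage to the quotient, for any
  \<open>\<delta>\<close>; the graph trace equation enters with \<open>tr_ideal\<close>.\<close>

definition tr :: "('v \<Rightarrow> 'r) \<Rightarrow> ('v,'e,'k) fa \<Rightarrow> 'r" where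
  "tr \<delta> = lin smul (wval (\<lambda>q. \<delta> (path_rng G q)))"

lemma tr_mono: "tr \<delta> (mono w) = wval (\<lambda>q. \<delta> (path_rng G q)) w"
  by (simp add: tr_def lin_mono[OF mod])

lemma tr_zero: "tr \<delta> 0 = 0"
  by (simp add: tr_def lin_zero[OF mod])

lemma tr_add: "f \<in> free_alg G \<Longrightarrow> g \<in> free_alg G \<Longrightarrow> tr \<delta> (f + g) = tr \<delta> f + tr \<delta> g"
  by (simp add: tr_def lin_add[OF mod] free_alg_finite)

lemma tr_smul: "f \<in> free_alg G \<Longrightarrow> tr \<delta> (fsmul a f) = smul a (tr \<delta> f)"
  by (simp add: tr_def lin_smul[OF mod] free_alg_finite)

lemma tr_diff: "f \<in> free_alg G \<Longrightarrow> g \<in> free_alg G \<Longrightarrow> tr \<delta> (f - g) = tr \<delta> f - tr \<delta> g"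
  using tr_add[of "f - g" g] by (simp add: free_alg_diff)

lemma tr_sum: "(\<And>i. i \<in> A \<Longrightarrow> F i \<in> free_alg G) \<Longrightarrow> tr \<delta> (\<Sum>i\<in>A. F i) = (\<Sum>i\<in>A. tr \<delta> (F i))"
  by (induction A rule: infinite_finite_induct) (simp_all add: tr_zero tr_add free_alg_sum)

lemma tr_cong:
  assumes "\<And>v. v \<in> verts G \<Longrightarrow> \<delta> v = \<delta>' v"
  shows "tr \<delta> = tr \<delta>'"
proof -
  have "wval (\<lambda>q. \<delta> (path_rng G q)) w = wval (\<lambda>q. \<delta>' (path_rng G q)) w" for w
  proof (cases "\<exists>q. is_path G q \<and> fixset w = cyl G q")
    case True
    then show ?thesis using assms path_rng_in_verts by (auto simp: wval_def cylval_cyl)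
  next
    case False
    then show ?thesis by (simp only: wval_def cylval_def if_False)
  qed
  then show ?thesis by (simp add: tr_def lin_def fun_eq_iff)
qed

lemma tr_ideal:
  assumes "graph_trace G \<delta>" "x \<in> lpa_ideal G"
  shows "tr \<delta> x = 0"
  unfolding tr_def using assms
  by (intro lin_wval_ideal[OF mod]) (simp_all add: graph_trace_def path_rng_pext)

lemma tr_fmul_commute:
  assumes f: "f \<in> free_alg G" and g: "g \<in> free_alg G"
  shows "tr \<delta> (fmul f g) = tr \<delta> (fmul g f)"
proof -
  let ?\<phi> = "wval (\<lambda>q. \<delta> (path_rng G q))"
  have "tr \<delta> (fmul f g) = (\<Sum>u | f u \<noteq> 0. \<Sum>v | g v \<noteq> 0. smul (f u * g v) (?\<phi> (u @ v)))"
    unfolding tr_def using f g by (intro lin_fmul[OF mod] free_alg_finite) auto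
  also have "\<dots> = (\<Sum>u | f u \<noteq> 0. \<Sum>v | g v \<noteq> 0. smul (g v * f u) (?\<phi> (v @ u)))"
    using free_alg_word[OF f] free_alg_word[OF g]
    by (intro sum.cong refl) (auto simp: mult.commute wval_commute[of _ _ \<delta>])
  also have "\<dots> = (\<Sum>v | g v \<noteq> 0. \<Sum>u | f u \<noteq> 0. smul (g v * f u) (?\<phi> (v @ u)))"
    by (rule sum.swap)
  also have "\<dots> = tr \<delta> (fmul g f)"
    unfolding tr_def using f g by (intro lin_fmul[OF mod, symmetric] free_alg_finite) auto
  finally show ?thesis .
qed

lemma weight_path_rng:
  "weight D (\<lambda>q. \<delta> (path_rng G q)) u = \<delta> (path_rng G u) - (\<Sum>e | pext u [e] \<in> D. \<delta> (rng G e))"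
  by (simp add: weight_def path_rng_pext)

lemma children_out_edges:
  assumes "adapted D A"
  shows "finite {e. pext u [e] \<in> D}" "{e. pext u [e] \<in> D} \<subseteq> out_edges G (path_rng G u)"
proof -
  show "finite {e. pext u [e] \<in> D}" using assms by (simp add: adapted_def finite_children)
  have "is_path G (pext u [e])" if "pext u [e] \<in> D" for e using assms that unfolding adapted_def by blast
  then show "{e. pext u [e] \<in> D} \<subseteq> out_edges G (path_rng G u)"
    by (auto simp: is_path_pext out_edges_def)
qed

text \<open>The weight is the very difference that positivity of \<open>\<delta>\<close> controls,
  at the range of \<open>u\<close> and for the finite set of edges continuing \<open>u\<close> in
  \<open>D\<close>.\<close>

lemma weight_nonneg:
  assumes \<delta>: "positive_graph_trace G star \<delta>" and D: "adapted D A" and u: "u \<in> D"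
  shows "nonnegR star (weight D (\<lambda>q. \<delta> (path_rng G q)) u)"
proof -
  have "is_path G u" using D u unfolding adapted_def by blast
  then have "path_rng G u \<in> verts G" by (rule path_rng_in_verts)
  then show ?thesis
    using \<delta> children_out_edges[OF D, of u]
    unfolding positive_graph_trace_def geR_def weight_path_rng by blast
qed

lemma tr_square_nonneg:
  assumes \<delta>: "positive_graph_trace G star \<delta>" and f: "f \<in> free_alg G"
  shows "nonnegR star (tr \<delta> (fmul f (fstar invK f)))"
proof -
  obtain D where D: "adapted D {w. f w \<noteq> 0}"
    using adapted_exists free_alg_finite[OF f] free_alg_word[OF f] by blast
  show ?thesis
    unfolding tr_def lin_wval_square[OF mod f D] scale_sum_left
    by (intro nonneg_sum nonneg_smul weight_nonneg[OF \<delta> D])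
qed

text \<open>A vanishing finite sum of nonnegative terms has vanishing terms. Where the weight is
  nonzero, invertibility of nonzero scalars forces the fibre sums to vanish; where it is zero,
  \<open>D\<close> must continue \<open>u\<close> by all edges at its range. These are the two
  alternatives of \<open>in_ideal_if_fibres_vanish\<close>.\<close>

lemma tr_square_eq_0:
  assumes pd: "positive_definite star" and \<delta>: "faithful_graph_trace G star \<delta>"
    and f: "f \<in> free_alg G" and zero: "tr \<delta> (fmul f (fstar invK f)) = 0"
  shows "f \<in> lpa_ideal G"
proof -
  let ?m = "\<lambda>D. weight D (\<lambda>q. \<delta> (path_rng G q))"
  have pos: "positive_graph_trace G star \<delta>"
    and \<delta>_pos: "\<And>v. v \<in> verts G \<Longrightarrow> nonnegR star (\<delta> v) \<and> \<delta> v \<noteq> 0"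
    using \<delta> by (auto simp: faithful_graph_trace_def posR_def)
  obtain D where D: "adapted D {w. f w \<noteq> 0}"
    using adapted_exists free_alg_finite[OF f] free_alg_word[OF f] by blast
  have finD: "finite D" and paths: "\<And>u. u \<in> D \<Longrightarrow> is_path G u"
    using D unfolding adapted_def by blast+
  have summand: "smul (fibre_sum f u x * invK (fibre_sum f u x)) (?m D u) = 0"
    if u: "u \<in> D" and x: "x \<in> images f u" for u x
  proof -
    let ?F = "\<lambda>u x. smul (fibre_sum f u x * invK (fibre_sum f u x)) (?m D u)"
    have nn: "nonnegR star (?F u x)" if "u \<in> D" for u x
      by (intro nonneg_smul weight_nonneg[OF pos D that])
    have "(\<Sum>u\<in>D. \<Sum>x\<in>images f u. ?F u x) = 0"
      using zero unfolding tr_def lin_wval_square[OF mod f D] scale_sum_left .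
    with pd finD have "(\<Sum>x\<in>images f u. ?F u x) = 0"
      using nonneg_sum_eq_0[where F = "\<lambda>u. \<Sum>x\<in>images f u. ?F u x" and A = D and i = u] nn u
      by (simp only: nonneg_sum)
    with pd finite_images[OF f] show ?thesis
      using nonneg_sum_eq_0[where F = "?F u" and A = "images f u" and i = x] nn[OF u] x by (simp only:)
  qed
  show ?thesis
  proof (rule in_ideal_if_fibres_vanish[OF f D])
    fix u assume u: "u \<in> D"
    define v where "v = path_rng G u"
    define I where "I = {e. pext u [e] \<in> D}"
    have v: "v \<in> verts G" using path_rng_in_verts[OF paths[OF u]] by (simp add: v_def)
    have I: "finite I" "I \<subseteq> out_edges G v"
      using children_out_edges[OF D, of u] by (simp_all add: I_def v_def)
    show "(\<forall>x. fibre_sum f u x = 0) \<or>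
        (regular G (path_rng G u) \<and> {e. pext u [e] \<in> D} = out_edges G (path_rng G u))"
    proof (cases "?m D u = 0")
      case False
      have "fibre_sum f u x = 0" for x
      proof (cases "x \<in> images f u")
        case True
        then show ?thesis
          using summand[OF u True] False by (simp add: smul_eq_0_iff invK_eq_0_iff[OF invol])
      next
        case x: False
        then show ?thesis
          unfolding fibre_sum_def by (intro sum.neutral) (auto simp: images_def)
      qed
      then show ?thesis by blast
    next
      case True
      then have \<delta>v: "\<delta> v = (\<Sum>e\<in>I. \<delta> (rng G e))"
        by (simp add: weight_path_rng v_def I_def)
      have "out_edges G v \<subseteq> I"
      proof (rule ccontr)
        assume "\<not> out_edges G v \<subseteq> I"
        then obtain e where e: "e \<in> out_edges G v" "e \<notin> I" by blast
        \<comment> \<open>Positivity for \<open>insert e I\<close> is played against equality for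
          \<open>I\<close>; what is left over is \<open>- \<delta> (rng G e)\<close>.\<close>
        have "nonnegR star (\<delta> v - (\<Sum>e\<in>insert e I. \<delta> (rng G e)))"
          using pos v e I unfolding positive_graph_trace_def geR_def
          by (metis finite_insert insert_subset)
        then have "nonnegR star (- \<delta> (rng G e))"
          using e I by (simp add: \<delta>v)
        moreover have "rng G e \<in> verts G" using e by (simp add: out_edges_def)
        ultimately show False
          using nonneg_add_eq_0[OF pd, of "\<delta> (rng G e)" "- \<delta> (rng G e)"] \<delta>_pos by simp
      qed
      then have "I = out_edges G v" using I by blast
      \<comment> \<open>A sink is excluded by \<open>\<delta> v \<noteq> 0\<close>, an infinite
        emitter by the finiteness of \<open>I\<close>.\<close>
      moreover have "I \<noteq> {}" using \<delta>v \<delta>_pos[OF v] by auto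
      ultimately have "regular G v" using I v by (simp add: regular_def)
      then show ?thesis using \<open>I = out_edges G v\<close> by (simp add: I_def v_def)
    qed
  qed
qed

section \<open>Traces of edge and gap projections\<close>

lemma fixset_edge_ghost: "e \<in> edges G \<Longrightarrow> fixset [Ex e, Gx e] = cyl G (src G e, [e])"
proof -
  assume e: "e \<in> edges G"
  have "y \<in> fixset [Ex e, Gx e] \<longleftrightarrow> y \<in> cyl G (src G e, [e])" for y
    by (cases y; cases "snd y") (auto simp: fixset_def cyl_def pext_Pair)
  then show ?thesis by blast
qed

lemma tr_edge_ghost:
  assumes "e \<in> edges G"
  shows "tr \<delta> (mono [Ex e, Gx e]) = \<delta> (rng G e)"
  using assms by (simp add: tr_mono wval_def fixset_edge_ghost cylval_cyl)

lemma tr_vertex: "v \<in> verts G \<Longrightarrow> tr \<delta> (mono [Vx v]) = \<delta> v"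
  by (simp add: tr_mono wval_vertex)

text \<open>The elements \<open>v - (\<Sum>e\<in>I. e e*)\<close> are projections, whose trace is the expression that
  positivity of a graph trace is about.\<close>

lemma tr_gap:
  assumes v: "v \<in> verts G" and I: "finite I" "I \<subseteq> out_edges G v"
  defines "g \<equiv> mono [Vx v] - (\<Sum>e\<in>I. mono [Ex e, Gx e])"
  shows "g \<in> free_alg G" "tr \<delta> g = \<delta> v - (\<Sum>e\<in>I. \<delta> (rng G e))"
    "tr \<delta> (fmul g (fstar invK g)) = \<delta> v - (\<Sum>e\<in>I. \<delta> (rng G e))"
proof -
  have e: "e \<in> edges G" "src G e = v" if "e \<in> I" for e using that I by (auto simp: out_edges_def)
  show g: "g \<in> free_alg G"
    unfolding g_def using v e by (intro free_alg_diff free_alg_sum free_alg_mono) auto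
  show "tr \<delta> g = \<delta> v - (\<Sum>e\<in>I. \<delta> (rng G e))"
    unfolding g_def using v e
    by (simp add: tr_diff tr_sum tr_vertex tr_edge_ghost free_alg_mono free_alg_sum)
  have star: "fstar invK g = g"
    by (simp add: g_def fstar_diff[OF invol] fstar_sum[OF invol] fstar_mono[OF invol] word_star_def)
  \<comment> \<open>\<open>\<delta>\<close> is arbitrary here and \<open>tr \<delta>\<close> need
    not vanish on the ideal, so the words in \<open>g g*\<close> are reduced by comparing their
    actions.\<close>
  have word: "tr \<delta> (mono w) = tr \<delta> (mono w')" if "\<And>y. is_path G y \<Longrightarrow> act G w y = act G w' y" for w w'
  proof -
    have "fixset w = fixset w'" using that by (auto simp: fixset_def)
    then show ?thesis by (simp add: tr_mono wval_def)
  qed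
  have vv: "tr \<delta> (mono [Vx v, Vx v]) = tr \<delta> (mono [Vx v])"
    by (rule word) simp
  have vee: "tr \<delta> (mono [Vx v, Ex e, Gx e]) = tr \<delta> (mono [Ex e, Gx e])" if "e \<in> I" for e
    by (rule word) (use e[OF that] in \<open>auto split: list.splits\<close>)
  have eev: "tr \<delta> (mono [Ex e, Gx e, Vx v]) = tr \<delta> (mono [Ex e, Gx e])" if "e \<in> I" for e
    by (rule word) (use e[OF that] in \<open>auto split: list.splits\<close>)
  have eeff: "tr \<delta> (mono [Ex e, Gx e, Ex f, Gx f]) = (if e = f then tr \<delta> (mono [Ex e, Gx e]) else 0)"
    if "e \<in> I" "f \<in> I" for e f
  proof (cases "e = f")
    case True
    have "tr \<delta> (mono [Ex e, Gx e, Ex f, Gx f]) = tr \<delta> (mono [Ex e, Gx e])"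
      by (rule word) (use e[OF that(1)] True in \<open>auto split: list.splits\<close>)
    then show ?thesis using True by simp
  next
    case False
    then have "fixset [Ex e, Gx e, Ex f, Gx f] = {}"
      by (auto simp: fixset_def bind_eq_Some_conv split: list.splits if_splits)
    then show ?thesis using False by (simp add: tr_mono wval_def cylval_empty)
  qed
  have gg: "fmul g g = mono [Vx v, Vx v] - (\<Sum>e\<in>I. mono [Vx v, Ex e, Gx e])
      - ((\<Sum>e\<in>I. mono [Ex e, Gx e, Vx v]) - (\<Sum>e\<in>I. \<Sum>f\<in>I. mono [Ex e, Gx e, Ex f, Gx f]))"
    by (simp add: g_def fmul_diff_left fmul_diff_right fmul_sum_left fmul_sum_right fmul_mono_mono
        sum_subtractf) (rule sum.swap)
  have "tr \<delta> (fmul g g) = tr \<delta> (mono [Vx v, Vx v]) - (\<Sum>e\<in>I. tr \<delta> (mono [Vx v, Ex e, Gx e]))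
      - ((\<Sum>e\<in>I. tr \<delta> (mono [Ex e, Gx e, Vx v])) - (\<Sum>e\<in>I. \<Sum>f\<in>I. tr \<delta> (mono [Ex e, Gx e, Ex f, Gx f])))"
    unfolding gg using v e by (simp add: tr_diff tr_sum free_alg_diff free_alg_sum free_alg_mono)
  also have "\<dots> = \<delta> v - (\<Sum>e\<in>I. \<delta> (rng G e))
      - ((\<Sum>e\<in>I. \<delta> (rng G e)) - (\<Sum>e\<in>I. \<Sum>f\<in>I. if e = f then \<delta> (rng G e) else 0))"
  proof -
    have ee: "tr \<delta> (mono [Ex e, Gx e]) = \<delta> (rng G e)" if "e \<in> I" for e
      by (rule tr_edge_ghost[OF e(1)[OF that]])
    show ?thesis
      unfolding vv tr_vertex[OF v]
      by (intro arg_cong2[of _ _ _ _ "(-)"] sum.cong refl) (simp_all only: vee eev eeff ee)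
  qed
  \<comment> \<open>The double sum reduces to its diagonal, which cancels the second single
    sum.\<close>
  also have "\<dots> = \<delta> v - (\<Sum>e\<in>I. \<delta> (rng G e))"
    using I by simp
  finally show "tr \<delta> (fmul g (fstar invK g)) = \<delta> v - (\<Sum>e\<in>I. \<delta> (rng G e))"
    by (simp add: star)
qed

lemma mono_path_word:
  assumes "is_path G (v, es)" "es \<noteq> []"
  shows "mono (path_word (v, es)) - mono (map Ex es) \<in> (lpa_ideal G :: ('v,'e,'k) fa set)"
proof (cases es)
  case (Cons e es')
  have "valid_word G (map Ex es')" using valid_path_word[OF assms(1)] Cons by (simp add: path_word_def)
  then have "mono ([] @ [Vx (src G e), Ex e] @ map Ex es') - mono ([] @ [Ex e] @ map Ex es')
      \<in> (lpa_ideal G :: ('v,'e,'k) fa set)"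
    using assms(1) Cons by (intro mono_cong_ctx ideal_E1s) auto
  then show ?thesis using assms(1) Cons by (simp add: path_word_def)
qed (use assms in simp)

lemma free_alg_path_word: "is_path G p \<Longrightarrow> mono (path_word p) \<in> free_alg G"
  by (intro free_alg_mono valid_path_word) (simp_all add: path_word_def)

lemma pathL_eq:
  assumes p: "is_path G p"
  shows "(pathL G p :: ('v,'e,'k) fa set) = cls G (mono (path_word p))"
proof -
  obtain v es where p_eq: "p = (v, es)" by (cases p)
  show ?thesis
  proof (cases "es = []")
    case True
    then show ?thesis by (simp add: p_eq pathL_def path_word_def)
  next
    case False
    have "valid_word G (map Ex es)" using valid_path_word[OF p] by (simp add: p_eq path_word_def)
    then have "mono (map Ex es) \<in> (free_alg G :: ('v,'e,'k) fa set)" using False by (intro free_alg_mono) simp_all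
    then have "cls G (mono (path_word p)) = (cls G (mono (map Ex es)) :: ('v,'e,'k) fa set)"
      using mono_path_word[of v es] p False
      by (subst cls_eq_iff[OF free_alg_path_word[OF p]]) (simp_all add: p_eq)
    then show ?thesis
      using False by (simp add: p_eq pathL_def)
  qed
qed

lemma multL_pathL_starL:
  assumes p: "is_path G p" and q: "is_path G q"
  shows "(multL G (pathL G p) (starL G invK (pathL G q)) :: ('v,'e,'k) fa set) = cls G (mono (pq_word p q))"
proof -
  have q': "fstar invK (mono (path_word q)) \<in> free_alg G"
    by (intro free_alg_star[OF invol] free_alg_path_word q)
  show ?thesis
    unfolding pathL_eq[OF p] pathL_eq[OF q] starL_cls[OF invol free_alg_path_word[OF q]]
      multL_cls[OF free_alg_path_word[OF p] q']
    by (simp add: fstar_mono[OF invol] fmul_mono_mono pq_word_def)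
qed

lemma free_alg_pq_word: "is_path G p \<Longrightarrow> is_path G q \<Longrightarrow> mono (pq_word p q) \<in> free_alg G"
  by (intro free_alg_mono valid_pq_word) (simp_all add: pq_word_def path_word_def)

section \<open>Arbitrary linear traces\<close>

context
  fixes t :: "('v,'e,'k) fa set \<Rightarrow> 'r"
  assumes trace: "lpa_trace G t" and linear: "lpa_Klinear G smul t"
begin

lemma trace_add: "f \<in> free_alg G \<Longrightarrow> g \<in> free_alg G \<Longrightarrow> t (cls G (f + g)) = t (cls G f) + t (cls G g)"
  using trace unfolding lpa_trace_def by (metis addL_cls cls_in_LPA)

lemma trace_smul: "f \<in> free_alg G \<Longrightarrow> t (cls G (fsmul a f)) = smul a (t (cls G f))"
  using linear unfolding lpa_Klinear_def by (metis smulL_cls cls_in_LPA)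

lemma trace_zero: "t (cls G 0) = 0"
  using trace_smul[of 0 0] by (simp add: fsmul_0_left free_alg_zero)

lemma trace_expand:
  assumes f: "f \<in> free_alg G"
  shows "t (cls G f) = (\<Sum>w | f w \<noteq> 0. smul (f w) (t (cls G (mono w))))"
proof -
  have "t (cls G (\<Sum>w\<in>A. fsmul (f w) (mono w))) = (\<Sum>w\<in>A. smul (f w) (t (cls G (mono w))))"
    if "finite A" "A \<subseteq> {w. f w \<noteq> 0}" for A
    using that
  proof (induction A)
    case empty
    show ?case by (simp add: trace_zero)
  next
    case (insert w A)
    have free: "mono a \<in> (free_alg G :: ('v,'e,'k) fa set)" if "a \<in> insert w A" for a
      using free_alg_word[OF f, of a] insert that by (intro free_alg_mono) auto
    have "(\<Sum>a\<in>A. fsmul (f a) (mono a)) \<in> free_alg G"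
      using free by (intro free_alg_sum free_alg_smul) simp
    then show ?case
      using insert free by (simp add: trace_add trace_smul free_alg_smul)
  qed
  from this[OF free_alg_finite[OF f] order_refl] show ?thesis
    by (simp only: free_alg_expand[OF free_alg_finite[OF f] order_refl, symmetric])
qed

text \<open>By linearity words suffice, and \<open>normal_form\<close> reduces each to 0 or to some
  \<open>p q*\<close>, where canonicity dictates the value. Uniqueness of the extension rests on
  this.\<close>

lemma canonical_trace_eq_tr:
  assumes canonical: "lpa_canonical G invK t" and f: "f \<in> free_alg G"
  shows "t (cls G f) = tr (restrict_E0 G t) f"
proof -
  let ?\<delta> = "restrict_E0 G t"
  have \<delta>: "?\<delta> v = t (vertL G v)" if "v \<in> verts G" for v
    using that by (simp add: restrict_E0_def)
  have "t (cls G (mono w)) = wval (\<lambda>q. ?\<delta> (path_rng G q)) w" if w: "w \<noteq> []" "valid_word G w" for w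
    using normal_form[OF w]
  proof (elim disjE exE conjE)
    assume "dom_act G w = {}" "mono w \<in> (lpa_ideal G :: ('v,'e,'k) fa set)"
    then have "(cls G (mono w) :: ('v,'e,'k) fa set) = cls G 0" "fixset w = {}"
      using cls_eq_iff[OF free_alg_mono[OF w] free_alg_zero]
      by (auto simp: fixset_def dom_act_def)
    then show ?thesis by (simp add: trace_zero wval_def cylval_empty)
  next
    fix p q assume pq: "is_path G p" "is_path G q" "path_rng G p = path_rng G q"
      "dom_act G w = cyl G q" "act G w q = Some p"
      "mono w - mono (pq_word p q) \<in> (lpa_ideal G :: ('v,'e,'k) fa set)"
    then have "(cls G (mono w) :: ('v,'e,'k) fa set) = cls G (mono (pq_word p q))"
      using cls_eq_iff[OF free_alg_mono[OF w] free_alg_pq_word] by blast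
    also have "t \<dots> = (if p = q then ?\<delta> (path_rng G p) else 0)"
      using canonical pq multL_pathL_starL[OF pq(1,2)] path_rng_in_verts[OF pq(1)]
      unfolding lpa_canonical_def by (metis \<delta>)
    also have "\<dots> = wval (\<lambda>q. ?\<delta> (path_rng G q)) w"
      by (simp add: wval_def fixset_live[OF pq(4,5,2)] cylval_cyl pq(2) cylval_empty)
    finally show ?thesis .
  qed
  then show ?thesis
    unfolding trace_expand[OF f] tr_def lin_def using free_alg_word[OF f]
    by (intro sum.cong) auto
qed

lemma trace_sum_of_squares:
  assumes "set zs \<subseteq> LPA G"
  defines "X \<equiv> foldr (\<lambda>z acc. addL G (multL G z (starL G invK z)) acc) zs (zeroL G)"
  shows "X \<in> LPA G" "t X = (\<Sum>z\<leftarrow>zs. t (multL G z (starL G invK z)))"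
proof -
  have "X \<in> LPA G \<and> t X = (\<Sum>z\<leftarrow>zs. t (multL G z (starL G invK z)))"
    using assms(1) unfolding X_def
  proof (induction zs)
    case Nil
    show ?case by (simp add: zeroL_def fzero_eq trace_zero cls_in_LPA free_alg_zero)
  next
    case (Cons z zs)
    obtain f where f: "f \<in> free_alg G" "z = cls G f" using Cons.prems by (auto elim: LPA_cases)
    obtain g where g: "g \<in> free_alg G"
      "foldr (\<lambda>z acc. addL G (multL G z (starL G invK z)) acc) zs (zeroL G) = cls G g"
      using Cons by (auto elim: LPA_cases)
    have z: "multL G z (starL G invK z) = cls G (fmul f (fstar invK f))"
      by (simp add: f starL_cls[OF invol] multL_cls free_alg_star[OF invol])
    have "fmul f (fstar invK f) \<in> free_alg G"
      using f by (simp add: free_alg_mul free_alg_star[OF invol])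
    then show ?case
      using Cons g by (simp add: z addL_cls cls_in_LPA free_alg_add trace_add)
  qed
  then show "X \<in> LPA G" "t X = (\<Sum>z\<leftarrow>zs. t (multL G z (starL G invK z)))" by blast+
qed

end

lemma multL_starL:
  assumes "f \<in> free_alg G"
  shows "multL G (cls G f) (starL G invK (cls G f)) = (cls G (fmul f (fstar invK f)) :: ('v,'e,'k) fa set)"
  by (simp add: assms starL_cls[OF invol] multL_cls free_alg_star[OF invol])

lemma nonnegL_square:
  assumes f: "f \<in> free_alg G"
  shows "nonnegL G invK (cls G (fmul f (fstar invK f)))"
  unfolding nonnegL_def
  using f by (intro exI[of _ "[cls G f]"])
    (simp add: cls_in_LPA multL_starL zeroL_def fzero_eq addL_cls free_alg_zero free_alg_mul free_alg_star[OF invol])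

text \<open>Both conditions evaluate \<open>t\<close> at the gap element of \<open>tr_gap\<close>.
  For all edges at a regular vertex it is 0 by (CK2), which gives the graph trace equation; for a
  finite set \<open>I\<close> its trace is that of the square \<open>g g*\<close>, which is
  nonnegative.\<close>

lemma trace_restrict_positive:
  assumes t: "lpa_trace G t" "lpa_Klinear G smul t" "lpa_canonical G invK t"
    and pos: "lpa_positive G invK star t"
  shows "positive_graph_trace G star (restrict_E0 G t)"
proof -
  let ?\<delta> = "restrict_E0 G t"
  note t_eq = canonical_trace_eq_tr[OF t]
  have "?\<delta> v = (\<Sum>e\<in>out_edges G v. ?\<delta> (rng G e))" if v: "regular G v" for v
  proof -
    let ?g = "mono [Vx v] - (\<Sum>e\<in>out_edges G v. mono [Ex e, Gx e]) :: ('v,'e,'k) fa"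
    have reg: "v \<in> verts G" "finite (out_edges G v)" using v by (auto simp: regular_def)
    have "cls G ?g = cls G 0"
      using cls_eq_iff[OF tr_gap(1)[OF reg order_refl] free_alg_zero] ideal_CK2[OF v] by simp
    then have "tr ?\<delta> ?g = 0"
      using t_eq[OF tr_gap(1)[OF reg order_refl]] trace_zero[OF t(1,2)] by simp
    then show ?thesis using tr_gap(2)[OF reg order_refl, of ?\<delta>] by simp
  qed
  moreover have "nonnegR star (?\<delta> v - (\<Sum>e\<in>I. ?\<delta> (rng G e)))"
    if v: "v \<in> verts G" and I: "finite I" "I \<subseteq> out_edges G v" for v I
  proof -
    let ?g = "mono [Vx v] - (\<Sum>e\<in>I. mono [Ex e, Gx e]) :: ('v,'e,'k) fa"
    note g = tr_gap(1)[OF v I]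
    have gg: "fmul ?g (fstar invK ?g) \<in> free_alg G"
      using g by (simp add: free_alg_mul free_alg_star[OF invol])
    have "nonnegR star (t (cls G (fmul ?g (fstar invK ?g))))"
      using pos nonnegL_square[OF g] cls_in_LPA[OF gg] unfolding lpa_positive_def by blast
    then show ?thesis unfolding t_eq[OF gg] tr_gap(3)[OF v I] .
  qed
  ultimately show ?thesis
    unfolding positive_graph_trace_def graph_trace_def geR_def by blast
qed

text \<open>\<open>restrict\<close> fixes the values outside the algebra, so that traces equal on
  \<open>LPA G\<close> are equal as functions; \<open>trL_cls\<close> shows independence of the
  representative.\<close>

definition trL :: "('v \<Rightarrow> 'r) \<Rightarrow> ('v,'e,'k) fa set \<Rightarrow> 'r" where
  "trL \<delta> = restrict (\<lambda>X. tr \<delta> (rep X)) (LPA G)"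

context
  fixes \<delta> :: "'v \<Rightarrow> 'r"
  assumes \<delta>: "graph_trace G \<delta>"
begin

lemma trL_cls: "f \<in> free_alg G \<Longrightarrow> trL \<delta> (cls G f) = tr \<delta> f"
  using tr_ideal[OF \<delta> rep_cls(2), of f] rep_cls(1)[of f G] by (simp add: trL_def cls_in_LPA tr_diff)

lemma trL_trace: "lpa_trace G (trL \<delta>)"
  unfolding lpa_trace_def
proof (intro conjI ballI)
  fix X Y :: "('v,'e,'k) fa set" assume X: "X \<in> LPA G" and Y: "Y \<in> LPA G"
  obtain f where f: "f \<in> free_alg G" "X = cls G f" using X by (rule LPA_cases)
  obtain g where g: "g \<in> free_alg G" "Y = cls G g" using Y by (rule LPA_cases)
  show "trL \<delta> (addL G X Y) = trL \<delta> X + trL \<delta> Y"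
    using f g by (simp add: addL_cls trL_cls free_alg_add tr_add)
  show "trL \<delta> (multL G X Y) = trL \<delta> (multL G Y X)"
    using f g by (simp add: multL_cls trL_cls free_alg_mul tr_fmul_commute[of f g])
qed

lemma trL_Klinear: "lpa_Klinear G smul (trL \<delta>)"
  unfolding lpa_Klinear_def
proof (intro allI ballI)
  fix a and X :: "('v,'e,'k) fa set" assume "X \<in> LPA G"
  then obtain f where "f \<in> free_alg G" "X = cls G f" by (rule LPA_cases)
  then show "trL \<delta> (smulL G a X) = smul a (trL \<delta> X)"
    by (simp add: smulL_cls trL_cls free_alg_smul tr_smul)
qed

lemma trL_vertL: "v \<in> verts G \<Longrightarrow> trL \<delta> (vertL G v) = \<delta> v"
  by (simp add: vertL_def trL_cls free_alg_mono tr_vertex)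

lemma trL_path:
  assumes "is_path G p" "is_path G q" "path_rng G p = path_rng G q"
  shows "trL \<delta> (multL G (pathL G p) (starL G invK (pathL G q))) = (if p = q then \<delta> (path_rng G p) else 0)"
  using assms by (simp add: multL_pathL_starL trL_cls free_alg_pq_word tr_mono wval_pq_word)

lemma trL_canonical: "lpa_canonical G invK (trL \<delta>)"
  unfolding lpa_canonical_def by (simp add: trL_path trL_vertL path_rng_in_verts)

lemma trL_extensional: "trL \<delta> \<in> extensional (LPA G)"
  by (simp add: trL_def)

lemma restrict_trL: "\<delta> \<in> extensional (verts G) \<Longrightarrow> restrict_E0 G (trL \<delta>) = \<delta>"
  by (rule extensionalityI[of _ "verts G"]) (simp_all add: restrict_E0_def trL_vertL)

lemma trL_square: "f \<in> free_alg G \<Longrightarrow>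
    trL \<delta> (multL G (cls G f) (starL G invK (cls G f))) = tr \<delta> (fmul f (fstar invK f))"
  by (simp add: multL_starL trL_cls free_alg_mul free_alg_star[OF invol])

end

lemma trL_square_nonneg:
  assumes \<delta>: "positive_graph_trace G star \<delta>" and z: "z \<in> LPA G"
  shows "nonnegR star (trL \<delta> (multL G z (starL G invK z)))"
proof -
  have gt: "graph_trace G \<delta>" using \<delta> by (simp add: positive_graph_trace_def)
  obtain f where "f \<in> free_alg G" "z = cls G f" using z by (rule LPA_cases)
  then show ?thesis using tr_square_nonneg[OF \<delta>] by (simp add: trL_square[OF gt])
qed

lemma trL_positive:
  assumes \<delta>: "positive_graph_trace G star \<delta>"
  shows "lpa_positive G invK star (trL \<delta>)"
  unfolding lpa_positive_def nonnegL_def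
proof (intro ballI impI, elim exE conjE)
  have gt: "graph_trace G \<delta>" using \<delta> by (simp add: positive_graph_trace_def)
  fix X :: "('v,'e,'k) fa set" and zs assume zs: "set zs \<subseteq> LPA G"
    and X: "X = foldr (\<lambda>z acc. addL G (multL G z (starL G invK z)) acc) zs (zeroL G)"
  show "nonnegR star (trL \<delta> X)"
    unfolding X trace_sum_of_squares(2)[OF trL_trace[OF gt] trL_Klinear[OF gt] zs]
    using zs by (intro nonneg_sum_list) (auto intro!: trL_square_nonneg[OF \<delta>])
qed

text \<open>A nonnegative element is a list of squares. If its trace is 0, each square has trace 0
  by positive definiteness, so each factor has its representative in the ideal by
  \<open>tr_square_eq_0\<close>, and the element itself is 0.\<close>

lemma trL_faithful:
  assumes pd: "positive_definite star" and \<delta>: "faithful_graph_trace G star \<delta>"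
  shows "lpa_faithful G invK star (trL \<delta>)"
  unfolding lpa_faithful_def
proof (intro ballI impI)
  have pos: "positive_graph_trace G star \<delta>" using \<delta> by (simp add: faithful_graph_trace_def)
  then have gt: "graph_trace G \<delta>" by (simp add: positive_graph_trace_def)
  fix X :: "('v,'e,'k) fa set" assume X: "X \<in> LPA G" "posL G invK X"
  then have nonneg: "nonnegR star (trL \<delta> X)"
    using trL_positive[OF pos] by (simp add: lpa_positive_def posL_def)
  have "trL \<delta> X \<noteq> 0"
  proof
    assume zero: "trL \<delta> X = 0"
    obtain zs where zs: "set zs \<subseteq> LPA G"
      and X_eq: "X = foldr (\<lambda>z acc. addL G (multL G z (starL G invK z)) acc) zs (zeroL G)"
      using X by (auto simp: posL_def nonnegL_def)
    have sum0: "(\<Sum>z\<leftarrow>zs. trL \<delta> (multL G z (starL G invK z))) = 0"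
      using zero trace_sum_of_squares(2)[OF trL_trace[OF gt] trL_Klinear[OF gt] zs] by (simp add: X_eq)
    have "foldr (\<lambda>z acc. addL G (multL G z (starL G invK z)) acc) zs (zeroL G) = zeroL G"
      using zs sum0
    proof (induction zs)
      case (Cons z zs)
      have sq: "nonnegR star (trL \<delta> (multL G y (starL G invK y)))" if "y \<in> set (z # zs)" for y
        using Cons.prems that by (intro trL_square_nonneg[OF pos]) auto
      have rest: "nonnegR star (\<Sum>z\<leftarrow>zs. trL \<delta> (multL G z (starL G invK z)))"
        using sq by (intro nonneg_sum_list) auto
      have z0: "trL \<delta> (multL G z (starL G invK z)) = 0"
        using nonneg_add_eq_0[OF pd sq rest] Cons.prems by simp
      have "z \<in> LPA G" using Cons.prems by simp
      then obtain f where f: "f \<in> free_alg G" "z = cls G f" by (rule LPA_cases)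
      then have "f \<in> lpa_ideal G"
        using z0 tr_square_eq_0[OF pd \<delta>] by (simp add: trL_square[OF gt])
      then have "fmul f (fstar invK f) \<in> lpa_ideal G"
        using f by (intro lpa_ideal.rmul free_alg_star[OF invol])
      then have "cls G (fmul f (fstar invK f)) = cls G 0"
        using f by (subst cls_eq_iff) (simp_all add: free_alg_mul free_alg_star[OF invol] free_alg_zero)
      then show ?case
        using Cons z0 f by (simp add: multL_starL zeroL_def fzero_eq addL_cls free_alg_zero)
    qed simp
    then show False using X X_eq by (simp add: posL_def)
  qed
  with nonneg show "posR star (trL \<delta> X)" by (simp add: posR_def)
qed

text \<open>Faithfulness speaks of nonzero elements; the remaining element 0 has trace 0 by
  linearity.\<close>

lemma faithful_imp_positive:
  assumes "lpa_trace G t" "lpa_Klinear G smul t" "lpa_faithful G invK star t"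
  shows "lpa_positive G invK star t"
  unfolding lpa_positive_def
proof (intro ballI impI)
  fix X assume X: "X \<in> LPA G" "nonnegL G invK X"
  show "nonnegR star (t X)"
  proof (cases "X = zeroL G")
    case True
    then show ?thesis
      using trace_zero[OF assms(1,2)] by (simp add: zeroL_def fzero_eq nonneg_0)
  next
    case False
    then show ?thesis using assms(3) X by (simp add: lpa_faithful_def posL_def posR_def)
  qed
qed

text \<open>In the algebra \<open>v = v v*\<close> is a square, and it is nonzero by
  \<open>vertex_nonzero\<close>, so faithfulness applies to it.\<close>

lemma trace_restrict_faithful:
  assumes t: "lpa_trace G t" "lpa_Klinear G smul t" "lpa_canonical G invK t"
    and faithful: "lpa_faithful G invK star t"
  shows "faithful_graph_trace G star (restrict_E0 G t)"
  unfolding faithful_graph_trace_def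
proof (intro conjI ballI)
  show "positive_graph_trace G star (restrict_E0 G t)"
    by (intro trace_restrict_positive t faithful_imp_positive faithful)
  fix v assume v: "v \<in> verts G"
  let ?v = "mono [Vx v] :: ('v,'e,'k) fa"
  have v_free: "?v \<in> free_alg G" using v by (intro free_alg_mono) simp_all
  have "fmul ?v (fstar invK ?v) = mono [Vx v, Vx v]"
    by (simp add: fstar_mono[OF invol] word_star_def fmul_mono_mono)
  moreover have "cls G (mono [Vx v, Vx v]) = cls G ?v"
    using v v_free ideal_V[OF v] by (subst cls_eq_iff) (auto intro: free_alg_mono)
  ultimately have "nonnegL G invK (vertL G v)"
    using nonnegL_square[OF v_free] by (simp add: vertL_def)
  moreover have "vertL G v \<noteq> (zeroL G :: ('v,'e,'k) fa set)"
    using vertex_nonzero[OF v] cls_eq_iff[OF v_free free_alg_zero]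
    by (simp add: vertL_def zeroL_def fzero_eq)
  ultimately have "posR star (t (vertL G v))"
    using faithful cls_in_LPA[OF v_free] by (simp add: lpa_faithful_def posL_def vertL_def)
  then show "posR star (restrict_E0 G t v)" using v by (simp add: restrict_E0_def)
qed

lemma canonical_trace_unique:
  assumes "t \<in> extensional (LPA G)" "lpa_trace G t" "lpa_Klinear G smul t" "lpa_canonical G invK t"
    and \<delta>: "graph_trace G \<delta>" "\<And>v. v \<in> verts G \<Longrightarrow> t (vertL G v) = \<delta> v"
  shows "t = trL \<delta>"
proof (rule extensionalityI[OF assms(1) trL_extensional[OF \<delta>(1)]])
  fix X :: "('v,'e,'k) fa set" assume "X \<in> LPA G"
  then obtain f where f: "f \<in> free_alg G" "X = cls G f" by (rule LPA_cases)
  have "tr (restrict_E0 G t) = tr \<delta>"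
    by (rule tr_cong) (simp add: restrict_E0_def \<delta>)
  then show "t X = trL \<delta> X"
    using canonical_trace_eq_tr[OF assms(2-4) f(1)] trL_cls[OF \<delta>(1) f(1)] f(2) by simp
qed

text \<open>With \<open>p = q\<close> the trivial path at \<open>v\<close>, canonicity and the
  prescribed values evaluate the same element \<open>v v*\<close>.\<close>

lemma path_values_vertex:
  assumes "lpa_canonical G invK t" "v \<in> verts G"
    and "\<forall>p q. is_path G p \<longrightarrow> is_path G q \<longrightarrow> path_rng G p = path_rng G q \<longrightarrow>
      t (multL G (pathL G p) (starL G invK (pathL G q))) = (if p = q then \<delta> (path_rng G p) else 0)"
  shows "t (vertL G v) = \<delta> v"
proof -
  have "is_path G (v, [])" using assms(2) by simp
  then show ?thesis using assms(1,3) unfolding lpa_canonical_def by (metis path_rng_Nil)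
qed

end

theorem theorem3p6:
  fixes G :: "('v,'e) graph"
    and invK :: "'k::field \<Rightarrow> 'k"
    and smul :: "'k \<Rightarrow> 'r::ring \<Rightarrow> 'r"
    and star :: "'r \<Rightarrow> 'r"
  assumes "wf_graph G"
    and "field_involution invK"
    and "involutive_algebra invK smul star"
  shows
    "bij_betw (restrict_E0 G)
       {t. t \<in> extensional (LPA G) \<and> lpa_trace G t \<and> lpa_Klinear G smul t \<and>
           lpa_canonical G invK t \<and> lpa_positive G invK star t}
       {\<delta>. \<delta> \<in> extensional (verts G) \<and> positive_graph_trace G star \<delta>}
     \<and> (\<forall>\<delta>. \<delta> \<in> extensional (verts G) \<and> positive_graph_trace G star \<delta> \<longrightarrow>
          (\<exists>!t. t \<in> extensional (LPA G) \<and> lpa_trace G t \<and> lpa_Klinear G smul t \<and>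
                lpa_canonical G invK t \<and>
                (\<forall>p q. is_path G p \<longrightarrow> is_path G q \<longrightarrow> path_rng G p = path_rng G q \<longrightarrow>
                   t (multL G (pathL G p) (starL G invK (pathL G q))) =
                   (if p = q then \<delta> (path_rng G p) else 0)))
          \<and> (\<forall>t. t \<in> extensional (LPA G) \<and> lpa_trace G t \<and> lpa_Klinear G smul t \<and>
                lpa_canonical G invK t \<and> lpa_positive G invK star t \<and>
                restrict_E0 G t = \<delta> \<longrightarrow>
                (\<forall>p q. is_path G p \<longrightarrow> is_path G q \<longrightarrow> path_rng G p = path_rng G q \<longrightarrow>
                   t (multL G (pathL G p) (starL G invK (pathL G q))) =
                   (if p = q then \<delta> (path_rng G p) else 0))))
     \<and> (positive_definite star \<longrightarrow>
        bij_betw (restrict_E0 G)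
          {t. t \<in> extensional (LPA G) \<and> lpa_trace G t \<and> lpa_Klinear G smul t \<and>
              lpa_canonical G invK t \<and> lpa_faithful G invK star t}
          {\<delta>. \<delta> \<in> extensional (verts G) \<and> faithful_graph_trace G star \<delta>})"
proof -
  interpret leavitt_target G invK smul star
    using assms by unfold_locales
  let ?T = "{t. t \<in> extensional (LPA G) \<and> lpa_trace G t \<and> lpa_Klinear G smul t \<and> lpa_canonical G invK t}"
  have restrict_ext: "restrict_E0 G t \<in> extensional (verts G)" for t :: "('v,'e,'k) fa set \<Rightarrow> 'r"
    by (simp add: restrict_E0_def)
  have trL_in: "trL \<delta> \<in> ?T" if "graph_trace G \<delta>" for \<delta>
    using that by (simp add: trL_extensional trL_trace trL_Klinear trL_canonical)
  have trL_restrict: "trL (restrict_E0 G t) = t"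
    if "t \<in> ?T" "graph_trace G (restrict_E0 G t)" for t
    using that by (intro canonical_trace_unique[symmetric]) (simp_all add: restrict_E0_def)
  have gt: "graph_trace G \<delta>" if "positive_graph_trace G star \<delta>" for \<delta>
    using that by (simp add: positive_graph_trace_def)
  have pos: "positive_graph_trace G star \<delta>" if "faithful_graph_trace G star \<delta>" for \<delta>
    using that by (simp add: faithful_graph_trace_def)
  have A: "bij_betw (restrict_E0 G)
      {t. t \<in> extensional (LPA G) \<and> lpa_trace G t \<and> lpa_Klinear G smul t \<and>
          lpa_canonical G invK t \<and> lpa_positive G invK star t}
      {\<delta>. \<delta> \<in> extensional (verts G) \<and> positive_graph_trace G star \<delta>}"
    \<comment> \<open>\<open>trL\<close> is the inverse map: one composite is
      \<open>restrict_trL\<close>, the other is \<open>trL_restrict\<close>, which rests on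
      uniqueness.\<close>
    by (rule bij_betwI[where g = trL])
      (use trL_in trL_restrict gt restrict_ext in
        \<open>auto simp: trL_positive restrict_trL intro: trace_restrict_positive\<close>)
  have B: "\<exists>!t. t \<in> extensional (LPA G) \<and> lpa_trace G t \<and> lpa_Klinear G smul t \<and> lpa_canonical G invK t \<and>
      (\<forall>p q. is_path G p \<longrightarrow> is_path G q \<longrightarrow> path_rng G p = path_rng G q \<longrightarrow>
         t (multL G (pathL G p) (starL G invK (pathL G q))) = (if p = q then \<delta> (path_rng G p) else 0))"
    if "positive_graph_trace G star \<delta>" for \<delta>
  proof (rule ex1I[of _ "trL \<delta>"], goal_cases)
    case 1
    show ?case using trL_in[OF gt[OF that]] trL_path[OF gt[OF that]] by blast
  next
    case (2 t)
    then show ?case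
      \<comment> \<open>The prescribed values on trivial paths recover \<open>\<delta>\<close> on
        the vertices, which is all that uniqueness asks for.\<close>
      by (intro canonical_trace_unique gt that path_values_vertex) blast+
  qed
  have C: "t (multL G (pathL G p) (starL G invK (pathL G q))) = (if p = q then \<delta> (path_rng G p) else 0)"
    if "lpa_canonical G invK t" "restrict_E0 G t = \<delta>"
      "is_path G p" "is_path G q" "path_rng G p = path_rng G q" for t \<delta> p q
  proof -
    have "t (multL G (pathL G p) (starL G invK (pathL G q))) = (if p = q then t (vertL G (path_rng G p)) else 0)"
      using that(1,3-5) unfolding lpa_canonical_def by blast
    then show ?thesis
      using path_rng_in_verts[OF that(3)] by (auto simp: that(2)[symmetric] restrict_E0_def)
  qed
  have trL_restrict': "trL (restrict_E0 G t) = t" if "t \<in> ?T" "lpa_faithful G invK star t" for t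
    using that by (intro trL_restrict gt pos trace_restrict_faithful) simp_all
  have D: "bij_betw (restrict_E0 G)
      {t. t \<in> extensional (LPA G) \<and> lpa_trace G t \<and> lpa_Klinear G smul t \<and>
          lpa_canonical G invK t \<and> lpa_faithful G invK star t}
      {\<delta>. \<delta> \<in> extensional (verts G) \<and> faithful_graph_trace G star \<delta>}"
    if pd: "positive_definite star"
    by (rule bij_betwI[where g = trL])
      (use trL_in trL_restrict' gt pos restrict_ext in
        \<open>auto simp: trL_faithful[OF pd] restrict_trL intro: trace_restrict_faithful\<close>)
  show ?thesis
  proof (intro conjI allI impI, goal_cases)
    case 1
    show ?case by (rule A)
  next
    case (2 \<delta>)
    then show ?case by (intro B) blast
  next
    case (3 \<delta> t p q)
    then show ?case by (intro C) blast+
  next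
    case 4
    then show ?case by (rule D)
  qed
qed

end
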